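(* Let $\Lambda\ge\lambda>0$ and let $M,E>0$ be constants. Suppose $A(x,t)=(a^{ij}(x,t))_{i,j=1}^n$ is a real symmetric matrix-valued function on $\mathbb{R}^n_+\times(0,1)$ such that for all $(x,t)\in\mathbb{R}^n_+\times(0,1)$ $$\lambda|\xi|^2\le\sum_{i,j}a^{ij}(x,t)\xi_i\xi_j\le\Lambda|\xi|^2\quad\forall\,\xi\in\mathbb{R}^n,$$ $$|\nabla_xa^{ij}(x,t)|+|\partial_ta^{ij}(x,t)|\le M,\qquad|\nabla_xa^{ij}(x,t)|\le\frac{E}{|x|}.$$ Let $P=\partial_t+\sum_{i,j}\partial_i(a^{ij}\partial_j)$, let $Q=\{(x,t): x_n\ge1,\ t\in(0,1)\}$ and $$\psi(x)=|x|^2-2\frac{\Lambda}{\lambda}|x|x_n+2\Big(\frac{\Lambda}{\lambda}\Big)^2x_n^2.$$ Then there exist positive constants $E_0=E_0(n,\Lambda,\lambda)$, $\alpha=\alpha(n,\Lambda,\lambda,E)\in(1,2)$, $b=b(\Lambda,\lambda)$ and $K=K(n,\Lambda,\lambda,M,E)$, each depending only on the quantities indicated, such that when $E<E_0$, for any function $u\in C_0^\infty(Q)$ and any number $\gamma>0$, $$\int_Qe^{2\gamma(t^{-K}-1)x_n^\alpha-\frac{b\psi(x)+K}{t}}\left(|u|^2+|\nabla u|^2\right)dx\,dt\le\int_Qe^{2\gamma(t^{-K}-1)x_n^\alpha-\frac{b\psi(x)+K}{t}}|Pu|^2\,dx\,dt.$$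
   Context: $\mathbb{R}^n_+=\{x\in\mathbb{R}^n:x_n>0\}$. $\nabla=\nabla_x$ is the gradient in the space variable $x$, $\partial_i=\partial/\partial x_i$. The coefficients $a^{ij}$ are Lipschitz and the bounds on their first derivatives are understood accordingly (i.e. almost everywhere). $C_0^\infty(Q)$ denotes the smooth functions on $\mathbb{R}^n\times(0,1)$ with compact support contained in $Q$ (so all derivatives vanish on $x_n=1$). *)

theory Defs
  imports "HOL-Analysis.Analysis"
begin

text \<open>
  The constant \<open>b\<close> of the theorem must not depend on the dimension, so the dimension \<open>n\<close> has to be
  quantified inside the formula.  Points of n-dimensional space are therefore functions
  \<open>nat \<Rightarrow> real\<close> on the index set \<open>{1..n}\<close>, extensional (\<open>undefined\<close>) outside of it; this set is
  the space of the product measure \<open>Pi\<^sub>M {1..n} (\<lambda>_. lborel)\<close>, and on it the product topology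
  of \<open>nat \<Rightarrow> real\<close> is the Euclidean one.  The Euclidean norm is \<open>L2_set x {1..n}\<close>.  (The metric that
  the library puts on \<open>nat \<Rightarrow> real\<close> is not Euclidean and is not used.)
\<close>

type_synonym point = "(nat \<Rightarrow> real) \<times> real"

definition Rn :: "nat \<Rightarrow> (nat \<Rightarrow> real) set" where
  "Rn n = ({1..n} \<rightarrow>\<^sub>E UNIV)"

definition Rn_plus :: "nat \<Rightarrow> (nat \<Rightarrow> real) set" where
  "Rn_plus n = {x \<in> Rn n. x n > 0}"

definition spacetime_measure :: "nat \<Rightarrow> point measure" where
  "spacetime_measure n = Pi\<^sub>M {1..n} (\<lambda>_. lborel) \<Otimes>\<^sub>M lborel"

definition Q_set :: "nat \<Rightarrow> point set" where
  "Q_set n = {x \<in> Rn n. x n \<ge> 1} \<times> {0<..<1}"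

definition partial_x :: "nat \<Rightarrow> (point \<Rightarrow> real) \<Rightarrow> point \<Rightarrow> real" where
  "partial_x i f = (\<lambda>(x, t). deriv (\<lambda>s. f (x(i := s), t)) (x i))"

definition partial_t :: "(point \<Rightarrow> real) \<Rightarrow> point \<Rightarrow> real" where
  "partial_t f = (\<lambda>(x, t). deriv (\<lambda>s. f (x, s)) t)"

definition has_partials_at :: "nat \<Rightarrow> (point \<Rightarrow> real) \<Rightarrow> point \<Rightarrow> bool" where
  "has_partials_at n f = (\<lambda>(x, t).
     (\<forall>i\<in>{1..n}. (\<lambda>s. f (x(i := s), t)) field_differentiable (at (x i))) \<and>
     (\<lambda>s. f (x, s)) field_differentiable (at t))"

definition grad_norm :: "nat \<Rightarrow> (point \<Rightarrow> real) \<Rightarrow> point \<Rightarrow> real" where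
  "grad_norm n f p = L2_set (\<lambda>i. partial_x i f p) {1..n}"

primrec C_k :: "nat \<Rightarrow> nat \<Rightarrow> (point \<Rightarrow> real) \<Rightarrow> bool" where
  "C_k n 0 f \<longleftrightarrow> continuous_on (Rn n \<times> {0<..<1}) f"
| "C_k n (Suc k) f \<longleftrightarrow>
     continuous_on (Rn n \<times> {0<..<1}) f \<and>
     (\<forall>p \<in> Rn n \<times> {0<..<1}. has_partials_at n f p) \<and>
     (\<forall>i\<in>{1..n}. C_k n k (partial_x i f)) \<and> C_k n k (partial_t f)"

definition test_function :: "nat \<Rightarrow> (point \<Rightarrow> real) \<Rightarrow> bool" where
  "test_function n u \<longleftrightarrow>
     (\<forall>k. C_k n k u) \<and>
     compact (closure {p \<in> Rn n \<times> {0<..<1}. u p \<noteq> 0}) \<and>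
     closure {p \<in> Rn n \<times> {0<..<1}. u p \<noteq> 0} \<subseteq> Q_set n"

definition lipschitz_coeff :: "nat \<Rightarrow> (point \<Rightarrow> real) \<Rightarrow> bool" where
  "lipschitz_coeff n f \<longleftrightarrow>
     (\<exists>L. \<forall>x \<in> Rn_plus n. \<forall>y \<in> Rn_plus n. \<forall>t \<in> {0<..<1}. \<forall>s \<in> {0<..<1}.
        \<bar>f (x, t) - f (y, s)\<bar> \<le> L * sqrt ((L2_set (\<lambda>i. x i - y i) {1..n})\<^sup>2 + (t - s)\<^sup>2))"

text \<open>
  For Lipschitz \<open>a\<close> the outer derivatives exist almost everywhere only, and \<open>parabolic_op n a u\<close>
  is meaningful up to a null set.
\<close>

definition parabolic_op ::
  "nat \<Rightarrow> (nat \<Rightarrow> nat \<Rightarrow> point \<Rightarrow> real) \<Rightarrow> (point \<Rightarrow> real) \<Rightarrow> point \<Rightarrow> real" where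
  "parabolic_op n a u p =
     partial_t u p +
     (\<Sum>i=1..n. \<Sum>j=1..n. partial_x i (\<lambda>q. a i j q * partial_x j u q) p)"

definition psi :: "nat \<Rightarrow> real \<Rightarrow> real \<Rightarrow> (nat \<Rightarrow> real) \<Rightarrow> real" where
  "psi n Lam lam x =
     (L2_set x {1..n})\<^sup>2 - 2 * (Lam / lam) * L2_set x {1..n} * x n + 2 * (Lam / lam)\<^sup>2 * (x n)\<^sup>2"

definition carleman_weight ::
  "nat \<Rightarrow> real \<Rightarrow> real \<Rightarrow> real \<Rightarrow> real \<Rightarrow> real \<Rightarrow> real \<Rightarrow> point \<Rightarrow> real" where
  "carleman_weight n Lam lam \<alpha> b K \<gamma> = (\<lambda>(x, t).
     exp (2 * \<gamma> * (t powr (-K) - 1) * x n powr \<alpha> - (b * psi n Lam lam x + K) / t))"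

end

theory Submission
  imports Defs
begin

text \<open>Take \<open>\<alpha> = 3/2\<close> and write the weight as \<open>exp (2 \<phi>)\<close>. With \<open>v = exp \<phi> u\<close>, \<open>B = A \<nabla>\<phi>\<close> and
  \<open>W = B \<bullet> \<nabla>\<phi> - \<partial>\<^sub>t \<phi>\<close>, conjugation turns \<open>exp \<phi> P u\<close> into
  \<open>(div (A \<nabla>v) + W v) + R v + (\<partial>\<^sub>t v - 2 B \<bullet> \<nabla>v - F v)\<close> with \<open>R = F - div B\<close>. Choosing the explicit
  multiplier \<open>F = (3/4 a\<^sub>n\<^sub>n + c) g / sqrt x\<^sub>n + \<Theta> / t\<close>, where \<open>g = \<gamma> (t powr (-K) - 1)\<close>, instead of \<open>div B\<close>
  means that the merely bounded derivatives of the coefficients are never differentiated again. Twice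
  the product of the first and the last bracket is a divergence plus a quadratic form in \<open>(v, \<nabla>v)\<close>.

  The form is positive, even after \<open>R\<^sup>2 v\<^sup>2\<close> is subtracted: the \<open>\<nabla>v\<close> part because the Hessian of \<open>\<psi>\<close>
  enters with a small factor \<open>b\<close> and \<open>2 R A\<close> absorbs the coefficient errors, the \<open>v\<^sup>2\<close> part
  because the last component of \<open>- A \<nabla>\<psi>\<close> is at least \<open>(Lam + lam) \<bar>x\<bar>\<close> up to a multiple of \<open>x\<^sub>n\<close>,
  which \<open>\<partial>\<^sub>t\<^sup>2 \<phi>\<close> dominates for large \<open>K\<close>. The divergence integrates to zero since
  its fields are Lipschitz with compact support.\<close>

section \<open>Partial derivatives and translations on space-time\<close>

text \<open>For \<open>alpha = 3/2\<close> the part \<open>g x_n^(3/2)\<close> of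
  \<open>\<phi>\<close> has a gradient of size \<open>g sqrt x_n\<close> but a Hessian of size only
  \<open>g / sqrt x_n\<close>, and this Hessian has rank one. Two obstacles follow. A derivative of
  the coefficients multiplied by \<open>\<nabla>\<phi>\<close> is comparable with the Hessian only
  if it decays; the bound \<open>E / |x|\<close> provides the missing factor, and small
  \<open>E\<close> lets \<open>c g / sqrt x_n\<close> win. Moreover convexity in the single
  direction \<open>x_n\<close> gives no control of the tangential derivatives of \<open>v\<close>.
  The surplus \<open>c g / sqrt x_n + \<Theta> / t\<close> of \<open>F\<close> over the trace
  supplies it, but costs \<open>2 R A \<nabla>\<phi> . \<nabla>\<phi>\<close> in the coefficient of
  \<open>v\<^sup>2\<close>. The share of this cost that carries \<open>c\<close> is paid by the
  rank-one Hessian at \<open>\<nabla>\<phi>\<close>, that is by the square of the last component of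
  \<open>A \<nabla>\<phi>\<close>, which must therefore control all of
  \<open>|\<nabla>\<phi>|\<close>. For \<open>|x|\<^sup>2\<close> alone that component has no sign;
  the cross term \<open>|x| x_n\<close> in \<open>\<psi>\<close> gives it one.\<close>

text \<open>Coordinate \<open>0\<close> is time and the coordinates \<open>1, \<dots>, n\<close> are the space variables, so that \<open>pd\<close> treats
  \<open>partial_t\<close> and \<open>partial_x\<close> uniformly.\<close>

definition crd :: "nat \<Rightarrow> point \<Rightarrow> real" where
  "crd i p = (if i = 0 then snd p else fst p i)"

definition upd :: "nat \<Rightarrow> real \<Rightarrow> point \<Rightarrow> point" where
  "upd i s p = (if i = 0 then (fst p, s) else ((fst p)(i := s), snd p))"

definition has_pd :: "nat \<Rightarrow> (point \<Rightarrow> real) \<Rightarrow> point \<Rightarrow> real \<Rightarrow> bool" where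
  "has_pd i f p d \<longleftrightarrow> ((\<lambda>s. f (upd i s p)) has_real_derivative d) (at (crd i p))"

definition pd :: "nat \<Rightarrow> (point \<Rightarrow> real) \<Rightarrow> point \<Rightarrow> real" where
  "pd i f p = deriv (\<lambda>s. f (upd i s p)) (crd i p)"

definition Om :: "nat \<Rightarrow> point set" where
  "Om n = Rn_plus n \<times> {0<..<1}"

lemma upd_crd [simp]: "upd i (crd i p) p = p"
  by (simp add: upd_def crd_def)

lemma upd_upd [simp]: "upd i s (upd i r p) = upd i s p"
  by (simp add: upd_def)

lemma upd_commute: "i \<noteq> j \<Longrightarrow> upd i s (upd j r p) = upd j r (upd i s p)"
  by (auto simp: upd_def fun_upd_twist)

lemma crd_upd: "crd i (upd j s p) = (if i = j then s else crd i p)"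
  by (simp add: upd_def crd_def)

lemma crd_upd_same [simp]: "crd i (upd i s p) = s"
  by (simp add: crd_upd)

lemma partial_x_pd: "i \<ge> 1 \<Longrightarrow> partial_x i f p = pd i f p"
  by (cases p) (simp add: partial_x_def pd_def upd_def crd_def)

lemma partial_t_pd: "partial_t f p = pd 0 f p"
  by (cases p) (simp add: partial_t_def pd_def upd_def crd_def)

lemma has_pd_imp_pd: "has_pd i f p d \<Longrightarrow> pd i f p = d"
  by (simp add: has_pd_def pd_def DERIV_imp_deriv)

lemma continuous_on_crd [continuous_intros]: "continuous_on S (crd i)"
proof -
  have "continuous_on S (\<lambda>p. if i = 0 then snd p else fst p i)"
    using continuous_on_product_then_coordinatewise[OF continuous_on_fst[OF continuous_on_id], of S i]
    by (cases "i = 0") (auto intro: continuous_on_snd continuous_on_id)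
  then show ?thesis by (simp add: crd_def[abs_def])
qed

lemma continuous_on_upd [continuous_intros]:
  assumes "continuous_on S f" "continuous_on S g"
  shows "continuous_on S (\<lambda>z. upd i (f z) (g z))"
proof (cases "i = 0")
  case True
  then show ?thesis using assms by (simp add: upd_def continuous_on_Pair continuous_on_fst)
next
  case False
  have "continuous_on S (\<lambda>z. (fst (g z))(i := f z))"
  proof (rule continuous_on_coordinatewise_then_product)
    fix j
    show "continuous_on S (\<lambda>z. ((fst (g z))(i := f z)) j)"
      using assms continuous_on_product_then_coordinatewise[OF continuous_on_fst[OF assms(2)], of j]
      by (cases "j = i") auto
  qed
  with False show ?thesis using assms by (simp add: upd_def continuous_on_Pair continuous_on_snd)
qed

lemma Om_iff: "p \<in> Om n \<longleftrightarrow> fst p \<in> Rn n \<and> fst p n > 0 \<and> 0 < snd p \<and> snd p < 1"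
  by (cases p) (auto simp: Om_def Rn_plus_def)

lemma Rn_upd: "1 \<le> i \<Longrightarrow> i \<le> n \<Longrightarrow> x \<in> Rn n \<Longrightarrow> x(i := s) \<in> Rn n"
  by (auto simp: Rn_def PiE_iff extensional_def)

lemma upd_Rn: "i \<le> n \<Longrightarrow> fst p \<in> Rn n \<Longrightarrow> fst (upd i s p) \<in> Rn n"
  using Rn_upd[of i n "fst p" s] by (auto simp: upd_def)

text \<open>\<open>Om n\<close> is not open in the product topology, since the coordinates outside
  \<open>{1..n}\<close> are frozen. Openness is available along the coordinate directions only,
  which is all that partial derivatives see.\<close>

lemma eventually_upd_Om:
  assumes "p \<in> Om n" "i \<le> n"
  shows "eventually (\<lambda>s. upd i s p \<in> Om n) (nhds (crd i p))"
proof -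
  define U where "U = (if i = 0 then {0<..<1} else if i = n then {0<..} else (UNIV::real set))"
  have "open U" "crd i p \<in> U" using assms by (auto simp: U_def crd_def Om_iff)
  moreover have "upd i s p \<in> Om n" if "s \<in> U" for s
    using that assms upd_Rn[of i n p s] by (auto simp: U_def Om_iff upd_def split: if_splits)
  ultimately show ?thesis using eventually_nhds by blast
qed

lemma isCont_slice:
  assumes "continuous_on (Om n) f" "p \<in> Om n" "i \<le> n"
  shows "isCont (\<lambda>s. f (upd i s p)) (crd i p)"
proof -
  obtain U where U: "open U" "crd i p \<in> U" "\<And>s. s \<in> U \<Longrightarrow> upd i s p \<in> Om n"
    using eventually_upd_Om[OF assms(2,3)] by (auto simp: eventually_nhds)
  have "continuous_on U (\<lambda>s. f (upd i s p))"
    by (rule continuous_on_compose2[OF assms(1)]) (auto intro!: continuous_intros U)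
  with U show ?thesis by (simp add: continuous_on_eq_continuous_at)
qed

section \<open>Borel sets and translation invariance of the space-time measure\<close>

lemma space_spacetime: "space (spacetime_measure n) = Rn n \<times> UNIV"
  by (simp add: spacetime_measure_def space_pair_measure space_PiM Rn_def)

lemma measurable_ident_spacetime:
  "(\<lambda>p. p) \<in> spacetime_measure n \<rightarrow>\<^sub>M (borel :: point measure)"
proof -
  have 1: "(\<lambda>x. x) \<in> Pi\<^sub>M {1..n} (\<lambda>_. lborel) \<rightarrow>\<^sub>M (borel :: (nat \<Rightarrow> real) measure)"
  proof (rule measurable_coordinatewise_then_product)
    fix i
    show "(\<lambda>x. x i) \<in> borel_measurable (Pi\<^sub>M {1..n} (\<lambda>_. lborel::real measure))"
    proof (cases "i \<in> {1..n}")
      case True then show ?thesis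
        using measurable_component_singleton[of i "{1..n}" "\<lambda>_. lborel::real measure"] by simp
    next
      case False
      have "(\<lambda>x. undefined::real) \<in> borel_measurable (Pi\<^sub>M {1..n} (\<lambda>_. lborel::real measure))" by simp
      moreover have "x i = undefined" if "x \<in> space (Pi\<^sub>M {1..n} (\<lambda>_. lborel::real measure))" for x
        using that False by (auto simp: space_PiM PiE_iff extensional_def)
      ultimately show ?thesis by (subst measurable_cong[where g = "\<lambda>_. undefined"]) blast+
    qed
  qed
  have "(\<lambda>p. (fst p, snd p)) \<in> spacetime_measure n \<rightarrow>\<^sub>M (borel \<Otimes>\<^sub>M borel :: point measure)"
    unfolding spacetime_measure_def
    by (intro measurable_Pair measurable_compose[OF measurable_fst 1]) auto
  then show ?thesis by (simp add: borel_prod)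
qed

lemma borel_measurable_spacetime:
  "f \<in> borel_measurable (borel :: point measure) \<Longrightarrow> f \<in> borel_measurable (spacetime_measure n)"
  by (rule measurable_compose[OF measurable_ident_spacetime])

lemma sets_spacetime: "A \<in> sets borel \<Longrightarrow> A \<inter> (Rn n \<times> UNIV) \<in> sets (spacetime_measure n)"
  using measurable_sets[OF measurable_ident_spacetime, of A n] by (simp add: space_spacetime)

lemma closed_Rn: "closed (Rn n)"
proof -
  have "Rn n = (\<Inter>i\<in>-{1..n}. {x. x i = undefined})"
    by (auto simp: Rn_def PiE_iff extensional_def)
  moreover have "closed {x::nat \<Rightarrow> real. x i = undefined}" for i
    by (intro closed_Collect_eq continuous_on_const continuous_on_product_then_coordinatewise[OF continuous_on_id])
  ultimately show ?thesis by auto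
qed

lemma Om_sets: "Om n \<in> sets borel"
proof -
  have eq: "Om n = (Rn n \<times> UNIV) \<inter> {p. 0 < crd 0 p} \<inter> {p. crd 0 p < 1} \<inter> {p. 0 < fst p n}"
    by (auto simp: Om_iff crd_def)
  have o: "open {p::point. 0 < crd 0 p}" "open {p::point. crd 0 p < 1}"
    by (intro open_Collect_less continuous_intros)+
  have o2: "open {p::point. 0 < fst p n}"
    by (intro open_Collect_less continuous_on_const
        continuous_on_product_then_coordinatewise[OF continuous_on_fst[OF continuous_on_id]])
  have c: "closed (Rn n \<times> (UNIV :: real set))" by (intro closed_Times closed_Rn closed_UNIV)
  show ?thesis
    by (subst eq) (rule sets.Int[OF sets.Int[OF sets.Int[OF borel_closed[OF c] borel_open[OF o(1)]]
          borel_open[OF o(2)]] borel_open[OF o2]])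
qed

definition shift :: "nat \<Rightarrow> real \<Rightarrow> point \<Rightarrow> point" where
  "shift i h p = upd i (crd i p + h) p"

lemma distr_translate: "distr lborel lborel (\<lambda>x::real. x + h) = lborel"
proof -
  have "distr lborel lborel (\<lambda>x::real. x + h) = distr lborel borel ((+) h)"
    by (rule distr_cong) auto
  then show ?thesis by (simp only: lborel_distr_plus)
qed

text \<open>A product measure is determined by its values on boxes, and the preimage of a box is a
  box with one side translated, so the invariance of one-dimensional Lebesgue measure
  suffices.\<close>

lemma distr_PiM_translate:
  assumes "finite I" "i \<in> I"
  shows "distr (Pi\<^sub>M I (\<lambda>_. lborel)) (Pi\<^sub>M I (\<lambda>_. lborel)) (\<lambda>x. x(i := x i + h)) = Pi\<^sub>M I (\<lambda>_. lborel::real measure)"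
proof -
  interpret product_sigma_finite "\<lambda>_. lborel::real measure" by standard
  have m: "(\<lambda>x. x(i := x i + h)) \<in> Pi\<^sub>M I (\<lambda>_. lborel) \<rightarrow>\<^sub>M Pi\<^sub>M I (\<lambda>_. lborel::real measure)"
    using assms by (intro measurable_fun_upd[of I I i]) auto
  show ?thesis
  proof (rule PiM_eqI)
    fix A :: "_ \<Rightarrow> real set" assume A: "\<And>i. i \<in> I \<Longrightarrow> A i \<in> sets lborel"
    define A' where "A' = A(i := (\<lambda>x. x + h) -` A i)"
    have mm: "(\<lambda>x::real. x + h) \<in> borel \<rightarrow>\<^sub>M borel" by simp
    have sA': "A' j \<in> sets lborel" if "j \<in> I" for j
      using A[OF that] measurable_sets[OF mm, of "A i"] by (auto simp: A'_def)
    have "emeasure lborel (A' i) = emeasure (distr lborel lborel (\<lambda>x::real. x + h)) (A i)"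
      using A[OF assms(2)] by (subst emeasure_distr) (auto simp: A'_def)
    then have e: "emeasure lborel (A' j) = emeasure lborel (A j)" for j
      by (cases "j = i") (auto simp: A'_def distr_translate)
    have vi: "(\<lambda>x. x(i := x i + h)) -` Pi\<^sub>E I A \<inter> space (Pi\<^sub>M I (\<lambda>_. lborel)) = Pi\<^sub>E I A'"
      using assms by (auto simp: A'_def space_PiM PiE_iff extensional_def Pi_iff split: if_splits)
    have "emeasure (distr (Pi\<^sub>M I (\<lambda>_. lborel)) (Pi\<^sub>M I (\<lambda>_. lborel)) (\<lambda>x. x(i := x i + h))) (Pi\<^sub>E I A)
       = emeasure (Pi\<^sub>M I (\<lambda>_. lborel)) (Pi\<^sub>E I A')"
      using A assms(1) by (subst emeasure_distr[OF m sets_PiM_I_finite]) (simp_all only: vi)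
    also have "\<dots> = (\<Prod>i\<in>I. emeasure lborel (A' i))"
      using sA' assms(1) by (intro emeasure_PiM) auto
    also have "\<dots> = (\<Prod>i\<in>I. emeasure lborel (A i))"
      by (intro prod.cong refl e)
    finally show "emeasure (distr (Pi\<^sub>M I (\<lambda>_. lborel)) (Pi\<^sub>M I (\<lambda>_. lborel)) (\<lambda>x. x(i := x i + h))) (Pi\<^sub>E I A)
       = (\<Prod>i\<in>I. emeasure lborel (A i))" .
  qed (use assms in auto)
qed

lemma distr_shift:
  assumes "i \<le> n"
  shows "distr (spacetime_measure n) (spacetime_measure n) (shift i h) = spacetime_measure n"
proof -
  let ?P = "Pi\<^sub>M {1..n} (\<lambda>_. lborel::real measure)"
  have sf: "sigma_finite_measure (lborel::real measure)" by (rule lborel.sigma_finite_measure_axioms)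
  show ?thesis
  proof (cases "i = 0")
    case True
    have eq: "shift i h = (\<lambda>(x, y). (x, y + h))" using True by (auto simp: shift_def upd_def crd_def)
    have "distr ?P ?P (\<lambda>x. x) \<Otimes>\<^sub>M distr lborel lborel (\<lambda>y::real. y + h)
      = distr (?P \<Otimes>\<^sub>M lborel) (?P \<Otimes>\<^sub>M lborel) (\<lambda>(x, y). (x, y + h))"
      by (rule pair_measure_distr) (simp_all add: distr_translate sf)
    then show ?thesis unfolding spacetime_measure_def eq by (simp only: distr_translate distr_id2)
  next
    case False
    then have i: "i \<in> {1..n}" using assms by auto
    have eq: "shift i h = (\<lambda>(x, y). (x(i := x i + h), y))" using False by (auto simp: shift_def upd_def crd_def)
    have m: "(\<lambda>x. x(i := x i + h)) \<in> ?P \<rightarrow>\<^sub>M ?P"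
      using i by (intro measurable_fun_upd[of "{1..n}" "{1..n}" i]) auto
    have "distr ?P ?P (\<lambda>x. x(i := x i + h)) \<Otimes>\<^sub>M distr lborel lborel (\<lambda>y::real. y)
      = distr (?P \<Otimes>\<^sub>M lborel) (?P \<Otimes>\<^sub>M lborel) (\<lambda>(x, y). (x(i := x i + h), y))"
      by (rule pair_measure_distr[OF m measurable_ident_sets[OF refl]]) (simp only: distr_id2 sf)
    then show ?thesis unfolding spacetime_measure_def eq
      by (simp only: distr_PiM_translate[OF finite_atLeastAtMost i] distr_id2)
  qed
qed

lemma measurable_shift:
  assumes "i \<le> n"
  shows "shift i h \<in> spacetime_measure n \<rightarrow>\<^sub>M spacetime_measure n"
proof (cases "i = 0")
  case True
  have "shift i h = (\<lambda>(x, y). (x, y + h))" using True by (auto simp: shift_def upd_def crd_def)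
  then show ?thesis unfolding spacetime_measure_def by simp
next
  case False
  then have i: "i \<in> {1..n}" using assms by auto
  have m: "(\<lambda>x. x(i := x i + h)) \<in> Pi\<^sub>M {1..n} (\<lambda>_. lborel) \<rightarrow>\<^sub>M Pi\<^sub>M {1..n} (\<lambda>_. lborel::real measure)"
    using i by (intro measurable_fun_upd[of "{1..n}" "{1..n}" i]) auto
  have eq: "shift i h = (\<lambda>p. ((\<lambda>x. x(i := x i + h)) (fst p), snd p))" using False by (auto simp: shift_def upd_def crd_def)
  show ?thesis unfolding spacetime_measure_def eq
    by (rule measurable_Pair[OF measurable_compose[OF measurable_fst m] measurable_snd])
qed

lemma integral_shift:
  fixes f :: "point \<Rightarrow> real"
  assumes "i \<le> n" "f \<in> borel_measurable (spacetime_measure n)"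
  shows "(LINT p|spacetime_measure n. f (shift i h p)) = (LINT p|spacetime_measure n. f p)"
  using integral_distr[OF measurable_shift[OF assms(1)] assms(2)] unfolding distr_shift[OF assms(1)] by (rule sym)

lemma integrable_shift:
  fixes f :: "point \<Rightarrow> real"
  assumes "i \<le> n" "integrable (spacetime_measure n) f"
  shows "integrable (spacetime_measure n) (\<lambda>p. f (shift i h p))"
  by (rule integrable_distr[OF measurable_shift[OF assms(1)]]) (simp only: distr_shift[OF assms(1)] assms(2))

section \<open>Measurability of partial derivatives\<close>

lemma isCont_le_rat:
  fixes G :: "real \<Rightarrow> real"
  assumes "isCont G h" "e > 0" "\<And>r::rat. \<bar>of_rat r - h\<bar> < e \<Longrightarrow> of_rat r \<noteq> h \<Longrightarrow> G (of_rat r) \<le> B"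
  shows "G h \<le> B"
proof (rule ccontr)
  assume "\<not> G h \<le> B"
  then have "G h > B" by simp
  then have "eventually (\<lambda>s. G s > B) (nhds h)"
    using assms(1) by (auto simp: continuous_at tendsto_at_iff_tendsto_nhds intro: order_tendstoD)
  then obtain d where d: "d > 0" "\<And>s. dist s h < d \<Longrightarrow> G s > B"
    by (auto simp: eventually_nhds_metric)
  obtain r where "h < of_rat r" "of_rat r < h + min d e"
    using of_rat_dense[of h "h + min d e"] d assms(2) by auto
  then show False using d(2)[of "of_rat r"] assms(3)[of r] by (force simp: dist_real_def)
qed

text \<open>Existence of a limit is expressed by countably many conditions, which makes the set of
  differentiability points of a continuous function measurable.\<close>

lemma limit_at_0_iff_rat:
  fixes Q :: "real \<Rightarrow> real"
  assumes e: "e > 0" and cont: "\<And>h. 0 < \<bar>h\<bar> \<Longrightarrow> \<bar>h\<bar> < e \<Longrightarrow> isCont Q h"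
  shows "(\<exists>d. (Q \<longlongrightarrow> d) (at 0)) \<longleftrightarrow>
    (\<forall>k::nat. \<exists>m::nat. \<forall>r s::rat. 0 < \<bar>real_of_rat r\<bar> \<and> \<bar>real_of_rat r\<bar> < 1 / Suc m \<and>
       0 < \<bar>real_of_rat s\<bar> \<and> \<bar>real_of_rat s\<bar> < 1 / Suc m \<longrightarrow>
       \<bar>Q (of_rat r) - Q (of_rat s)\<bar> \<le> 1 / Suc k)" (is "?L \<longleftrightarrow> ?R")
proof
  assume ?L
  then obtain d where d: "(Q \<longlongrightarrow> d) (at 0)" by auto
  show ?R
  proof
    fix k :: nat
    have "eventually (\<lambda>h. dist (Q h) d < 1 / (2 * Suc k)) (at 0)"
      using d by (rule tendstoD) simp
    then obtain c where c: "c > 0" "\<And>h. h \<noteq> 0 \<Longrightarrow> \<bar>h\<bar> < c \<Longrightarrow> \<bar>Q h - d\<bar> < 1 / (2 * Suc k)"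
      by (auto simp: eventually_at dist_real_def)
    obtain m where m: "1 / real (Suc m) < c" using nat_approx_posE[OF c(1)] by blast
    have "\<bar>Q (of_rat r) - Q (of_rat s)\<bar> \<le> 1 / Suc k"
      if "0 < \<bar>real_of_rat r\<bar>" "\<bar>real_of_rat r\<bar> < 1 / Suc m" "0 < \<bar>real_of_rat s\<bar>" "\<bar>real_of_rat s\<bar> < 1 / Suc m" for r s
    proof -
      define \<epsilon> where "\<epsilon> = 1 / real (2 * Suc k)"
      have "\<bar>Q (of_rat r) - d\<bar> < \<epsilon>" "\<bar>Q (of_rat s) - d\<bar> < \<epsilon>" unfolding \<epsilon>_def
        by (rule c(2); use that m in linarith)+
      moreover have "1 / Suc k = \<epsilon> + \<epsilon>" by (simp add: \<epsilon>_def field_simps)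
      ultimately show ?thesis by linarith
    qed
    then show "\<exists>m::nat. \<forall>r s::rat. 0 < \<bar>real_of_rat r\<bar> \<and> \<bar>real_of_rat r\<bar> < 1 / Suc m \<and>
       0 < \<bar>real_of_rat s\<bar> \<and> \<bar>real_of_rat s\<bar> < 1 / Suc m \<longrightarrow>
       \<bar>Q (of_rat r) - Q (of_rat s)\<bar> \<le> 1 / Suc k" by blast
  qed
next
  assume R: ?R
  have real: "\<exists>c>0. \<forall>h h'. 0 < \<bar>h\<bar> \<and> \<bar>h\<bar> < c \<and> 0 < \<bar>h'\<bar> \<and> \<bar>h'\<bar> < c \<longrightarrow> \<bar>Q h - Q h'\<bar> \<le> 1 / Suc k" for k :: nat
  proof -
    obtain m :: nat where m: "\<And>r s::rat. 0 < \<bar>real_of_rat r\<bar> \<Longrightarrow> \<bar>real_of_rat r\<bar> < 1 / Suc m \<Longrightarrow>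
       0 < \<bar>real_of_rat s\<bar> \<Longrightarrow> \<bar>real_of_rat s\<bar> < 1 / Suc m \<Longrightarrow>
       \<bar>Q (of_rat r) - Q (of_rat s)\<bar> \<le> 1 / Suc k" using R by blast
    define c where "c = min e (1 / Suc m)"
    have c: "c > 0" "c \<le> e" "c \<le> 1 / Suc m" using e by (auto simp: c_def)
    \<comment> \<open>The Cauchy condition passes from rational to real increments one argument at a
      time. The radius \<open>min \<bar>h\<bar> (c - \<bar>h\<bar>)\<close> keeps the approximating
      rationals away from 0, where \<open>Q\<close> may be discontinuous, and below
      \<open>c\<close>.\<close>
    have 1: "\<bar>Q h - Q (of_rat s)\<bar> \<le> 1 / Suc k"
      if "0 < \<bar>h\<bar>" "\<bar>h\<bar> < c" "0 < \<bar>real_of_rat s\<bar>" "\<bar>real_of_rat s\<bar> < c" for h s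
    proof (rule isCont_le_rat[where e = "min \<bar>h\<bar> (c - \<bar>h\<bar>)" and G = "\<lambda>h. \<bar>Q h - Q (of_rat s)\<bar>"])
      show "isCont (\<lambda>h. \<bar>Q h - Q (of_rat s)\<bar>) h" using that c by (intro continuous_intros cont) auto
      fix r :: rat assume "\<bar>real_of_rat r - h\<bar> < min \<bar>h\<bar> (c - \<bar>h\<bar>)"
      then have "0 < \<bar>real_of_rat r\<bar>" "\<bar>real_of_rat r\<bar> < c" by linarith+
      then show "\<bar>Q (real_of_rat r) - Q (real_of_rat s)\<bar> \<le> 1 / Suc k"
        using that c by (intro m) linarith+
    qed (use that in auto)
    have "\<bar>Q h - Q h'\<bar> \<le> 1 / Suc k"
      if "0 < \<bar>h\<bar>" "\<bar>h\<bar> < c" "0 < \<bar>h'\<bar>" "\<bar>h'\<bar> < c" for h h'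
    proof (rule isCont_le_rat[where e = "min \<bar>h'\<bar> (c - \<bar>h'\<bar>)" and G = "\<lambda>h'. \<bar>Q h - Q h'\<bar>"])
      show "isCont (\<lambda>h'. \<bar>Q h - Q h'\<bar>) h'" using that c by (intro continuous_intros cont) auto
      fix r :: rat assume "\<bar>real_of_rat r - h'\<bar> < min \<bar>h'\<bar> (c - \<bar>h'\<bar>)"
      then have "0 < \<bar>real_of_rat r\<bar>" "\<bar>real_of_rat r\<bar> < c" by linarith+
      then show "\<bar>Q h - Q (real_of_rat r)\<bar> \<le> 1 / Suc k"
        using that by (intro 1) linarith+
    qed (use that in auto)
    with c(1) show ?thesis by blast
  qed
  define X where "X j = Q (1 / Suc j)" for j :: nat
  have Xc: "\<exists>J. \<forall>j\<ge>J. 1 / real (Suc j) < c" if "c > 0" for c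
    using LIMSEQ_inverse_real_of_nat that unfolding lim_sequentially by (force simp: inverse_eq_divide)
  have "Cauchy X"
  proof (rule metric_CauchyI)
    fix E :: real assume "E > 0"
    then obtain k where k: "1 / real (Suc k) < E" using nat_approx_posE by blast
    obtain c where c: "c > 0" "\<And>h h'. 0 < \<bar>h\<bar> \<and> \<bar>h\<bar> < c \<and> 0 < \<bar>h'\<bar> \<and> \<bar>h'\<bar> < c \<Longrightarrow> \<bar>Q h - Q h'\<bar> \<le> 1 / Suc k"
      using real[of k] by blast
    obtain J where J: "\<And>j. j \<ge> J \<Longrightarrow> 1 / real (Suc j) < c" using Xc[OF c(1)] by blast
    have "dist (X a) (X b) < E" if "a \<ge> J" "b \<ge> J" for a b
      using c(2)[of "1 / Suc a" "1 / Suc b"] J[OF that(1)] J[OF that(2)] k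
      by (simp add: X_def dist_real_def)
    then show "\<exists>J. \<forall>a\<ge>J. \<forall>b\<ge>J. dist (X a) (X b) < E" by blast
  qed
  then obtain d where d: "X \<longlonglongrightarrow> d" using Cauchy_convergent convergent_def by blast
  have "(Q \<longlongrightarrow> d) (at 0)"
  proof (rule tendstoI)
    fix E :: real assume "E > 0"
    then obtain k where k: "1 / real (Suc k) < E" using nat_approx_posE by blast
    obtain c where c: "c > 0" "\<And>h h'. 0 < \<bar>h\<bar> \<and> \<bar>h\<bar> < c \<and> 0 < \<bar>h'\<bar> \<and> \<bar>h'\<bar> < c \<Longrightarrow> \<bar>Q h - Q h'\<bar> \<le> 1 / Suc k"
      using real[of k] by blast
    obtain J where J: "\<And>j. j \<ge> J \<Longrightarrow> 1 / real (Suc j) < c" using Xc[OF c(1)] by blast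
    have "\<bar>Q h - d\<bar> \<le> 1 / Suc k" if "h \<noteq> 0" "\<bar>h\<bar> < c" for h
    proof (rule LIMSEQ_le_const2)
      show "(\<lambda>j. \<bar>Q h - X j\<bar>) \<longlonglongrightarrow> \<bar>Q h - d\<bar>" by (intro tendsto_intros d)
      show "\<exists>N. \<forall>j\<ge>N. \<bar>Q h - X j\<bar> \<le> 1 / Suc k"
        using J that by (intro exI[of _ J]) (auto simp: X_def simp del: of_nat_Suc intro!: c(2))
    qed
    then show "eventually (\<lambda>h. dist (Q h) d < E) (at 0)"
      using c(1) k unfolding eventually_at by (intro exI[of _ c]) (force simp: dist_real_def)
  qed
  then show ?L by blast
qed

lemma measurable_continuous_on_Om:
  assumes "continuous_on (Om n) (f :: point \<Rightarrow> real)"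
  shows "(\<lambda>p. indicator (Om n) p * f p) \<in> borel_measurable (spacetime_measure n)"
  using borel_measurable_continuous_on_indicator[OF Om_sets assms] by (simp add: borel_measurable_spacetime)

lemma shift_0 [simp]: "shift i 0 p = p"
  by (simp add: shift_def)

lemma has_pd_iff_quotient:
  "has_pd i f p d \<longleftrightarrow> ((\<lambda>h. (f (shift i h p) - f p) / h) \<longlongrightarrow> d) (at 0)"
  unfolding has_pd_def DERIV_def by (simp add: shift_def)

lemma eventually_shift_Om:
  assumes "p \<in> Om n" "i \<le> n"
  shows "\<exists>e>0. \<forall>h. \<bar>h\<bar> < e \<longrightarrow> shift i h p \<in> Om n"
proof -
  obtain e where "e > 0" "\<And>s. dist s (crd i p) < e \<Longrightarrow> upd i s p \<in> Om n"
    using eventually_upd_Om[OF assms] by (auto simp: eventually_nhds_metric)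
  then show ?thesis by (intro exI[of _ e]) (auto simp: shift_def dist_real_def)
qed

text \<open>\<open>pd\<close> rests on \<open>deriv\<close>, a Hilbert choice, so its measurability
  is not automatic. The points of differentiability form the measurable set \<open>D\<close> by
  \<open>limit_at_0_iff_rat\<close>, and on \<open>D\<close> the derivative is the limit of the
  quotients with steps \<open>1 / Suc j\<close>.\<close>

lemma measurable_pd:
  assumes cont: "continuous_on (Om n) f" and i: "i \<le> n"
  shows "(\<lambda>p. indicator (Om n) p * pd i f p) \<in> borel_measurable (spacetime_measure n)"
proof -
  let ?M = "spacetime_measure n"
  \<comment> \<open>Extension by zero makes the difference quotients measurable on the whole space;
    at a point of \<open>Om n\<close> they agree with those of \<open>f\<close> for small
    steps.\<close>
  define F where "F p = indicator (Om n) p * f p" for p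
  have F: "F \<in> borel_measurable ?M" 
    unfolding F_def by (rule measurable_continuous_on_Om[OF cont])
  define q where "q h p = (F (shift i h p) - F p) / h" for h p
  have q[measurable]: "q h \<in> borel_measurable ?M" for h
    unfolding q_def by (intro borel_measurable_divide borel_measurable_diff F borel_measurable_const
      measurable_compose[OF measurable_shift[OF i] F])
  define D where "D = {p \<in> space ?M. \<forall>k::nat. \<exists>m::nat. \<forall>r s::rat.
      0 < \<bar>real_of_rat r\<bar> \<and> \<bar>real_of_rat r\<bar> < 1 / Suc m \<and>
      0 < \<bar>real_of_rat s\<bar> \<and> \<bar>real_of_rat s\<bar> < 1 / Suc m \<longrightarrow>
      \<bar>q (of_rat r) p - q (of_rat s) p\<bar> \<le> 1 / Suc k}"
  have D[measurable]: "D \<in> sets ?M" unfolding D_def by measurable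
  define L where "L p = lim (\<lambda>j. q (1 / Suc j) p)" for p
  have L[measurable]: "L \<in> borel_measurable ?M" unfolding L_def by measurable
  have Om[measurable]: "Om n \<in> sets ?M"
  proof -
    have "Om n \<inter> (Rn n \<times> UNIV) = Om n" by (auto simp: Om_def Rn_plus_def)
    then show ?thesis using sets_spacetime[OF Om_sets, of n n] by simp
  qed
  \<comment> \<open>At points of \<open>Om n\<close> outside \<open>D\<close> the predicate inside
    \<open>deriv\<close> has no solution, so all these points share one default value, the constant
    \<open>SOME d. False\<close>.\<close>
  have "indicator (Om n) p * pd i f p =
      indicator (Om n) p * (if p \<in> D then L p else (SOME d::real. False))" if "p \<in> space ?M" for p
  proof (cases "p \<in> Om n")
    case True
    obtain e where e: "e > 0" "\<And>h. \<bar>h\<bar> < e \<Longrightarrow> shift i h p \<in> Om n"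
      using eventually_shift_Om[OF True i] by blast
    have Feq: "F (shift i h p) = f (shift i h p)" if "\<bar>h\<bar> < e" for h
      using e that by (simp add: F_def)
    have F0: "F p = f p" using True by (simp add: F_def)
    have ev: "eventually (\<lambda>h. (f (shift i h p) - f p) / h = q h p) (at 0)"
      unfolding eventually_at using e(1) Feq F0 by (intro exI[of _ e]) (auto simp: q_def)
    have pd_iff: "has_pd i f p d \<longleftrightarrow> ((\<lambda>h. q h p) \<longlongrightarrow> d) (at 0)" for d
      unfolding has_pd_iff_quotient by (rule tendsto_cong[OF ev])
    have c: "isCont (\<lambda>h. q h p) h" if h: "0 < \<bar>h\<bar>" "\<bar>h\<bar> < e" for h
    proof -
      have "isCont (\<lambda>s. f (upd i s (shift i h p))) (crd i (shift i h p))"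
        using isCont_slice[OF cont e(2)[OF h(2)] i] .
      then have c1: "isCont (\<lambda>s. f (upd i s p)) (crd i p + h)" by (simp add: shift_def)
      have "isCont (\<lambda>h. f (upd i (crd i p + h) p)) h"
        using isCont_o2[where g="\<lambda>s. f (upd i s p)" and f="\<lambda>h. crd i p + h", OF _ c1] by simp
      then have c2: "isCont (\<lambda>h. (f (shift i h p) - f p) / h) h"
        using h unfolding shift_def by (intro continuous_intros) auto
      have "eventually (\<lambda>h. \<bar>h\<bar> < e) (nhds h)"
        using h(2) by (intro eventually_nhds_in_open[where s="{h. \<bar>h\<bar> < e}", simplified]) 
          (auto intro!: open_Collect_less continuous_intros)
      then have "eventually (\<lambda>h. (f (shift i h p) - f p) / h = q h p) (nhds h)"
        by (rule eventually_mono) (simp add: q_def Feq F0)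
      from isCont_cong[OF this] c2 show ?thesis by blast
    qed
    have iff: "p \<in> D \<longleftrightarrow> (\<exists>d. has_pd i f p d)"
      unfolding pd_iff D_def using limit_at_0_iff_rat[OF e(1) c] that by simp
    show ?thesis
    proof (cases "p \<in> D")
      case True
      then obtain d where d: "has_pd i f p d" using iff by auto
      then have "((\<lambda>h. q h p) \<longlongrightarrow> d) (at 0)" by (simp add: pd_iff)
      then have "(\<lambda>j. q (1 / Suc j) p) \<longlonglongrightarrow> d"
        by (rule filterlim_compose) (use LIMSEQ_inverse_real_of_nat in \<open>auto simp: filterlim_at inverse_eq_divide\<close>)
      then show ?thesis using True d by (simp add: L_def limI has_pd_imp_pd)
    next
      case False
      then have "\<not> (\<exists>d. has_pd i f p d)" by (simp add: iff)
      then have "pd i f p = (SOME d. False)" unfolding pd_def deriv_def has_pd_def by simp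
      then show ?thesis using False by simp
    qed
  qed simp
  then show ?thesis by (rule measurable_cong[THEN iffD2]) measurable
qed

lemma sets_spacetime_subset:
  assumes "closed K" "K \<subseteq> Om n"
  shows "K \<in> sets (spacetime_measure n)"
proof -
  have "K \<inter> (Rn n \<times> UNIV) = K" using assms(2) by (auto simp: Om_def Rn_plus_def)
  then show ?thesis using sets_spacetime[OF borel_closed[OF assms(1)], of n] by simp
qed

section \<open>Compact boxes and separately Lipschitz functions\<close>

definition cuboid :: "nat \<Rightarrow> (nat \<Rightarrow> real) \<Rightarrow> (nat \<Rightarrow> real) \<Rightarrow> point set" where
  "cuboid n l r = {p. fst p \<in> Rn n \<and> (\<forall>i\<le>n. l i \<le> crd i p \<and> crd i p \<le> r i)}"

lemma cuboid_eq: "cuboid n l r = (\<Pi>\<^sub>E i\<in>{1..n}. {l i..r i}) \<times> {l 0..r 0}"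
proof -
  have "(\<forall>i\<le>n. P i) \<longleftrightarrow> P 0 \<and> (\<forall>i\<in>{1..n}. P i)" for P :: "nat \<Rightarrow> bool"
  proof (intro iffI conjI allI impI ballI)
    fix i assume "P 0 \<and> (\<forall>i\<in>{1..n}. P i)" "i \<le> n"
    then show "P i" by (cases "i = 0") auto
  qed auto
  note split = this[of "\<lambda>i. l i \<le> crd i p \<and> crd i p \<le> r i" for p]
  have "p \<in> cuboid n l r \<longleftrightarrow> p \<in> (\<Pi>\<^sub>E i\<in>{1..n}. {l i..r i}) \<times> {l 0..r 0}" for p
  proof -
    have "(\<forall>i\<in>{1..n}. l i \<le> crd i p \<and> crd i p \<le> r i) \<longleftrightarrow> (\<forall>i\<in>{1..n}. fst p i \<in> {l i..r i})"
      by (intro ball_cong refl) (auto simp: crd_def)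
    moreover have "l 0 \<le> crd 0 p \<and> crd 0 p \<le> r 0 \<longleftrightarrow> snd p \<in> {l 0..r 0}"
      by (simp add: crd_def)
    moreover have "fst p \<in> Rn n \<longleftrightarrow> fst p \<in> extensional {1..n}"
      by (simp add: Rn_def PiE_iff)
    ultimately show ?thesis
      unfolding cuboid_def mem_Collect_eq split mem_Times_iff PiE_iff by blast
  qed
  then show ?thesis by (rule set_eqI)
qed

lemma compact_cuboid: "compact (cuboid n l r)"
proof -
  let ?A = "\<lambda>i. if i \<in> {1..n} then {l i..r i} else {undefined :: real}"
  have eq: "(\<Pi>\<^sub>E i\<in>{1..n}. {l i..r i}) = Pi\<^sub>E UNIV ?A"
  proof (rule set_eqI)
    fix x :: "nat \<Rightarrow> real"
    show "x \<in> (\<Pi>\<^sub>E i\<in>{1..n}. {l i..r i}) \<longleftrightarrow> x \<in> Pi\<^sub>E UNIV ?A"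
    proof -
      have "x i \<in> ?A i \<longleftrightarrow> (i \<in> {1..n} \<longrightarrow> x i \<in> {l i..r i}) \<and> (i \<notin> {1..n} \<longrightarrow> x i = undefined)" for i
        by (simp del: atLeastAtMost_iff)
      then show ?thesis unfolding PiE_iff extensional_def mem_Collect_eq by blast
    qed
  qed
  have "compactin euclidean (?A i)" for i by simp
  then have "compactin (product_topology (\<lambda>_. euclidean) UNIV) (Pi\<^sub>E UNIV ?A)"
    unfolding compactin_PiE by blast
  then have "compact (Pi\<^sub>E UNIV ?A)"
    by (simp only: euclidean_product_topology compactin_euclidean_iff)
  then have "compact ((\<Pi>\<^sub>E i\<in>{1..n}. {l i..r i}) \<times> {l 0..r 0})"
    unfolding eq by (intro compact_Times compact_Icc)
  then show ?thesis by (simp only: cuboid_eq)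
qed

lemma emeasure_cuboid: "emeasure (spacetime_measure n) (cuboid n l r) < \<infinity>"
proof -
  interpret product_sigma_finite "\<lambda>_. lborel::real measure" by standard
  have "emeasure (spacetime_measure n) (cuboid n l r) =
    emeasure (Pi\<^sub>M {1..n} (\<lambda>_. lborel)) (\<Pi>\<^sub>E i\<in>{1..n}. {l i..r i}) * emeasure lborel {l 0..r 0}"
    unfolding cuboid_eq spacetime_measure_def
    by (intro lborel.emeasure_pair_measure_Times sets_PiM_I_finite) auto
  also have "emeasure (Pi\<^sub>M {1..n} (\<lambda>_. lborel)) (\<Pi>\<^sub>E i\<in>{1..n}. {l i..r i}) = (\<Prod>i\<in>{1..n}. emeasure lborel {l i..r i})"
    by (intro emeasure_PiM) auto
  finally have "emeasure (spacetime_measure n) (cuboid n l r) =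
    (\<Prod>i\<in>{1..n}. emeasure lborel {l i..r i}) * emeasure lborel {l 0..r 0}" .
  also have "\<dots> \<noteq> \<infinity>"
    by (auto simp: ennreal_mult_eq_top_iff ennreal_prod_eq_top emeasure_lborel_Icc_eq)
  finally show ?thesis by (simp add: less_top)
qed

lemma shift_Rn: "i \<le> n \<Longrightarrow> fst p \<in> Rn n \<Longrightarrow> fst (shift i h p) \<in> Rn n"
  by (simp add: shift_def upd_Rn)

lemma crd_shift: "crd j (shift i h p) = crd j p + (if i = j then h else 0)"
  by (auto simp: shift_def crd_upd)

text \<open>Lipschitz continuity in each coordinate separately, together with continuity, is all that is
  needed of the functions under the divergence; it is stable under products.\<close>

definition slip_with :: "nat \<Rightarrow> point set \<Rightarrow> real \<Rightarrow> (point \<Rightarrow> real) \<Rightarrow> bool" where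
  "slip_with n B L f \<longleftrightarrow> (\<forall>i p h. i \<le> n \<longrightarrow> p \<in> B \<longrightarrow> shift i h p \<in> B \<longrightarrow>
     \<bar>f (shift i h p) - f p\<bar> \<le> L * \<bar>h\<bar>)"

definition slip :: "nat \<Rightarrow> point set \<Rightarrow> (point \<Rightarrow> real) \<Rightarrow> bool" where
  "slip n B f \<longleftrightarrow> continuous_on (Om n) f \<and> (\<exists>L. L \<ge> 0 \<and> slip_with n B L f)"

lemma slip_continuous: "slip n B f \<Longrightarrow> continuous_on (Om n) f"
  by (simp add: slip_def)

lemma slipE:
  assumes "slip n B f"
  obtains L where "L \<ge> 0" "\<And>i p h. i \<le> n \<Longrightarrow> p \<in> B \<Longrightarrow> shift i h p \<in> B \<Longrightarrow>
    \<bar>f (shift i h p) - f p\<bar> \<le> L * \<bar>h\<bar>"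
proof -
  obtain L where "L \<ge> 0" and L: "slip_with n B L f"
    using assms unfolding slip_def by blast
  show ?thesis
    by (rule that[OF \<open>L \<ge> 0\<close> L[unfolded slip_with_def, rule_format]])
qed

lemma slipI:
  assumes "continuous_on (Om n) f" "L \<ge> 0" "\<And>i p h. i \<le> n \<Longrightarrow> p \<in> B \<Longrightarrow> shift i h p \<in> B \<Longrightarrow>
    \<bar>f (shift i h p) - f p\<bar> \<le> L * \<bar>h\<bar>"
  shows "slip n B f"
proof -
  have "slip_with n B L f" unfolding slip_with_def by (intro allI impI assms(3))
  then show ?thesis using assms(1,2) unfolding slip_def by blast
qed

lemma slip_const: "slip n B (\<lambda>_. c)"
  by (rule slipI[of n _ 0]) simp_all

lemma slip_add:
  assumes "slip n B f" "slip n B g"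
  shows "slip n B (\<lambda>p. f p + g p)"
proof -
  obtain L where L: "L \<ge> 0" "\<And>i p h. i \<le> n \<Longrightarrow> p \<in> B \<Longrightarrow> shift i h p \<in> B \<Longrightarrow>
      \<bar>f (shift i h p) - f p\<bar> \<le> L * \<bar>h\<bar>"
    by (rule slipE[OF assms(1)]) (rule that)
  obtain M where M: "M \<ge> 0" "\<And>i p h. i \<le> n \<Longrightarrow> p \<in> B \<Longrightarrow> shift i h p \<in> B \<Longrightarrow>
      \<bar>g (shift i h p) - g p\<bar> \<le> M * \<bar>h\<bar>"
    by (rule slipE[OF assms(2)]) (rule that)
  have "\<bar>(f (shift i h p) + g (shift i h p)) - (f p + g p)\<bar> \<le> (L + M) * \<bar>h\<bar>"
    if "i \<le> n" "p \<in> B" "shift i h p \<in> B" for i p h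
    using L(2)[OF that] M(2)[OF that] unfolding distrib_right by linarith
  note bound = this
  have "continuous_on (Om n) (\<lambda>p. f p + g p)"
    by (rule continuous_on_add[OF slip_continuous[OF assms(1)] slip_continuous[OF assms(2)]])
  moreover have "L + M \<ge> 0" using L(1) M(1) by simp
  ultimately show ?thesis by (rule slipI) (rule bound)
qed

lemma slip_bounded:
  assumes "slip n B f" "compact B" "B \<subseteq> Om n"
  shows "\<exists>C\<ge>0. \<forall>p\<in>B. \<bar>f p\<bar> \<le> C"
proof -
  have "compact (f ` B)"
    by (rule compact_continuous_image[OF continuous_on_subset[OF slip_continuous[OF assms(1)] assms(3)] assms(2)])
  then obtain C where "\<And>p. p \<in> B \<Longrightarrow> \<bar>f p\<bar> \<le> C"
    using compact_imp_bounded[of "f ` B"] by (auto simp: bounded_iff)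
  then show ?thesis by (intro exI[of _ "max C 0"]) (auto simp: le_max_iff_disj)
qed

lemma slip_mult:
  assumes "slip n B f" "slip n B g" "compact B" "B \<subseteq> Om n"
  shows "slip n B (\<lambda>p. f p * g p)"
proof -
  obtain L where L: "L \<ge> 0" "\<And>i p h. i \<le> n \<Longrightarrow> p \<in> B \<Longrightarrow> shift i h p \<in> B \<Longrightarrow>
      \<bar>f (shift i h p) - f p\<bar> \<le> L * \<bar>h\<bar>"
    by (rule slipE[OF assms(1)]) (rule that)
  obtain M where M: "M \<ge> 0" "\<And>i p h. i \<le> n \<Longrightarrow> p \<in> B \<Longrightarrow> shift i h p \<in> B \<Longrightarrow>
      \<bar>g (shift i h p) - g p\<bar> \<le> M * \<bar>h\<bar>"
    by (rule slipE[OF assms(2)]) (rule that)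
  obtain C where C: "C \<ge> 0" "\<And>p. p \<in> B \<Longrightarrow> \<bar>f p\<bar> \<le> C" using slip_bounded[OF assms(1,3,4)] by blast
  obtain D where D: "D \<ge> 0" "\<And>p. p \<in> B \<Longrightarrow> \<bar>g p\<bar> \<le> D" using slip_bounded[OF assms(2,3,4)] by blast
  have "\<bar>f (shift i h p) * g (shift i h p) - f p * g p\<bar> \<le> (C * M + L * D) * \<bar>h\<bar>"
    if "i \<le> n" "p \<in> B" "shift i h p \<in> B" for i p h
  proof -
    let ?q = "shift i h p"
    have "\<bar>f ?q * g ?q - f p * g p\<bar> = \<bar>f ?q * (g ?q - g p) + (f ?q - f p) * g p\<bar>"
      by (simp add: algebra_simps)
    also have "\<dots> \<le> \<bar>f ?q\<bar> * \<bar>g ?q - g p\<bar> + \<bar>f ?q - f p\<bar> * \<bar>g p\<bar>"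
      unfolding abs_mult[symmetric] by (rule abs_triangle_ineq)
    also have "\<dots> \<le> C * (M * \<bar>h\<bar>) + (L * \<bar>h\<bar>) * D"
      using L M C D that by (intro add_mono mult_mono) auto
    finally show ?thesis by (simp add: algebra_simps)
  qed
  note bound = this
  have "continuous_on (Om n) (\<lambda>p. f p * g p)"
    by (rule continuous_on_mult[OF slip_continuous[OF assms(1)] slip_continuous[OF assms(2)]])
  moreover have "C * M + L * D \<ge> 0" using L(1) M(1) C(1) D(1) by simp
  ultimately show ?thesis by (rule slipI) (rule bound)
qed

lemma slip_sum:
  assumes "\<And>j. j \<in> J \<Longrightarrow> slip n B (f j)"
  shows "slip n B (\<lambda>p. \<Sum>j\<in>J. f j p)"
  using assms
proof (induction J rule: infinite_finite_induct)
  case (insert x J)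
  have "slip n B (\<lambda>p. f x p + (\<Sum>j\<in>J. f j p))"
    by (rule slip_add[OF insert.prems insert.IH[OF insert.prems]]) simp_all
  then show ?case by (simp only: sum.insert[OF insert.hyps])
next
  case (infinite J)
  then show ?case by (simp add: slip_const)
qed (simp add: slip_const)

text \<open>Two points of a cuboid that differ in one coordinate are joined by a segment inside it,
  and the continuous partials are bounded there by compactness, so the mean value bound
  applies.\<close>

lemma slip_C1:
  assumes f: "continuous_on (Om n) f"
    and d: "\<And>i p. i \<le> n \<Longrightarrow> p \<in> Om n \<Longrightarrow> has_pd i f p (f' i p)"
    and c: "\<And>i. i \<le> n \<Longrightarrow> continuous_on (Om n) (f' i)"
    and B: "cuboid n l r \<subseteq> Om n"
  shows "slip n (cuboid n l r) f"
proof -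
  have "\<exists>C. \<forall>p\<in>cuboid n l r. \<bar>f' i p\<bar> \<le> C" if "i \<le> n" for i
  proof -
    have "compact (f' i ` cuboid n l r)"
      by (rule compact_continuous_image[OF continuous_on_subset[OF c[OF that] B] compact_cuboid])
    then show ?thesis using compact_imp_bounded[of "f' i ` cuboid n l r"] by (auto simp: bounded_iff)
  qed
  then obtain C where C: "\<And>i p. i \<le> n \<Longrightarrow> p \<in> cuboid n l r \<Longrightarrow> \<bar>f' i p\<bar> \<le> C i" by metis
  define L where "L = (\<Sum>i\<le>n. \<bar>C i\<bar>)"
  have L: "\<bar>f' i p\<bar> \<le> L" if "i \<le> n" "p \<in> cuboid n l r" for i p
  proof -
    have "\<bar>C i\<bar> \<le> L" unfolding L_def using that by (intro member_le_sum) auto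
    then show ?thesis using C[OF that] by linarith
  qed
  have bound: "\<bar>f (shift i h p) - f p\<bar> \<le> L * \<bar>h\<bar>"
    if i: "i \<le> n" and p: "p \<in> cuboid n l r" "shift i h p \<in> cuboid n l r" for i p h
  proof -
    let ?S = "{l i..r i}"
    have S: "upd i s p \<in> cuboid n l r" if "s \<in> ?S" for s
      using that p i by (auto simp: cuboid_def crd_upd upd_Rn)
    have der: "((\<lambda>s. f (upd i s p)) has_field_derivative f' i (upd i s p)) (at s within ?S)" if "s \<in> ?S" for s
    proof -
      have "has_pd i f (upd i s p) (f' i (upd i s p))" using d[OF i] S[OF that] B by blast
      then show ?thesis by (simp add: has_pd_def has_field_derivative_at_within)
    qed
    have m: "crd i p \<in> ?S" "crd i p + h \<in> ?S" using p i by (auto simp: cuboid_def crd_shift)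
    have "norm (f (upd i (crd i p + h) p) - f (upd i (crd i p) p)) \<le> L * norm (crd i p + h - crd i p)"
      by (rule field_differentiable_bound[where S = ?S and f' = "\<lambda>s. f' i (upd i s p)", OF _ der _ m(2) m(1)])
        (simp_all add: L[OF i S])
    then show ?thesis by (simp add: shift_def)
  qed
  have "L \<ge> 0" by (simp add: L_def sum_nonneg)
  then show ?thesis by (rule slipI[OF f]) (rule bound)
qed

section \<open>Integrals of derivatives of compactly supported, separately Lipschitz
  functions\<close>

lemma pd_bound:
  assumes L: "\<forall>h. \<bar>h\<bar> < e \<longrightarrow> \<bar>f (shift i h p) - f p\<bar> \<le> L * \<bar>h\<bar>" and e: "e > 0" and d: "has_pd i f p d"
  shows "\<bar>d\<bar> \<le> L"
proof (rule tendsto_upperbound)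
  show "((\<lambda>h. \<bar>(f (shift i h p) - f p) / h\<bar>) \<longlongrightarrow> \<bar>d\<bar>) (at 0)"
    using d unfolding has_pd_iff_quotient by (rule tendsto_rabs)
  show "eventually (\<lambda>h. \<bar>(f (shift i h p) - f p) / h\<bar> \<le> L) (at 0)"
    unfolding eventually_at
  proof (intro exI[of _ e] conjI ballI impI e)
    fix h :: real assume "h \<noteq> 0 \<and> dist h 0 < e"
    then have "\<bar>f (shift i h p) - f p\<bar> \<le> L * \<bar>h\<bar>" "\<bar>h\<bar> > 0" using L by simp_all
    then show "\<bar>(f (shift i h p) - f p) / h\<bar> \<le> L" by (simp only: abs_divide pos_divide_le_eq)
  qed
qed simp

text \<open>The box surrounds the support \<open>K\<close> with a margin: every coordinate step of
  length at most \<open>\<delta>\<close> from \<open>K\<close> ends in the box. The Lipschitz bound,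
  known only between points of the box, then controls all difference quotients that matter.\<close>

locale support_in_box =
  fixes n :: nat and l r :: "nat \<Rightarrow> real" and K :: "point set" and \<delta> :: real
  assumes closed_K: "closed K"
    and K_sub: "K \<subseteq> cuboid n l r"
    and box_sub: "cuboid n l r \<subseteq> Om n"
    and \<delta>_pos: "\<delta> > 0"
    and K_shift: "\<And>i p h. i \<le> n \<Longrightarrow> p \<in> K \<Longrightarrow> \<bar>h\<bar> \<le> \<delta> \<Longrightarrow> shift i h p \<in> cuboid n l r"
begin

abbreviation "M \<equiv> spacetime_measure n"
abbreviation "B \<equiv> cuboid n l r"

lemma K_Om: "K \<subseteq> Om n"
  using K_sub box_sub by (rule order_trans)

lemma K_sets: "K \<in> sets M"
  by (rule sets_spacetime_subset[OF closed_K K_Om])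

lemma B_sets: "B \<in> sets M"
  by (rule sets_spacetime_subset[OF compact_imp_closed[OF compact_cuboid] box_sub])

lemma integrable_B: "integrable M (\<lambda>p. C * indicator B p :: real)"
  using B_sets emeasure_cuboid[of n l r] by (simp add: integrable_real_indicator)

lemma integrable_K_bounded:
  fixes g :: "point \<Rightarrow> real"
  assumes "(\<lambda>p. indicator K p * g p) \<in> borel_measurable M"
    and "AE p in M. p \<in> K \<longrightarrow> \<bar>g p\<bar> \<le> C"
  shows "integrable M (\<lambda>p. indicator K p * g p)"
proof (rule Bochner_Integration.integrable_bound[OF integrable_B[of C] assms(1)])
  show "AE p in M. norm (indicator K p * g p) \<le> norm (C * indicator B p)"
    using assms(2)
  proof (rule AE_mp, intro AE_I2 impI)
    fix p assume p: "p \<in> K \<longrightarrow> \<bar>g p\<bar> \<le> C"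
    show "norm (indicator K p * g p) \<le> norm (C * indicator B p)"
    proof (cases "p \<in> K")
      case True
      then have "p \<in> B" using K_sub by blast
      with True p show ?thesis by simp
    next
      case False
      then show ?thesis by simp
    qed
  qed
qed

lemma measurable_K:
  assumes "continuous_on (Om n) (f :: point \<Rightarrow> real)"
  shows "(\<lambda>p. indicator K p * f p) \<in> borel_measurable M"
proof -
  have "(\<lambda>p. indicator K p * (indicator (Om n) p * f p)) \<in> borel_measurable M"
    by (rule borel_measurable_times[OF borel_measurable_indicator[OF K_sets] measurable_continuous_on_Om[OF assms]])
  moreover have "indicator K p * (indicator (Om n) p * f p) = indicator K p * f p" for p
    using K_Om by (cases "p \<in> K") auto
  ultimately show ?thesis by simp
qed

lemma measurable_K_pd:
  assumes "continuous_on (Om n) f" "i \<le> n"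
  shows "(\<lambda>p. indicator K p * pd i f p) \<in> borel_measurable M"
proof -
  have "(\<lambda>p. indicator K p * (indicator (Om n) p * pd i f p)) \<in> borel_measurable M"
    by (rule borel_measurable_times[OF borel_measurable_indicator[OF K_sets] measurable_pd[OF assms]])
  moreover have "indicator K p * (indicator (Om n) p * pd i f p) = indicator K p * pd i f p" for p
    using K_Om by (cases "p \<in> K") auto
  ultimately show ?thesis by simp
qed

lemma pd_bounded:
  assumes f: "slip n B f" and i: "i \<le> n"
    and D: "AE p in M. p \<in> K \<longrightarrow> (\<exists>d. has_pd i f p d)"
  shows "\<exists>C. AE p in M. p \<in> K \<longrightarrow> \<bar>pd i f p\<bar> \<le> C"
proof -
  obtain L where L: "\<And>i p h. i \<le> n \<Longrightarrow> p \<in> B \<Longrightarrow> shift i h p \<in> B \<Longrightarrow>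
    \<bar>f (shift i h p) - f p\<bar> \<le> L * \<bar>h\<bar>"
    by (rule slipE[OF f]) (rule that)
  have "\<bar>pd i f p\<bar> \<le> L" if p: "p \<in> K" and d: "has_pd i f p d" for p d
  proof -
    have "\<forall>h. \<bar>h\<bar> < \<delta> \<longrightarrow> \<bar>f (shift i h p) - f p\<bar> \<le> L * \<bar>h\<bar>"
    proof (intro allI impI)
      fix h assume "\<bar>h\<bar> < \<delta>"
      then have "shift i h p \<in> B" using K_shift[OF i p] by simp
      moreover have "p \<in> B" using p K_sub by blast
      ultimately show "\<bar>f (shift i h p) - f p\<bar> \<le> L * \<bar>h\<bar>" using L[OF i] by blast
    qed
    from pd_bound[OF this \<delta>_pos d] show ?thesis using has_pd_imp_pd[OF d] by simp
  qed
  note bound = this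
  have "AE p in M. p \<in> K \<longrightarrow> \<bar>pd i f p\<bar> \<le> L"
    by (rule AE_mp[OF D]) (rule AE_I2, use bound in blast)
  then show ?thesis by blast
qed

lemma integrable_pd:
  assumes f: "slip n B f" and i: "i \<le> n"
    and D: "AE p in M. p \<in> K \<longrightarrow> (\<exists>d. has_pd i f p d)"
  shows "integrable M (\<lambda>p. indicator K p * pd i f p)"
proof -
  obtain C where "AE p in M. p \<in> K \<longrightarrow> \<bar>pd i f p\<bar> \<le> C" using pd_bounded[OF assms] by blast
  then show ?thesis by (rule integrable_K_bounded[OF measurable_K_pd[OF slip_continuous[OF f] i]])
qed

text \<open>The integral of every difference quotient vanishes by translation invariance, and the
  quotients converge dominatedly. No absolute continuity on lines is needed.\<close>

lemma integral_pd_eq_0: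
  assumes f: "slip n B f" and i: "i \<le> n" and zero: "\<And>p. p \<in> Om n \<Longrightarrow> p \<notin> K \<Longrightarrow> f p = 0"
    and D: "AE p in M. p \<in> K \<longrightarrow> (\<exists>d. has_pd i f p d)"
  shows "(LINT p|M. indicator K p * pd i f p) = 0"
proof -
  obtain L where L0: "L \<ge> 0" and L: "\<And>i p h. i \<le> n \<Longrightarrow> p \<in> B \<Longrightarrow> shift i h p \<in> B \<Longrightarrow>
    \<bar>f (shift i h p) - f p\<bar> \<le> L * \<bar>h\<bar>"
    by (rule slipE[OF f]) (rule that)
  obtain C where C: "\<And>p. p \<in> B \<Longrightarrow> \<bar>f p\<bar> \<le> C"
    using slip_bounded[OF f compact_cuboid box_sub] by blast
  \<comment> \<open>Values of \<open>f\<close> outside \<open>Om n\<close> are arbitrary, so it is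
    cut off to \<open>K\<close> before it is translated; on \<open>Om n\<close> nothing changes
    because \<open>f\<close> vanishes there off \<open>K\<close>.\<close>
  define F where "F p = indicator K p * f p" for p
  have F_Om: "F p = f p" if "p \<in> Om n" for p
    using zero[OF that] by (cases "p \<in> K") (simp_all add: F_def)
  have F_meas: "F \<in> borel_measurable M"
    unfolding F_def by (rule measurable_K[OF slip_continuous[OF f]])
  have F_int: "integrable M F"
    unfolding F_def
  proof (rule integrable_K_bounded[OF measurable_K[OF slip_continuous[OF f]]])
    show "AE p in M. p \<in> K \<longrightarrow> \<bar>f p\<bar> \<le> C" using C[OF subsetD[OF K_sub]] by (intro AE_I2 impI)
  qed
  define h where "h k = \<delta> / Suc k" for k :: nat
  have h: "h k > 0" "\<bar>h k\<bar> \<le> \<delta>" for k using \<delta>_pos by (simp_all add: h_def divide_le_eq)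
  have h_lim: "h \<longlonglongrightarrow> 0"
    using tendsto_mult_right[OF LIMSEQ_inverse_real_of_nat, of \<delta>]
    by (simp add: h_def[abs_def] divide_inverse mult.commute)
  define q where "q k p = (F (shift i (h k) p) - F p) / h k" for k p
  have shift_int: "integrable M (\<lambda>p. F (shift i (h k) p))" for k
    by (rule integrable_shift[OF i F_int])
  have q0: "(LINT p|M. q k p) = 0" for k
    unfolding q_def using F_int shift_int integral_shift[OF i F_meas, of "h k"] by simp
  \<comment> \<open>The quotient is nonzero only if \<open>p\<close> or its translate lies in
    \<open>K\<close>. The margin then puts both into the box, in the second case by translating
    back, so one integrable function dominates all quotients.\<close>
  have q_bound: "\<bar>q k p\<bar> \<le> L * indicator B p" for k p
  proof (cases "p \<in> K \<or> shift i (h k) p \<in> K")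
    case True
    have "p \<in> B \<and> shift i (h k) p \<in> B"
    proof (cases "p \<in> K")
      case True
      then show ?thesis using K_shift[OF i True h(2)] K_sub by blast
    next
      case False
      with True have s: "shift i (h k) p \<in> K" by simp
      have "shift i (- h k) (shift i (h k) p) \<in> B" using K_shift[OF i s, of "- h k"] h(2) by simp
      moreover have "shift i (- h k) (shift i (h k) p) = p" by (simp add: shift_def)
      ultimately show ?thesis using subsetD[OF K_sub s] by simp
    qed
    then have B: "p \<in> B" "shift i (h k) p \<in> B" by simp_all
    then have "p \<in> Om n" "shift i (h k) p \<in> Om n" using box_sub by blast+
    then have "\<bar>q k p\<bar> = \<bar>f (shift i (h k) p) - f p\<bar> / h k"
      using h(1)[of k] by (simp add: q_def F_Om)
    also have "\<dots> \<le> L" using L[OF i B] h(1)[of k] by (simp add: divide_le_eq)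
    finally show ?thesis using B by simp
  next
    case False
    then show ?thesis using L0 by (simp add: q_def F_def)
  qed
  have lim: "(\<lambda>k. q k p) \<longlonglongrightarrow> indicator K p * pd i f p"
    if p: "p \<in> K \<longrightarrow> (\<exists>d. has_pd i f p d)" for p
  proof (cases "p \<in> K")
    case True
    then obtain d where d: "has_pd i f p d" using p by blast
    have "((\<lambda>h. (f (shift i h p) - f p) / h) \<longlongrightarrow> d) (at 0)" using d unfolding has_pd_iff_quotient .
    then have "(\<lambda>k. (f (shift i (h k) p) - f p) / h k) \<longlonglongrightarrow> d"
    proof (rule filterlim_compose)
      show "filterlim h (at 0) sequentially"
        by (rule filterlim_atI[OF h_lim always_eventually]) (use h(1) in \<open>simp add: less_imp_neq[symmetric]\<close>)
    qed
    moreover have "q k p = (f (shift i (h k) p) - f p) / h k" for k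
      using F_Om[OF subsetD[OF box_sub K_shift[OF i True h(2)[of k]]]] F_Om[OF subsetD[OF K_Om True]]
      by (simp add: q_def)
    ultimately show ?thesis using True has_pd_imp_pd[OF d] by simp
  next
    case False
    \<comment> \<open>Off the closed set \<open>K\<close> all small translates stay off
      \<open>K\<close>, so the quotients are eventually zero, which is the value that the indicator
      prescribes.\<close>
    have "open (- K)" using closed_K by (simp add: open_Compl)
    moreover have "continuous_on UNIV (\<lambda>h. shift i h p)"
      unfolding shift_def by (intro continuous_on_upd continuous_intros)
    ultimately have "open ((\<lambda>h. shift i h p) -` (- K))" by (rule open_vimage)
    moreover have "0 \<in> (\<lambda>h. shift i h p) -` (- K)" using False by simp
    ultimately have "eventually (\<lambda>h. h \<in> (\<lambda>h. shift i h p) -` (- K)) (nhds 0)"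
      by (rule eventually_nhds_in_open)
    then have "eventually (\<lambda>k. h k \<in> (\<lambda>h. shift i h p) -` (- K)) sequentially"
      using h_lim unfolding filterlim_iff by blast
    then have "eventually (\<lambda>k. q k p = 0) sequentially"
      by (rule eventually_mono) (use False in \<open>simp add: q_def F_def\<close>)
    then show ?thesis using False by (simp add: tendsto_eventually)
  qed
  have "(\<lambda>k. LINT p|M. q k p) \<longlonglongrightarrow> (LINT p|M. indicator K p * pd i f p)"
  proof (rule integral_dominated_convergence[where w = "\<lambda>p. L * indicator B p"])
    show "(\<lambda>p. indicator K p * pd i f p) \<in> borel_measurable M"
      by (rule measurable_K_pd[OF slip_continuous[OF f] i])
    show "q k \<in> borel_measurable M" for k
      unfolding q_def using borel_measurable_integrable[OF shift_int] F_meas by simp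
    show "integrable M (\<lambda>p. L * indicator B p)" by (rule integrable_B)
    show "AE p in M. (\<lambda>k. q k p) \<longlonglongrightarrow> indicator K p * pd i f p"
      by (rule AE_mp[OF D]) (rule AE_I2, rule impI, rule lim)
    show "AE p in M. norm (q k p) \<le> L * indicator B p" for k
      by (rule AE_I2) (simp only: real_norm_def q_bound)
  qed
  then show ?thesis unfolding q0 by (simp add: LIMSEQ_const_iff)
qed

end

section \<open>Rules for partial derivatives and symmetry of second derivatives\<close>

lemma has_pd_const: "has_pd i (\<lambda>_. c) p 0"
  by (simp add: has_pd_def)

lemma has_pd_add: "has_pd i f p a \<Longrightarrow> has_pd i g p b \<Longrightarrow> has_pd i (\<lambda>q. f q + g q) p (a + b)"
  unfolding has_pd_def by (rule DERIV_add)

lemma has_pd_minus: "has_pd i f p a \<Longrightarrow> has_pd i (\<lambda>q. - f q) p (- a)"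
  unfolding has_pd_def by (rule DERIV_minus)

lemma has_pd_diff: "has_pd i f p a \<Longrightarrow> has_pd i g p b \<Longrightarrow> has_pd i (\<lambda>q. f q - g q) p (a - b)"
  unfolding has_pd_def by (rule DERIV_diff)

lemma has_pd_mult: "has_pd i f p a \<Longrightarrow> has_pd i g p b \<Longrightarrow> has_pd i (\<lambda>q. f q * g q) p (a * g p + f p * b)"
  unfolding has_pd_def
  by (drule (1) DERIV_mult) (simp add: algebra_simps)

lemma has_pd_cmult: "has_pd i f p a \<Longrightarrow> has_pd i (\<lambda>q. c * f q) p (c * a)"
  unfolding has_pd_def by (rule DERIV_cmult)

lemma has_pd_sum: "(\<And>j. j \<in> J \<Longrightarrow> has_pd i (f j) p (d j)) \<Longrightarrow> has_pd i (\<lambda>q. \<Sum>j\<in>J. f j q) p (\<Sum>j\<in>J. d j)"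
  unfolding has_pd_def by (rule DERIV_sum)

lemma has_pd_chain:
  assumes "(g has_real_derivative g') (at (f p))" "has_pd i f p d"
  shows "has_pd i (\<lambda>q. g (f q)) p (g' * d)"
  using DERIV_chain2[of g g' "\<lambda>s. f (upd i s p)" "crd i p" d UNIV] assms by (simp add: has_pd_def)

lemma has_pd_crd: "has_pd i (crd j) p (if i = j then 1 else 0)"
  unfolding has_pd_def by (auto simp: crd_upd)

text \<open>Schwarz's theorem on a planar square. Two applications of the mean value theorem turn
  the second difference \<open>\<Delta>\<close> over a small square into \<open>h * h\<close> times
  a value of \<open>gst\<close>, and in the other order into \<open>h * h\<close> times a value of
  \<open>gts\<close>; continuity at the corner finishes the proof.\<close>

lemma mixed_partials_eq:
  fixes g :: "real \<Rightarrow> real \<Rightarrow> real"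
  assumes e: "e > 0"
    and gs: "\<And>s t. \<bar>s - a\<bar> < e \<Longrightarrow> \<bar>t - b\<bar> < e \<Longrightarrow> ((\<lambda>s. g s t) has_real_derivative gs s t) (at s)"
    and gt: "\<And>s t. \<bar>s - a\<bar> < e \<Longrightarrow> \<bar>t - b\<bar> < e \<Longrightarrow> ((\<lambda>t. g s t) has_real_derivative gt s t) (at t)"
    and gst: "\<And>s t. \<bar>s - a\<bar> < e \<Longrightarrow> \<bar>t - b\<bar> < e \<Longrightarrow> ((\<lambda>t. gs s t) has_real_derivative gst s t) (at t)"
    and gts: "\<And>s t. \<bar>s - a\<bar> < e \<Longrightarrow> \<bar>t - b\<bar> < e \<Longrightarrow> ((\<lambda>s. gt s t) has_real_derivative gts s t) (at s)"
    and c1: "\<And>\<epsilon>. \<epsilon> > 0 \<Longrightarrow> \<exists>d>0. \<forall>s t. \<bar>s - a\<bar> < d \<and> \<bar>t - b\<bar> < d \<longrightarrow> \<bar>gst s t - gst a b\<bar> < \<epsilon>"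
    and c2: "\<And>\<epsilon>. \<epsilon> > 0 \<Longrightarrow> \<exists>d>0. \<forall>s t. \<bar>s - a\<bar> < d \<and> \<bar>t - b\<bar> < d \<longrightarrow> \<bar>gts s t - gts a b\<bar> < \<epsilon>"
  shows "gst a b = gts a b"
proof (rule ccontr)
  assume ne: "gst a b \<noteq> gts a b"
  define \<epsilon> where "\<epsilon> = \<bar>gst a b - gts a b\<bar> / 2"
  have \<epsilon>: "\<epsilon> > 0" using ne by (simp add: \<epsilon>_def)
  obtain d1 where d1: "d1 > 0" "\<And>s t. \<bar>s - a\<bar> < d1 \<Longrightarrow> \<bar>t - b\<bar> < d1 \<Longrightarrow> \<bar>gst s t - gst a b\<bar> < \<epsilon>"
    using c1[OF \<epsilon>] by blast
  obtain d2 where d2: "d2 > 0" "\<And>s t. \<bar>s - a\<bar> < d2 \<Longrightarrow> \<bar>t - b\<bar> < d2 \<Longrightarrow> \<bar>gts s t - gts a b\<bar> < \<epsilon>"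
    using c2[OF \<epsilon>] by blast
  define h where "h = min e (min d1 d2) / 2"
  have h: "h > 0" "h < e" "h < d1" "h < d2" using e d1(1) d2(1) by (auto simp: h_def)
  define \<Delta> where "\<Delta> = g (a + h) (b + h) - g (a + h) b - (g a (b + h) - g a b)"
  have "\<exists>x. a < x \<and> x < a + h \<and> \<Delta> = (a + h - a) * (gs x (b + h) - gs x b)"
    unfolding \<Delta>_def
    using h by (intro MVT2[where f = "\<lambda>s. g s (b + h) - g s b"]) (auto intro!: DERIV_diff gs)
  then obtain x where x: "a < x" "x < a + h" "\<Delta> = h * (gs x (b + h) - gs x b)" by auto
  have "\<exists>y. b < y \<and> y < b + h \<and> gs x (b + h) - gs x b = (b + h - b) * gst x y"
    using h x by (intro MVT2) (auto intro!: gst)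
  then obtain y where y: "b < y" "y < b + h" "gs x (b + h) - gs x b = h * gst x y" by auto
  have "\<exists>y. b < y \<and> y < b + h \<and> g (a + h) (b + h) - g a (b + h) - (g (a + h) b - g a b) = (b + h - b) * (gt (a + h) y - gt a y)"
    using h by (intro MVT2[where f = "\<lambda>t. g (a + h) t - g a t"]) (auto intro!: DERIV_diff gt)
  then obtain y' where y': "b < y'" "y' < b + h" "\<Delta> = h * (gt (a + h) y' - gt a y')"
    by (auto simp: \<Delta>_def)
  have "\<exists>x. a < x \<and> x < a + h \<and> gt (a + h) y' - gt a y' = (a + h - a) * gts x y'"
    using h y' by (intro MVT2) (auto intro!: gts)
  then obtain x' where x': "a < x'" "x' < a + h" "gt (a + h) y' - gt a y' = h * gts x' y'" by auto
  have "h * (h * gst x y) = h * (h * gts x' y')" unfolding y(3)[symmetric] x'(3)[symmetric] x(3)[symmetric] by (rule y'(3))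
  then have "gst x y = gts x' y'" using h(1) by simp
  moreover have "\<bar>gst x y - gst a b\<bar> < \<epsilon>" using x y h by (intro d1) auto
  moreover have "\<bar>gts x' y' - gts a b\<bar> < \<epsilon>" using x' y' h by (intro d2) auto
  ultimately have "\<bar>gst a b - gts a b\<bar> < \<epsilon> + \<epsilon>" by linarith
  then show False unfolding \<epsilon>_def by simp
qed

lemma upd_upd_Om:
  assumes "i \<noteq> j" "i \<le> n" "j \<le> n" "p \<in> Om n" "upd i s p \<in> Om n" "upd j t p \<in> Om n"
  shows "upd i s (upd j t p) \<in> Om n"
proof -
  have "fst (upd i s (upd j t p)) \<in> Rn n"
    using assms by (intro upd_Rn) (simp_all add: Om_iff)
  then show ?thesis using assms by (auto simp: Om_iff upd_def split: if_splits)
qed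

lemma pd_commute:
  assumes p: "p \<in> Om n" and i: "i \<le> n" and j: "j \<le> n"
    and f: "\<And>i q. i \<le> n \<Longrightarrow> q \<in> Om n \<Longrightarrow> has_pd i f q (pd i f q)"
    and ff: "\<And>i j q. i \<le> n \<Longrightarrow> j \<le> n \<Longrightarrow> q \<in> Om n \<Longrightarrow> has_pd i (pd j f) q (pd i (pd j f) q)"
    and c: "\<And>i j. i \<le> n \<Longrightarrow> j \<le> n \<Longrightarrow> continuous_on (Om n) (pd i (pd j f))"
  shows "pd i (pd j f) p = pd j (pd i f) p"
proof (cases "i = j")
  case False
  let ?U = "\<lambda>s t. upd i s (upd j t p)"
  let ?a = "crd i p" and ?b = "crd j p"
  have U0: "?U ?a ?b = p" by simp
  obtain e1 where e1: "e1 > 0" "\<And>s. dist s ?a < e1 \<Longrightarrow> upd i s p \<in> Om n"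
    using eventually_upd_Om[OF p i] unfolding eventually_nhds_metric by blast
  obtain e2 where e2: "e2 > 0" "\<And>s. dist s ?b < e2 \<Longrightarrow> upd j s p \<in> Om n"
    using eventually_upd_Om[OF p j] unfolding eventually_nhds_metric by blast
  define e where "e = min e1 e2"
  have e: "e > 0" using e1 e2 by (simp add: e_def)
  have U: "?U s t \<in> Om n" if "\<bar>s - ?a\<bar> < e" "\<bar>t - ?b\<bar> < e" for s t
    using that e1(2)[of s] e2(2)[of t]
    by (intro upd_upd_Om[OF False i j p]) (simp_all add: e_def dist_real_def)
  have di: "((\<lambda>s. F (?U s t)) has_real_derivative d) (at s)" if "has_pd i F (?U s t) d" for F s t d
    using that by (simp add: has_pd_def)
  have dj: "((\<lambda>t. F (?U s t)) has_real_derivative d) (at t)" if "has_pd j F (?U s t) d" for F s t d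
    using that False by (simp add: has_pd_def upd_commute[of i j] crd_upd)
  have cont: "\<exists>d>0. \<forall>s t. \<bar>s - ?a\<bar> < d \<and> \<bar>t - ?b\<bar> < d \<longrightarrow> \<bar>F (?U s t) - F (?U ?a ?b)\<bar> < \<epsilon>"
    if F: "continuous_on (Om n) F" and \<epsilon>: "\<epsilon> > 0" for F :: "point \<Rightarrow> real" and \<epsilon>
  proof -
    let ?S = "{?a - e<..<?a + e} \<times> {?b - e<..<?b + e}"
    have "continuous_on ?S (\<lambda>z. F (?U (fst z) (snd z)))"
    proof (rule continuous_on_compose2[OF F])
      show "continuous_on ?S (\<lambda>z. ?U (fst z) (snd z))" by (intro continuous_on_upd continuous_intros)
      show "(\<lambda>z. ?U (fst z) (snd z)) ` ?S \<subseteq> Om n" using U by (force simp: abs_less_iff)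
    qed
    then have "isCont (\<lambda>z. F (?U (fst z) (snd z))) (?a, ?b)"
      using e by (subst (asm) continuous_on_eq_continuous_at) (auto intro: open_Times)
    then obtain d where d: "d > 0" "\<And>z. dist z (?a, ?b) < d \<Longrightarrow> dist (F (?U (fst z) (snd z))) (F (?U ?a ?b)) < \<epsilon>"
      using \<epsilon> unfolding continuous_at_eps_delta by fastforce
    have "\<bar>F (?U s t) - F (?U ?a ?b)\<bar> < \<epsilon>" if "\<bar>s - ?a\<bar> < d / 2" "\<bar>t - ?b\<bar> < d / 2" for s t
    proof -
      have "dist (s, t) (?a, ?b) \<le> \<bar>s - ?a\<bar> + \<bar>t - ?b\<bar>"
        unfolding dist_Pair_Pair using sqrt_sum_squares_le_sum_abs[of "dist s ?a" "dist t ?b"] by (simp add: dist_real_def)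
      then show ?thesis using d(2)[of "(s, t)"] that by (simp add: dist_real_def)
    qed
    then show ?thesis using d(1) by (intro exI[of _ "d / 2"]) simp
  qed
  have "pd j (pd i f) (?U ?a ?b) = pd i (pd j f) (?U ?a ?b)"
  proof (rule mixed_partials_eq[OF e, where g = "\<lambda>s t. f (?U s t)"
        and gs = "\<lambda>s t. pd i f (?U s t)" and gt = "\<lambda>s t. pd j f (?U s t)"
        and gst = "\<lambda>s t. pd j (pd i f) (?U s t)" and gts = "\<lambda>s t. pd i (pd j f) (?U s t)"])
    fix s t assume st: "\<bar>s - ?a\<bar> < e" "\<bar>t - ?b\<bar> < e"
    note u = U[OF st]
    show "((\<lambda>s. f (?U s t)) has_real_derivative pd i f (?U s t)) (at s)" by (rule di[OF f[OF i u]])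
    show "((\<lambda>t. f (?U s t)) has_real_derivative pd j f (?U s t)) (at t)" by (rule dj[OF f[OF j u]])
    show "((\<lambda>t. pd i f (?U s t)) has_real_derivative pd j (pd i f) (?U s t)) (at t)" by (rule dj[OF ff[OF j i u]])
    show "((\<lambda>s. pd j f (?U s t)) has_real_derivative pd i (pd j f) (?U s t)) (at s)" by (rule di[OF ff[OF i j u]])
  qed (rule cont[OF c[OF j i]] cont[OF c[OF i j]]; assumption)+
  then show ?thesis unfolding U0 by (rule sym)
qed simp

section \<open>Smoothness, supports and Lipschitz coefficients in terms of coordinates\<close>

lemma has_partials_at_has_pd:
  assumes "has_partials_at n f p" "i \<le> n"
  shows "has_pd i f p (pd i f p)"
proof -
  obtain x t where pt: "p = (x, t)" by (cases p)
  have "(\<lambda>s. f (upd i s p)) field_differentiable (at (crd i p))"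
    using assms unfolding pt has_partials_at_def upd_def crd_def by (cases "i = 0") auto
  then show ?thesis unfolding has_pd_def pd_def by (simp only: field_differentiable_derivI)
qed

lemma C_k_Suc_pd:
  assumes "C_k n (Suc k) f"
  shows "continuous_on (Om n) f"
    and "i \<le> n \<Longrightarrow> p \<in> Om n \<Longrightarrow> has_pd i f p (pd i f p)"
    and "i \<le> n \<Longrightarrow> C_k n k (pd i f)"
proof -
  have sub: "Om n \<subseteq> Rn n \<times> {0<..<1}" unfolding Om_def Rn_plus_def by blast
  show "continuous_on (Om n) f"
    by (rule continuous_on_subset[OF _ sub]) (use assms in \<open>simp del: split_paired_All\<close>)
  show "has_pd i f p (pd i f p)" if i: "i \<le> n" and p: "p \<in> Om n"
  proof (rule has_partials_at_has_pd[OF _ i])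
    show "has_partials_at n f p" using assms subsetD[OF sub p] by (simp only: C_k.simps)
  qed
  show "C_k n k (pd i f)" if i: "i \<le> n"
  proof (cases "i = 0")
    case True
    have "partial_t f = pd 0 f" by (rule ext) (rule partial_t_pd)
    then show ?thesis using assms True by simp
  next
    case False
    then have "partial_x i f = pd i f" by (intro ext partial_x_pd) simp
    moreover have "i \<in> {1..n}" using False i by simp
    then have "C_k n k (partial_x i f)" using assms by simp
    ultimately show ?thesis by simp
  qed
qed

lemma has_pd_outside_support:
  assumes "closed K" and zero: "\<And>p. p \<in> Om n \<Longrightarrow> p \<notin> K \<Longrightarrow> f p = 0"
    and p: "p \<in> Om n" "p \<notin> K" and i: "i \<le> n"
  shows "has_pd i f p 0"
proof -
  have "open ((\<lambda>s. upd i s p) -` (- K))"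
    using assms(1) by (intro open_vimage continuous_on_upd continuous_intros) (simp add: open_Compl)
  moreover have "crd i p \<in> (\<lambda>s. upd i s p) -` (- K)" using p by simp
  ultimately have "eventually (\<lambda>s. s \<in> (\<lambda>s. upd i s p) -` (- K)) (nhds (crd i p))"
    by (rule eventually_nhds_in_open)
  then have ev: "eventually (\<lambda>s. f (upd i s p) = 0) (nhds (crd i p))"
    using eventually_upd_Om[OF p(1) i] by eventually_elim (rule zero, simp_all)
  show ?thesis unfolding has_pd_def by (subst DERIV_cong_ev[OF refl ev refl]) simp
qed

lemma support_in_box_exists:
  assumes n: "n \<ge> 1" and K: "compact K" "K \<subseteq> Q_set n"
  shows "\<exists>l r \<delta>. support_in_box n l r K \<delta>"
proof -
  have bd: "\<exists>C. \<forall>p\<in>K. \<bar>crd i p\<bar> \<le> C" for i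
  proof -
    have "compact (crd i ` K)" by (rule compact_continuous_image[OF continuous_on_crd K(1)])
    then show ?thesis using compact_imp_bounded[of "crd i ` K"] by (auto simp: bounded_iff)
  qed
  then obtain C where C: "\<And>i p. p \<in> K \<Longrightarrow> \<bar>crd i p\<bar> \<le> C i" by metis
  have Q: "fst p \<in> Rn n" "crd n p \<ge> 1" "0 < crd 0 p" "crd 0 p < 1" if "p \<in> K" for p
    using subsetD[OF K(2) that] n by (cases p; simp add: Q_set_def crd_def)+
  obtain t0 t1 where t: "0 < t0" "t1 < 1" "\<And>p. p \<in> K \<Longrightarrow> t0 \<le> crd 0 p" "\<And>p. p \<in> K \<Longrightarrow> crd 0 p \<le> t1"
  proof (cases "K = {}")
    case True
    then show ?thesis using that[of "1/2" "1/2"] by simp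
  next
    case False
    obtain p q where "p \<in> K" "\<And>x. x \<in> K \<Longrightarrow> crd 0 p \<le> crd 0 x" "q \<in> K" "\<And>x. x \<in> K \<Longrightarrow> crd 0 x \<le> crd 0 q"
      using continuous_attains_inf[OF K(1) False continuous_on_crd, of 0]
        continuous_attains_sup[OF K(1) False continuous_on_crd, of 0] by blast
    then show ?thesis using Q that[of "crd 0 p" "crd 0 q"] by blast
  qed
  \<comment> \<open>On \<open>K\<close> the time lies in \<open>[t0, t1]\<close> inside (0, 1) and
    the last coordinate is at least 1. Halving the distances to time 0, to time 1 and to the
    boundary of the half-space leaves room for steps up to \<open>\<delta>\<close> and keeps the box
    inside \<open>Om n\<close>.\<close>
  define l where "l i = (if i = 0 then t0 / 2 else if i = n then 1 / 2 else - C i - 1)" for i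
  define r where "r i = (if i = 0 then (1 + t1) / 2 else C i + 1)" for i
  define \<delta> where "\<delta> = min (1 / 2) (min (t0 / 2) ((1 - t1) / 2))"
  have \<delta>: "\<delta> \<le> 1 / 2" "\<delta> \<le> t0 / 2" "\<delta> \<le> (1 - t1) / 2"
    unfolding \<delta>_def by (rule min.cobounded1, rule min.coboundedI2, rule min.cobounded1,
      rule min.coboundedI2, rule min.cobounded2)
  have \<delta>0: "\<delta> > 0" using t(1,2) by (simp add: \<delta>_def)
  have main: "shift i h p \<in> cuboid n l r" if i: "i \<le> n" and p: "p \<in> K" and h: "\<bar>h\<bar> \<le> \<delta>" for i p h
  proof -
    have "l j \<le> crd j p - \<bar>h\<bar>" "crd j p + \<bar>h\<bar> \<le> r j" for j
      using C[OF p, of j] t(3,4)[OF p] Q[OF p] \<delta> h by (auto simp: l_def r_def abs_le_iff)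
    then have "l j \<le> crd j (shift i h p)" "crd j (shift i h p) \<le> r j" for j
      unfolding crd_shift using abs_ge_self[of h] abs_ge_minus_self[of h] 
      by (smt (verit))+
    then show ?thesis unfolding cuboid_def using shift_Rn[OF i Q(1)[OF p]] by simp
  qed
  have "support_in_box n l r K \<delta>"
  proof
    show "closed K" by (rule compact_imp_closed[OF K(1)])
    show "\<delta> > 0" by (rule \<delta>0)
    show "K \<subseteq> cuboid n l r"
    proof
      fix p assume "p \<in> K"
      from main[OF _ this, of 0 0] show "p \<in> cuboid n l r" using \<delta>0 by simp
    qed
    show "cuboid n l r \<subseteq> Om n"
    proof
      fix p assume "p \<in> cuboid n l r"
      then have p: "fst p \<in> Rn n" "\<And>i. i \<le> n \<Longrightarrow> l i \<le> crd i p \<and> crd i p \<le> r i" by (simp_all add: cuboid_def)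
      have "l n \<le> crd n p" "l 0 \<le> crd 0 p" "crd 0 p \<le> r 0" using p(2) by simp_all
      then show "p \<in> Om n" using p(1) n t(1,2) unfolding Om_iff by (simp add: l_def r_def crd_def split: if_splits)
    qed
    show "shift i h p \<in> cuboid n l r" if "i \<le> n" "p \<in> K" "\<bar>h\<bar> \<le> \<delta>" for i p h by (rule main[OF that])
  qed
  then show ?thesis by blast
qed

text \<open>The hypothesis is stated with the Euclidean distance, not with the metric of the
  function space. That distance is a continuous function of the coordinates, which gives continuity,
  and it equals \<open>\<bar>h\<bar>\<close> for a coordinate step, which gives the Lipschitz
  bound.\<close>

lemma slip_lipschitz_coeff:
  assumes "lipschitz_coeff n f" and B: "B \<subseteq> Om n"
  shows "slip n B f"
proof -
  let ?D = "\<lambda>p q. sqrt (\<Sum>i\<le>n. (crd i q - crd i p)\<^sup>2)"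
  obtain L0 where L0: "\<forall>x \<in> Rn_plus n. \<forall>y \<in> Rn_plus n. \<forall>t \<in> {0<..<1}. \<forall>s \<in> {0<..<1}.
        \<bar>f (x, t) - f (y, s)\<bar> \<le> L0 * sqrt ((L2_set (\<lambda>i. x i - y i) {1..n})\<^sup>2 + (t - s)\<^sup>2)"
    using assms(1) unfolding lipschitz_coeff_def by blast
  define L where "L = \<bar>L0\<bar>"
  have L: "\<bar>f q - f p\<bar> \<le> L * ?D p q" if "p \<in> Om n" "q \<in> Om n" for p q
  proof -
    obtain y s x t where pq: "p = (y, s)" "q = (x, t)" by (metis surj_pair)
    have "(L2_set (\<lambda>i. x i - y i) {1..n})\<^sup>2 + (t - s)\<^sup>2 = (\<Sum>i\<in>{1..n}. (crd i q - crd i p)\<^sup>2) + (crd 0 q - crd 0 p)\<^sup>2"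
      unfolding L2_set_def by (subst real_sqrt_pow2) (auto intro!: sum_nonneg sum.cong simp: pq crd_def)
    also have "\<dots> = (\<Sum>i\<le>n. (crd i q - crd i p)\<^sup>2)"
      by (simp add: atMost_atLeast0 sum.atLeast_Suc_atMost[of 0 n])
    finally have eq: "(L2_set (\<lambda>i. x i - y i) {1..n})\<^sup>2 + (t - s)\<^sup>2 = (\<Sum>i\<le>n. (crd i q - crd i p)\<^sup>2)" .
    have "\<bar>f q - f p\<bar> \<le> L0 * ?D p q"
      using L0 that unfolding pq(1,2) eq[symmetric, unfolded pq] by (simp add: Om_def)
    also have "\<dots> \<le> L * ?D p q" unfolding L_def by (intro mult_right_mono) (auto intro: sum_nonneg)
    finally show ?thesis .
  qed
  show ?thesis
  proof (rule slipI)
    show "continuous_on (Om n) f"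
      unfolding continuous_on_def
    proof
      fix p assume p: "p \<in> Om n"
      have "continuous_on (Om n) (\<lambda>q. L * ?D p q)"
        by (intro continuous_on_mult continuous_on_const continuous_on_real_sqrt continuous_on_sum
            continuous_on_power continuous_on_diff continuous_on_crd)
      then have "((\<lambda>q. L * ?D p q) \<longlongrightarrow> L * ?D p p) (at p within Om n)"
        using p unfolding continuous_on_def by blast
      then have D0: "((\<lambda>q. L * ?D p q) \<longlongrightarrow> 0) (at p within Om n)" by simp
      have ev: "eventually (\<lambda>q. norm (f q - f p) \<le> L * ?D p q) (at p within Om n)"
        unfolding eventually_at_topological real_norm_def using L[OF p] by blast
      show "(f \<longlongrightarrow> f p) (at p within Om n)"
        using Lim_null_comparison[OF ev D0] by (simp add: LIM_zero_iff)
    qed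
    show "L \<ge> 0" by (simp add: L_def)
    fix i p h assume i: "i \<le> n" and p: "p \<in> B" "shift i h p \<in> B"
    have "(\<Sum>j\<le>n. (crd j (shift i h p) - crd j p)\<^sup>2) = (\<Sum>j\<le>n. if i = j then h\<^sup>2 else 0)"
      by (intro sum.cong refl) (simp add: crd_shift)
    also have "\<dots> = h\<^sup>2" using i by simp
    finally have "?D p (shift i h p) = \<bar>h\<bar>" by simp
    then show "\<bar>f (shift i h p) - f p\<bar> \<le> L * \<bar>h\<bar>"
      using L[OF subsetD[OF B p(1)] subsetD[OF B p(2)]] by simp
  qed
qed

section \<open>The divergence identity\<close>

lemma sum_DX:
  fixes w B dwd dBd dWv dF db ds H0 V :: "nat \<Rightarrow> real" and v V0 be s F W :: real
  assumes s: "s = (\<Sum>i\<in>I. w i * V i)" and be: "be = (\<Sum>i\<in>I. B i * V i)"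
  shows "(\<Sum>i\<in>I. 2 * (dwd i * V0 + w i * H0 i) - 4 * (dwd i * be + w i * db i) + 2 * (dBd i * s + B i * ds i)
     - 2 * (dwd i * (F * v) + w i * (dF i * v + F * V i))
     - 2 * (dWv i * (B i * v\<^sup>2) + W * (dBd i * v\<^sup>2 + B i * (2 * v * V i)))) =
     2 * (\<Sum>i\<in>I. dwd i) * V0 + 2 * (\<Sum>i\<in>I. w i * H0 i) - 4 * (\<Sum>i\<in>I. dwd i) * be
     - 4 * (\<Sum>i\<in>I. w i * db i) + 2 * (\<Sum>i\<in>I. dBd i) * s + 2 * (\<Sum>i\<in>I. B i * ds i)
     - 2 * (\<Sum>i\<in>I. dwd i) * F * v - 2 * v * (\<Sum>i\<in>I. w i * dF i) - 2 * F * s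
     - 2 * v\<^sup>2 * (\<Sum>i\<in>I. B i * dWv i) - 2 * W * (\<Sum>i\<in>I. dBd i) * v\<^sup>2 - 4 * W * v * be"
proof -
  have "2 * (dwd i * V0 + w i * H0 i) - 4 * (dwd i * be + w i * db i) + 2 * (dBd i * s + B i * ds i)
     - 2 * (dwd i * (F * v) + w i * (dF i * v + F * V i))
     - 2 * (dWv i * (B i * v\<^sup>2) + W * (dBd i * v\<^sup>2 + B i * (2 * v * V i)))
   = (2 * V0) * dwd i + 2 * (w i * H0 i) - (4 * be) * dwd i - 4 * (w i * db i) + (2 * s) * dBd i + 2 * (B i * ds i)
     - (2 * F * v) * dwd i - (2 * v) * (w i * dF i) - (2 * F) * (w i * V i)
     - (2 * v\<^sup>2) * (B i * dWv i) - (2 * W * v\<^sup>2) * dBd i - (4 * W * v) * (B i * V i)" for i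
    by (simp add: algebra_simps)
  then show ?thesis
    by (simp only: sum.distrib sum_subtractf sum_distrib_left[symmetric] s[symmetric] be[symmetric])
      (simp add: algebra_simps)
qed

text \<open>At a point of differentiability: \<open>da k i j\<close> is the derivative of \<open>a i j\<close> in direction \<open>k\<close>
  (\<open>0\<close> is time), \<open>V\<close> and \<open>H\<close> the first and second derivatives of \<open>v\<close>, \<open>dB i k\<close> the derivative
  of \<open>B k\<close> in direction \<open>i\<close>.\<close>

locale jet =
  fixes n :: nat and a :: "nat \<Rightarrow> nat \<Rightarrow> real" and da :: "nat \<Rightarrow> nat \<Rightarrow> nat \<Rightarrow> real"
    and v :: real and V :: "nat \<Rightarrow> real" and H :: "nat \<Rightarrow> nat \<Rightarrow> real"
    and B :: "nat \<Rightarrow> real" and dB :: "nat \<Rightarrow> nat \<Rightarrow> real" and F W :: real and dF dW :: "nat \<Rightarrow> real"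
  assumes a_sym: "\<And>i j. i \<in> {1..n} \<Longrightarrow> j \<in> {1..n} \<Longrightarrow> a i j = a j i"
    and H_sym: "\<And>i j. i \<le> n \<Longrightarrow> j \<le> n \<Longrightarrow> H i j = H j i"
begin

abbreviation "I \<equiv> {1..n}"
definition w :: "nat \<Rightarrow> real" where "w i = (\<Sum>j\<in>I. a i j * V j)"
definition dw :: "nat \<Rightarrow> nat \<Rightarrow> real" where "dw k i = (\<Sum>j\<in>I. da k i j * V j + a i j * H k j)"
definition be :: real where "be = (\<Sum>k\<in>I. B k * V k)"
definition dbe :: "nat \<Rightarrow> real" where "dbe i = (\<Sum>k\<in>I. dB i k * V k + B k * H i k)"
definition s :: real where "s = (\<Sum>i\<in>I. w i * V i)"
definition ds :: "nat \<Rightarrow> real" where "ds k = (\<Sum>i\<in>I. dw k i * V i + w i * H k i)"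

text \<open>The product rule applied to the flux \<open>2 w_i V_0 - 4 w_i be + 2 B_i s - 2 F v w_i -
  2 W v\<^sup>2 B_i\<close>; \<open>DY\<close> does the same for the time flux
  \<open>W v\<^sup>2 - s\<close>. The second and third terms form a Rellich-type flux for the field
  \<open>B\<close>.\<close>

definition DX :: "nat \<Rightarrow> real" where
  "DX i = 2 * (dw i i * V 0 + w i * H i 0) - 4 * (dw i i * be + w i * dbe i) + 2 * (dB i i * s + B i * ds i)
     - 2 * (dw i i * (F * v) + w i * (dF i * v + F * V i))
     - 2 * (dW i * (B i * v\<^sup>2) + W * (dB i i * v\<^sup>2 + B i * (2 * v * V i)))"

definition DY :: real where "DY = - ds 0 + (dW 0 * v\<^sup>2 + W * (2 * v * V 0))"

text \<open>What remains of the cross term once the divergence is split off: a quadratic form in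
  \<open>(v, V)\<close> without second derivatives of \<open>v\<close>.\<close>

definition Qf :: real where
  "Qf = (\<Sum>i\<in>I. \<Sum>j\<in>I. da 0 i j * V i * V j) + 4 * (\<Sum>i\<in>I. w i * (\<Sum>k\<in>I. dB i k * V k))
     - 2 * (\<Sum>k\<in>I. B k * (\<Sum>i\<in>I. \<Sum>j\<in>I. da k i j * V i * V j)) - 2 * (\<Sum>i\<in>I. dB i i) * s + 2 * F * s
     + 2 * v * (\<Sum>i\<in>I. w i * dF i)
     + (2 * (\<Sum>i\<in>I. B i * dW i) + 2 * W * (\<Sum>i\<in>I. dB i i) - dW 0 - 2 * W * F) * v\<^sup>2"

lemma ds_eq:
  assumes "k \<le> n"
  shows "ds k = (\<Sum>i\<in>I. \<Sum>j\<in>I. da k i j * V i * V j) + 2 * (\<Sum>i\<in>I. w i * H k i)"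
proof -
  have "(\<Sum>i\<in>I. (\<Sum>j\<in>I. a i j * H k j) * V i) = (\<Sum>j\<in>I. (\<Sum>i\<in>I. a j i * V i) * H k j)"
    unfolding sum_distrib_right
    by (subst sum.swap) (auto intro!: sum.cong simp: a_sym)
  then have "(\<Sum>i\<in>I. (\<Sum>j\<in>I. a i j * H k j) * V i) = (\<Sum>i\<in>I. w i * H k i)"
    unfolding w_def .
  moreover have "(\<Sum>i\<in>I. (\<Sum>j\<in>I. da k i j * V j) * V i) = (\<Sum>i\<in>I. \<Sum>j\<in>I. da k i j * V i * V j)"
    unfolding sum_distrib_right by (simp add: algebra_simps)
  ultimately show ?thesis
    unfolding ds_def dw_def by (simp add: sum.distrib distrib_right)
qed

text \<open>The second derivatives of \<open>v\<close> cancel by the symmetry of \<open>a\<close>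
  and \<open>H\<close>: those in \<open>2 * (\<Sum>i\<in>I. w i * H i 0)\<close> against
  \<open>ds 0\<close>, and those in \<open>4 * (\<Sum>i\<in>I. w i * dbe i)\<close> against
  \<open>2 * (\<Sum>i\<in>I. B i * ds i)\<close>.\<close>

lemma divergence_identity:
  "2 * ((\<Sum>i\<in>I. dw i i) + W * v) * (V 0 - 2 * be - F * v) = (\<Sum>i\<in>I. DX i) + DY + Qf"
proof -
  have X: "(\<Sum>i\<in>I. DX i) = 2 * (\<Sum>i\<in>I. dw i i) * V 0 + 2 * (\<Sum>i\<in>I. w i * H i 0) - 4 * (\<Sum>i\<in>I. dw i i) * be
     - 4 * (\<Sum>i\<in>I. w i * dbe i) + 2 * (\<Sum>i\<in>I. dB i i) * s + 2 * (\<Sum>i\<in>I. B i * ds i)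
     - 2 * (\<Sum>i\<in>I. dw i i) * F * v - 2 * v * (\<Sum>i\<in>I. w i * dF i) - 2 * F * s
     - 2 * v\<^sup>2 * (\<Sum>i\<in>I. B i * dW i) - 2 * W * (\<Sum>i\<in>I. dB i i) * v\<^sup>2 - 4 * W * v * be"
    unfolding DX_def by (rule sum_DX[OF s_def be_def])
  have 0: "ds 0 = (\<Sum>i\<in>I. \<Sum>j\<in>I. da 0 i j * V i * V j) + 2 * (\<Sum>i\<in>I. w i * H i 0)"
    using H_sym by (simp add: ds_eq)
  have 1: "(\<Sum>i\<in>I. w i * dbe i) = (\<Sum>i\<in>I. w i * (\<Sum>k\<in>I. dB i k * V k)) + (\<Sum>i\<in>I. \<Sum>k\<in>I. w i * B k * H i k)"
    unfolding dbe_def by (simp add: sum.distrib distrib_left sum_distrib_left mult.assoc)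
  have 2: "(\<Sum>k\<in>I. B k * ds k) = (\<Sum>k\<in>I. B k * (\<Sum>i\<in>I. \<Sum>j\<in>I. da k i j * V i * V j))
     + 2 * (\<Sum>k\<in>I. \<Sum>i\<in>I. B k * (w i * H k i))"
    by (simp add: ds_eq distrib_left sum.distrib sum_distrib_left mult.left_commute)
  have 3: "(\<Sum>k\<in>I. \<Sum>i\<in>I. B k * (w i * H k i)) = (\<Sum>i\<in>I. \<Sum>k\<in>I. w i * B k * H i k)"
    by (subst sum.swap) (auto intro!: sum.cong simp: H_sym)
  show ?thesis
    unfolding X DY_def Qf_def 0 1 2 3 by (simp add: algebra_simps power2_eq_square)
qed

end

text \<open>Discarding the squares of \<open>S + R v\<close> and \<open>T\<close> up to \<open>R\<^sup>2 v\<^sup>2\<close> leaves a term \<open>2 S T\<close> in which \<open>R\<close>,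
  which has no derivatives, does not occur.\<close>

lemma square_ge_cross_term: "(S + R * v + T)\<^sup>2 \<ge> 2 * S * T - R\<^sup>2 * v\<^sup>2" for S R v T :: real
proof -
  have "(S + R * v + T)\<^sup>2 - (2 * S * T - R\<^sup>2 * v\<^sup>2) = (S + R * v)\<^sup>2 + (T + R * v)\<^sup>2"
    by (simp add: power2_eq_square algebra_simps)
  then show ?thesis by (smt (verit) zero_le_power2)
qed

section \<open>Ellipticity and the function psi\<close>

lemma abs_sum_le:
  assumes "\<And>i. i \<in> {1..n::nat} \<Longrightarrow> \<bar>f i :: real\<bar> \<le> C"
  shows "\<bar>\<Sum>i\<in>{1..n}. f i\<bar> \<le> n * C"
  using sum_norm_bound[of "{1..n}" f C] assms by simp

lemma abs_le_L2_set: "i \<in> {1..n::nat} \<Longrightarrow> \<bar>x i\<bar> \<le> L2_set x {1..n}"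
  using member_le_L2_set[of "{1..n}" i "\<lambda>i. \<bar>x i\<bar>"] by (simp add: L2_set_def)

lemma abs_sum_mult_le:
  assumes "\<And>i. i \<in> {1..n::nat} \<Longrightarrow> \<bar>f i\<bar> \<le> C" "C \<ge> 0"
  shows "\<bar>\<Sum>i\<in>{1..n}. f i * x i\<bar> \<le> n * (C * L2_set x {1..n})"
  by (rule abs_sum_le) (unfold abs_mult, intro mult_mono assms abs_le_L2_set L2_set_nonneg abs_ge_zero)

lemma abs_double_sum_le:
  assumes "\<And>i j. i \<in> {1..n::nat} \<Longrightarrow> j \<in> {1..n} \<Longrightarrow> \<bar>f i j\<bar> \<le> C" "C \<ge> 0"
  shows "\<bar>\<Sum>i\<in>{1..n}. \<Sum>j\<in>{1..n}. f i j * x i * y j\<bar> \<le> n * (n * (C * L2_set x {1..n} * L2_set y {1..n}))"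
proof (rule abs_sum_le)
  fix i assume i: "i \<in> {1..n}"
  show "\<bar>\<Sum>j\<in>{1..n}. f i j * x i * y j\<bar> \<le> n * (C * L2_set x {1..n} * L2_set y {1..n})"
  proof (rule abs_sum_mult_le)
    show "\<bar>f i j * x i\<bar> \<le> C * L2_set x {1..n}" if "j \<in> {1..n}" for j
      unfolding abs_mult using assms i that by (intro mult_mono abs_le_L2_set) auto
    show "0 \<le> C * L2_set x {1..n}" using assms(2) by simp
  qed
qed

lemma L2_set_sq: "(L2_set x {1..n::nat})\<^sup>2 = (\<Sum>i\<in>{1..n}. (x i)\<^sup>2)"
  unfolding L2_set_def by (rule real_sqrt_pow2) (simp add: sum_nonneg)

locale elliptic =
  fixes n :: nat and lam Lam :: real and a :: "nat \<Rightarrow> nat \<Rightarrow> real"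
  assumes n: "n \<ge> 1" and lam: "0 < lam" and lam_Lam: "lam \<le> Lam"
    and a_sym: "\<And>i j. i \<in> {1..n} \<Longrightarrow> j \<in> {1..n} \<Longrightarrow> a i j = a j i"
    and ell_lower: "\<And>\<xi>. lam * (L2_set \<xi> {1..n})\<^sup>2 \<le> (\<Sum>i\<in>{1..n}. \<Sum>j\<in>{1..n}. a i j * \<xi> i * \<xi> j)"
    and ell_upper: "\<And>\<xi>. (\<Sum>i\<in>{1..n}. \<Sum>j\<in>{1..n}. a i j * \<xi> i * \<xi> j) \<le> Lam * (L2_set \<xi> {1..n})\<^sup>2"
begin

abbreviation nrm :: "(nat \<Rightarrow> real) \<Rightarrow> real" where "nrm x \<equiv> L2_set x {1..n}"

definition Av :: "(nat \<Rightarrow> real) \<Rightarrow> nat \<Rightarrow> real" where "Av x i = (\<Sum>j\<in>{1..n}. a i j * x j)"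

definition Af :: "(nat \<Rightarrow> real) \<Rightarrow> (nat \<Rightarrow> real) \<Rightarrow> real" where
  "Af x y = (\<Sum>i\<in>{1..n}. Av x i * y i)"

lemma Lam_pos: "Lam > 0" using lam lam_Lam by simp

lemma n_in: "n \<in> {1..n}" using n by simp

lemma Av_add: "Av (\<lambda>i. x i + c * y i) i = Av x i + c * Av y i"
  by (simp add: Av_def distrib_left sum.distrib sum_distrib_left mult.left_commute)

lemma Af_commute: "Af x y = Af y x"
  unfolding Af_def Av_def sum_distrib_right
  by (subst sum.swap) (auto intro!: sum.cong simp: a_sym)

lemma Af_add: "Af (\<lambda>i. x i + c * y i) (\<lambda>i. x i + c * y i) = Af x x + 2 * c * Af x y + c\<^sup>2 * Af y y"
proof -
  have "Af (\<lambda>i. x i + c * y i) (\<lambda>i. x i + c * y i) = Af x x + c * Af x y + c * Af y x + c\<^sup>2 * Af y y"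
    unfolding Af_def Av_add
    by (simp add: algebra_simps sum.distrib sum_distrib_left power2_eq_square)
  then show ?thesis by (simp add: Af_commute[of y x])
qed

lemma Af_lower: "lam * (nrm x)\<^sup>2 \<le> Af x x"
  using ell_lower[of x] unfolding Af_def Av_def sum_distrib_right by (simp add: mult_ac)

lemma Af_upper: "Af x x \<le> Lam * (nrm x)\<^sup>2"
  using ell_upper[of x] unfolding Af_def Av_def sum_distrib_right by (simp add: mult_ac)

lemma Af_nonneg: "0 \<le> Af x x"
  using Af_lower[of x] lam by (smt (verit) mult_nonneg_nonneg zero_le_power2)

text \<open>Positivity of the form at \<open>x - y / Lam\<close> with \<open>y = A x\<close>,
  together with the upper ellipticity bound at \<open>x\<close> and at \<open>y\<close>, yields the
  operator norm without diagonalising \<open>A\<close>.\<close>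

lemma nrm_Av: "nrm (Av x) \<le> Lam * nrm x"
proof -
  let ?y = "Av x"
  have xy: "Af x ?y = (nrm ?y)\<^sup>2"
    unfolding Af_def L2_set_sq by (simp add: power2_eq_square)
  have "0 \<le> Af (\<lambda>i. x i + (- 1 / Lam) * ?y i) (\<lambda>i. x i + (- 1 / Lam) * ?y i)" by (rule Af_nonneg)
  also have "\<dots> = Af x x - 2 / Lam * (nrm ?y)\<^sup>2 + 1 / Lam\<^sup>2 * Af ?y ?y"
    unfolding Af_add xy by (simp add: power_divide)
  also have "\<dots> \<le> Lam * (nrm x)\<^sup>2 - 2 / Lam * (nrm ?y)\<^sup>2 + 1 / Lam\<^sup>2 * (Lam * (nrm ?y)\<^sup>2)"
    using Af_upper[of x] Af_upper[of ?y] Lam_pos by (intro add_mono diff_mono mult_left_mono) auto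
  also have "\<dots> = Lam * (nrm x)\<^sup>2 - (nrm ?y)\<^sup>2 / Lam"
    using Lam_pos by (simp add: power2_eq_square field_simps)
  finally have "(nrm ?y)\<^sup>2 \<le> (Lam * nrm x)\<^sup>2"
    using Lam_pos by (simp add: field_simps power2_eq_square)
  then show ?thesis by (rule power2_le_imp_le) (use Lam_pos in simp)
qed

lemma Av_comp: "i \<in> {1..n} \<Longrightarrow> \<bar>Av x i\<bar> \<le> Lam * nrm x"
  using abs_le_L2_set[of i n "Av x"] nrm_Av[of x] by linarith

definition e :: "nat \<Rightarrow> real" where "e i = (if i = n then 1 else 0)"

lemma Af_e: "Af e x = Av x n"
  unfolding Af_commute[of e x] unfolding Af_def e_def using n by (simp add: if_distrib cong: if_cong)

lemma Av_e: "Av e n = a n n"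
  unfolding Av_def e_def using n by (simp add: if_distrib cong: if_cong)

lemma nrm_e: "nrm e = 1"
proof -
  have "(nrm e)\<^sup>2 = (\<Sum>i\<in>{1..n}. if i = n then 1 else 0)"
    unfolding L2_set_sq e_def by (intro sum.cong) auto
  also have "\<dots> = 1\<^sup>2" using n by simp
  finally show ?thesis by (rule power2_eq_imp_eq) simp_all
qed

lemma ann: "lam \<le> a n n" "a n n \<le> Lam"
  using Af_lower[of e] Af_upper[of e] unfolding Af_e Av_e nrm_e by simp_all

lemma a_entry: "i \<in> {1..n} \<Longrightarrow> j \<in> {1..n} \<Longrightarrow> \<bar>a i j\<bar> \<le> Lam"
proof -
  assume i: "i \<in> {1..n}" and j: "j \<in> {1..n}"
  let ?e = "\<lambda>k. if k = j then 1 else (0::real)"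
  have "(nrm ?e)\<^sup>2 = (\<Sum>k\<in>{1..n}. if k = j then 1 else 0)"
    unfolding L2_set_sq by (intro sum.cong) auto
  also have "\<dots> = 1\<^sup>2" using j by simp
  finally have "nrm ?e = 1" by (rule power2_eq_imp_eq) simp_all
  moreover have "Av ?e i = a i j" unfolding Av_def using j by (simp add: if_distrib cong: if_cong)
  ultimately show "\<bar>a i j\<bar> \<le> Lam" using Av_comp[OF i, of ?e] by simp
qed

text \<open>Ellipticity applied to \<open>\<bar>y\<bar> e - y\<close>, with \<open>y\<close> the part of \<open>x\<close> orthogonal to \<open>e\<close>. The gain of
  \<open>2 lam\<close> over the trivial bound \<open>Lam \<bar>x\<bar>\<close> is what makes the conormal derivative of \<open>\<psi>\<close> strictly negative.\<close>

lemma Av_n_upper: "Av x n \<le> x n * a n n + nrm x * (a n n + Lam - 2 * lam) / 2"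
proof -
  define y where "y i = x i + (- x n) * e i" for i
  define \<rho> where "\<rho> = nrm y"
  have \<rho>0: "\<rho> \<ge> 0" by (simp add: \<rho>_def)
  have "\<rho>\<^sup>2 \<le> (nrm x)\<^sup>2"
    unfolding \<rho>_def L2_set_sq by (intro sum_mono) (auto simp: y_def e_def)
  then have \<rho>x: "\<rho> \<le> nrm x" by (rule power2_le_imp_le) simp
  have Avy: "Av y n = Av x n - x n * a n n"
    unfolding y_def[abs_def] Av_add Av_e by simp
  have coef: "0 \<le> a n n + Lam - 2 * lam" using ann lam_Lam by simp
  have "Av y n \<le> \<rho> * (a n n + Lam - 2 * lam) / 2"
  proof (cases "\<rho> = 0")
    case True
    then show ?thesis using Av_comp[OF n_in, of y] by (simp add: \<rho>_def)
  next
    case False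
    let ?z = "\<lambda>i. y i + (- \<rho>) * e i"
    have "(nrm ?z)\<^sup>2 = (\<Sum>i\<in>{1..n}. (y i)\<^sup>2 + (if i = n then \<rho>\<^sup>2 else 0))"
      unfolding L2_set_sq by (intro sum.cong refl) (auto simp: y_def e_def)
    also have "\<dots> = (nrm y)\<^sup>2 + \<rho>\<^sup>2" unfolding L2_set_sq using n by (simp add: sum.distrib)
    finally have z: "(nrm ?z)\<^sup>2 = 2 * \<rho>\<^sup>2" by (simp add: \<rho>_def)
    have "lam * (2 * \<rho>\<^sup>2) \<le> Af ?z ?z" using Af_lower[of ?z] unfolding z .
    also have "\<dots> = Af y y - 2 * \<rho> * Av y n + \<rho>\<^sup>2 * a n n"
      unfolding Af_add Af_commute[of y e] Af_e Av_e by simp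
    also have "\<dots> \<le> Lam * \<rho>\<^sup>2 - 2 * \<rho> * Av y n + \<rho>\<^sup>2 * a n n"
      using Af_upper[of y] by (simp add: \<rho>_def)
    finally have "\<rho> * Av y n \<le> \<rho> * (\<rho> * (a n n + Lam - 2 * lam) / 2)"
      by (simp add: algebra_simps power2_eq_square)
    then show ?thesis using False \<rho>0 by (simp only: mult_le_cancel_left_pos)
  qed
  also have "\<dots> \<le> nrm x * (a n n + Lam - 2 * lam) / 2"
    using \<rho>x coef by (intro divide_right_mono mult_right_mono) auto
  finally show ?thesis using Avy by simp
qed

section \<open>Gradient, Hessian and conormal derivative of psi\<close>

definition \<kappa> :: real where "\<kappa> = Lam / lam"
text \<open>One constant for two bounds: it dominates the gradient of \<open>\<psi>\<close> relative
  to \<open>nrm x\<close> and every entry of the Hessian. The \<open>8 * \<kappa>\<close> counts the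
  four terms of the bracket in \<open>psi2\<close>, each at most 1.\<close>

definition C\<psi> :: real where "C\<psi> = 2 + 8 * \<kappa> + 4 * \<kappa>\<^sup>2"
text \<open>Collects the multiples of \<open>x n\<close> lost in \<open>conormal_psi\<close>:
  \<open>2 * Lam\<close> from \<open>Av_n_upper\<close>, \<open>2 * \<kappa> * Lam\<close> from the
  derivative of \<open>nrm x\<close>, and \<open>4 * \<kappa>\<^sup>2 * Lam\<close> from the last
  square in \<open>\<psi>\<close>.\<close>

definition C2 :: real where "C2 = 2 * Lam + 2 * \<kappa> * Lam + 4 * \<kappa>\<^sup>2 * Lam"

text \<open>The gradient, and in \<open>psi2\<close> the Hessian, of \<open>psi n Lam lam\<close>.
  That they are derivatives is shown for their counterparts \<open>psi1f\<close> and
  \<open>psi2f\<close>, which are functions on space-time.\<close>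

definition psi1 :: "(nat \<Rightarrow> real) \<Rightarrow> nat \<Rightarrow> real" where
  "psi1 x i = (2 - 2 * \<kappa> * x n / nrm x) * x i + (4 * \<kappa>\<^sup>2 * x n - 2 * \<kappa> * nrm x) * e i"

definition psi2 :: "(nat \<Rightarrow> real) \<Rightarrow> nat \<Rightarrow> nat \<Rightarrow> real" where
  "psi2 x i j = 2 * (if i = j then 1 else 0) + 4 * \<kappa>\<^sup>2 * (e i * e j)
     - 2 * \<kappa> * ((if i = j then 1 else 0) * (x n / nrm x) + e j * (x i / nrm x) + e i * (x j / nrm x)
        - (x i / nrm x) * (x j / nrm x) * (x n / nrm x))"

lemma \<kappa>1: "\<kappa> \<ge> 1" using lam lam_Lam by (simp add: \<kappa>_def)

lemma C\<psi>_pos: "C\<psi> > 0" using \<kappa>1 unfolding C\<psi>_def by (intro add_pos_nonneg) auto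

lemma xn_le: "\<bar>x n\<bar> \<le> nrm x" by (rule abs_le_L2_set[OF n_in])

lemma psi1_bound:
  assumes x: "x n > 0"
  shows "nrm (psi1 x) \<le> C\<psi> * nrm x"
proof -
  have r: "0 < nrm x" using xn_le[of x] x by simp
  let ?p = "2 - 2 * \<kappa> * x n / nrm x" and ?q = "4 * \<kappa>\<^sup>2 * x n - 2 * \<kappa> * nrm x"
  have q1: "0 \<le> x n / nrm x" "x n / nrm x \<le> 1" using xn_le[of x] x r by (simp_all add: divide_le_eq)
  have scal: "nrm (\<lambda>i. c * z i) = \<bar>c\<bar> * nrm z" for c z
    by (simp add: L2_set_def power_mult_distrib sum_distrib_left[symmetric] real_sqrt_mult)
  have "nrm (psi1 x) \<le> nrm (\<lambda>i. ?p * x i) + nrm (\<lambda>i. ?q * e i)"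
    unfolding psi1_def[abs_def] by (rule L2_set_triangle_ineq)
  also have "\<dots> = \<bar>?p\<bar> * nrm x + \<bar>?q\<bar>" unfolding scal nrm_e by simp
  also have "\<dots> \<le> (2 + 2 * \<kappa>) * nrm x + (4 * \<kappa>\<^sup>2 + 2 * \<kappa>) * nrm x"
  proof (intro add_mono mult_right_mono)
    have "0 \<le> 2 * \<kappa>" using \<kappa>1 by simp
    then have "0 \<le> 2 * \<kappa> * (x n / nrm x)" "2 * \<kappa> * (x n / nrm x) \<le> 2 * \<kappa> * 1"
      by (rule mult_nonneg_nonneg[OF _ q1(1)], rule mult_left_mono[OF q1(2)])
    then show "\<bar>?p\<bar> \<le> 2 + 2 * \<kappa>" by (simp add: abs_le_iff)
    have "0 \<le> 4 * \<kappa>\<^sup>2 * x n" "4 * \<kappa>\<^sup>2 * x n \<le> 4 * \<kappa>\<^sup>2 * nrm x" "0 \<le> 2 * \<kappa> * nrm x"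
      using x xn_le[of x] \<kappa>1 r by (auto intro!: mult_left_mono)
    then show "\<bar>?q\<bar> \<le> (4 * \<kappa>\<^sup>2 + 2 * \<kappa>) * nrm x" by (simp add: abs_le_iff algebra_simps)
  qed (use r in simp)
  also have "\<dots> \<le> C\<psi> * nrm x" using \<kappa>1 r by (simp add: C\<psi>_def algebra_simps)
  finally show ?thesis .
qed

lemma psi2_bound:
  assumes "x n > 0" "i \<in> {1..n}" "j \<in> {1..n}"
  shows "\<bar>psi2 x i j\<bar> \<le> C\<psi>"
proof -
  have r: "0 < nrm x" using xn_le[of x] assms(1) by simp
  define d where "d = (if i = j then 1 else (0::real))"
  define z where "z k = x k / nrm x" for k
  have z: "\<bar>z k\<bar> \<le> 1" if "k \<in> {1..n}" for k
    using abs_le_L2_set[OF that, of x] r by (simp add: z_def abs_divide divide_le_eq)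
  have e1: "\<bar>e k\<bar> \<le> 1" for k by (simp add: e_def)
  have d1: "\<bar>d\<bar> \<le> 1" by (simp add: d_def)
  have m1: "\<bar>u * v\<bar> \<le> 1" if "\<bar>u\<bar> \<le> 1" "\<bar>v\<bar> \<le> 1" for u v :: real
    using mult_mono[OF that] by (simp add: abs_mult)
  have "\<bar>d * z n\<bar> \<le> 1" "\<bar>e j * z i\<bar> \<le> 1" "\<bar>e i * z j\<bar> \<le> 1" "\<bar>z i * z j * z n\<bar> \<le> 1"
    by (intro m1 d1 e1 z assms n_in)+
  then have 1: "\<bar>d * z n + e j * z i + e i * z j - z i * z j * z n\<bar> \<le> 4" by linarith
  have 2: "\<bar>e i * e j\<bar> \<le> 1" by (intro m1 e1)
  have "psi2 x i j = 2 * d + 4 * \<kappa>\<^sup>2 * (e i * e j) - 2 * \<kappa> * (d * z n + e j * z i + e i * z j - z i * z j * z n)"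
    unfolding psi2_def d_def z_def by simp
  also have "\<bar>\<dots>\<bar> \<le> 2 * \<bar>d\<bar> + 4 * \<kappa>\<^sup>2 * \<bar>e i * e j\<bar> + 2 * \<kappa> * \<bar>d * z n + e j * z i + e i * z j - z i * z j * z n\<bar>"
    using \<kappa>1 by (intro order_trans[OF abs_triangle_ineq4] add_mono order_trans[OF abs_triangle_ineq]) (simp_all add: abs_mult)
  also have "\<dots> \<le> 2 * 1 + 4 * \<kappa>\<^sup>2 * 1 + 2 * \<kappa> * 4"
    using 1 2 d1 \<kappa>1 by (intro add_mono mult_left_mono) auto
  finally show ?thesis by (simp add: C\<psi>_def)
qed

text \<open>The coefficients of \<open>\<psi>\<close> are those of a completed square: the
  difference of the two sides is \<open>2 * (nrm x / 2 - \<kappa> * x n)\<^sup>2\<close>.\<close>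

lemma psi_lower:
  assumes "x n > 0"
  shows "psi n Lam lam x \<ge> (nrm x)\<^sup>2 / 2"
proof -
  have "psi n Lam lam x - (nrm x)\<^sup>2 / 2 = (nrm x / 2 - \<kappa> * x n)\<^sup>2 * 2"
    unfolding psi_def \<kappa>_def[symmetric] by (simp add: power2_eq_square algebra_simps)
  then show ?thesis by (smt (verit) zero_le_power2)
qed

text \<open>The cross term of \<open>\<psi>\<close> contributes \<open>2 \<kappa> |x| a_nn\<close>.
  It has to beat \<open>2 (A x)_n\<close>, which \<open>Av_n_upper\<close> bounds by
  \<open>(a_nn + Lam - 2 lam) |x|\<close> up to a multiple of \<open>x n\<close>; since
  \<open>(2 \<kappa> - 1) a_nn \<ge> 2 Lam - lam\<close>, at least \<open>(Lam + lam) |x|\<close> is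
  left.\<close>

lemma conormal_psi:
  assumes x: "x n > 0"
  shows "- Av (psi1 x) n \<ge> (Lam + lam) * nrm x - C2 * x n"
proof -
  have r: "0 < nrm x" using xn_le[of x] x by simp
  have "Av (psi1 x) n = Av (\<lambda>i. (4 * \<kappa>\<^sup>2 * x n - 2 * \<kappa> * nrm x) * e i + (2 - 2 * \<kappa> * x n / nrm x) * x i) n"
    by (simp add: psi1_def[abs_def] add.commute)
  also have "\<dots> = (4 * \<kappa>\<^sup>2 * x n - 2 * \<kappa> * nrm x) * a n n + (2 - 2 * \<kappa> * x n / nrm x) * Av x n"
  proof -
    have "Av (\<lambda>i. c * e i) n = c * a n n" for c
      using Av_add[of "\<lambda>_. 0" c e n] unfolding Av_e by (simp add: Av_def)
    then show ?thesis unfolding Av_add by simp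
  qed
  finally have "- Av (psi1 x) n = 2 * \<kappa> * nrm x * a n n - 4 * \<kappa>\<^sup>2 * x n * a n n - 2 * Av x n
      + 2 * \<kappa> * (x n / nrm x * Av x n)" by (simp add: algebra_simps)
  moreover define T where "T = x n / nrm x * Av x n"
  ultimately have eq: "- Av (psi1 x) n = 2 * \<kappa> * nrm x * a n n - 4 * \<kappa>\<^sup>2 * x n * a n n - 2 * Av x n + 2 * \<kappa> * T"
    by simp
  have "- (Lam * nrm x) \<le> Av x n" using Av_comp[OF n_in, of x] by linarith
  then have "x n / nrm x * - (Lam * nrm x) \<le> T" unfolding T_def using x r by (intro mult_left_mono) auto
  then have "- (Lam * x n) \<le> T" using r by (simp add: mult.commute)
  then have 1: "2 * \<kappa> * (- (Lam * x n)) \<le> 2 * \<kappa> * T" using \<kappa>1 by (intro mult_left_mono) auto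
  have 2: "4 * \<kappa>\<^sup>2 * x n * a n n \<le> 4 * \<kappa>\<^sup>2 * x n * Lam" using ann x by (intro mult_left_mono) auto
  have 3: "x n * a n n \<le> x n * Lam" using ann x by (intro mult_left_mono) auto
  have "(2 * \<kappa> - 1) * lam \<le> (2 * \<kappa> - 1) * a n n" using ann \<kappa>1 by (intro mult_left_mono) auto
  moreover have "(2 * \<kappa> - 1) * lam = 2 * Lam - lam" using lam by (simp add: \<kappa>_def field_simps)
  ultimately have "nrm x * (2 * Lam - lam) \<le> nrm x * ((2 * \<kappa> - 1) * a n n)"
    using mult_left_mono[OF _ less_imp_le[OF r]] by simp
  then show ?thesis using 1 2 3 Av_n_upper[of x] unfolding eq C2_def
    by (simp add: algebra_simps add_divide_distrib diff_divide_distrib)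
qed

end

section \<open>Positivity at a point\<close>

text \<open>At a point \<open>(x, t)\<close> with \<open>\<tau> = 1/t\<close>, \<open>q = \<gamma> t powr (-K)\<close> and \<open>g = q - \<gamma>\<close>; \<open>\<eta>\<close> and \<open>P2\<close> are the space
  gradient and Hessian of \<open>\<phi>\<close>, and \<open>P0\<close>, \<open>P02\<close>, \<open>P00\<close> its time, mixed and second time derivatives.
  \<open>P2\<close> carries the term \<open>3/4 g / sqrt x\<^sub>n\<close> that \<open>F\<close> compensates.\<close>

locale carleman_point = elliptic n lam Lam a for n lam Lam a +
  fixes da :: "nat \<Rightarrow> nat \<Rightarrow> nat \<Rightarrow> real" and x :: "nat \<Rightarrow> real" and \<tau> g q b c c1 \<Theta> K M E :: real
  assumes xn: "x n \<ge> 1" and \<tau>: "\<tau> \<ge> 1" and g: "0 \<le> g" "g \<le> q"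
    and da0: "\<And>i j. i \<in> {1..n} \<Longrightarrow> j \<in> {1..n} \<Longrightarrow> \<bar>da 0 i j\<bar> \<le> M"
    and dak: "\<And>k i j. k \<in> {1..n} \<Longrightarrow> i \<in> {1..n} \<Longrightarrow> j \<in> {1..n} \<Longrightarrow> \<bar>da k i j\<bar> \<le> E / nrm x"
    and pos: "b > 0" "c > 0" "c1 > 0" "\<Theta> \<ge> 4" "K > 0" "M > 0" "E > 0"
    and A1: "12 * real n ^ 3 * Lam * E \<le> lam * c"
    and A2: "4 * real n ^ 3 * Lam * E * b * C\<psi> + (real n)\<^sup>2 * M + 3 * b * (real n)\<^sup>2 * C\<psi> * Lam\<^sup>2 + 2 \<le> 2 * lam * \<Theta>"
    and A3: "3 * (real n)\<^sup>2 * E \<le> c" "(real n)\<^sup>2 * E * b * C\<psi> + b * (real n)\<^sup>2 * Lam * C\<psi> \<le> \<Theta>"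
    and A4: "2 * b * (real n)\<^sup>2 * C\<psi> * Lam\<^sup>2 + (real n)\<^sup>2 * M + real n ^ 3 * Lam * E * b * C\<psi> + 2 \<le> \<Theta>"
    and A5: "3 * real n ^ 3 * Lam * E + 3 * Lam * c \<le> 3 / 2 * c1\<^sup>2" "c1 \<le> lam" "c1 * C\<psi> \<le> Lam + lam"
    and A6: "c \<le> lam" "9 / 2 * ((3 * Lam + 1) * \<Theta>) + 9 / 2 * c\<^sup>2 \<le> 6 * K * lam"
    and A7: "3 * K * b * C2 + 3 * b * C2 + 3 / 4 * b\<^sup>2 * C2\<^sup>2 + 3 * \<Theta> * K
       + (real n * (E + Lam + c) * Lam)\<^sup>2 / (lam * c) \<le> K * (K + 1)"
    and A8: "(3 * Lam + 1) * b * C\<psi>\<^sup>2 \<le> 1 / 4"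
    and A9: "9 / 2 * \<Theta>\<^sup>2 + 1 \<le> K"
begin

definition y :: real where "y = sqrt (x n)"
text \<open>The second derivative of \<open>g x_n^(3/2)\<close> in \<open>x_n\<close> is
  \<open>3 / 4 * \<rho>\<close>, so \<open>\<rho>\<close> measures the Hessian of the part of
  \<open>\<phi>\<close> that carries \<open>\<gamma>\<close>.\<close>

definition \<rho> :: real where "\<rho> = g / y"
definition \<eta> :: "nat \<Rightarrow> real" where "\<eta> i = 3 / 2 * g * y * e i - b * \<tau> / 2 * psi1 x i"
definition P2 :: "nat \<Rightarrow> nat \<Rightarrow> real" where "P2 i j = 3 / 4 * \<rho> * (e i * e j) - b * \<tau> / 2 * psi2 x i j"
definition P02 :: "nat \<Rightarrow> real" where "P02 i = b * \<tau>\<^sup>2 / 2 * psi1 x i - 3 / 2 * K * q * \<tau> * y * e i"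
definition P0 :: real where "P0 = (b * psi n Lam lam x + K) * \<tau>\<^sup>2 / 2 - K * q * \<tau> * y ^ 3"
definition P00 :: real where "P00 = K * (K + 1) * q * \<tau>\<^sup>2 * y ^ 3 - (b * psi n Lam lam x + K) * \<tau> ^ 3"
definition dB :: "nat \<Rightarrow> nat \<Rightarrow> real" where "dB i k = (\<Sum>l\<in>{1..n}. da i k l * \<eta> l + a k l * P2 i l)"
definition F :: real where "F = (3 / 4 * a n n + c) * \<rho> + \<Theta> * \<tau>"
definition dF :: "nat \<Rightarrow> real" where
  "dF i = 3 / 4 * da i n n * \<rho> - (3 / 4 * a n n + c) * (g / (2 * y ^ 3)) * e i"
definition R :: real where "R = F - (\<Sum>i\<in>{1..n}. dB i i)"
definition W :: real where "W = Af \<eta> \<eta> - P0"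
definition dW :: "nat \<Rightarrow> real" where
  "dW k = (\<Sum>i\<in>{1..n}. \<Sum>j\<in>{1..n}. da k i j * \<eta> i * \<eta> j)
     + 2 * (\<Sum>i\<in>{1..n}. Av \<eta> i * (if k = 0 then P02 i else P2 k i)) - (if k = 0 then P00 else P02 k)"

abbreviation "N \<equiv> real n"
abbreviation "r \<equiv> nrm x"
abbreviation "h \<equiv> nrm \<eta>"

definition \<epsilon> :: real where "\<epsilon> = E * (3 / 2 * \<rho> + b * C\<psi> * \<tau> / 2)"
definition R0 :: real where "R0 = c * \<rho> + \<Theta> * \<tau>"

lemma y: "y \<ge> 1" "y\<^sup>2 = x n" "y > 0"
  using xn by (simp_all add: y_def real_sqrt_ge_one)

lemma r: "r \<ge> y\<^sup>2" "r \<ge> 1" "r > 0"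
  using xn_le[of x] xn y by auto

lemma N_power_le: "N \<ge> 1" "N ^ 2 \<le> N ^ 3"
  using n by (simp_all add: power_increasing)

lemma \<rho>_nonneg: "0 \<le> \<rho>"
  using g y by (simp add: \<rho>_def)

lemma h_le: "h \<le> 3 / 2 * g * y + b * \<tau> / 2 * (C\<psi> * r)"
proof -
  have scal: "nrm (\<lambda>i. k * z i) = \<bar>k\<bar> * nrm z" for k z
    by (simp add: L2_set_def power_mult_distrib sum_distrib_left[symmetric] real_sqrt_mult)
  have "h \<le> nrm (\<lambda>i. 3 / 2 * g * y * e i) + nrm (\<lambda>i. - (b * \<tau> / 2) * psi1 x i)"
    unfolding \<eta>_def[abs_def] using L2_set_triangle_ineq[of "\<lambda>i. 3 / 2 * g * y * e i" "\<lambda>i. - (b * \<tau> / 2) * psi1 x i" "{1..n}"]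
    by simp
  also have "\<dots> = 3 / 2 * g * y + b * \<tau> / 2 * nrm (psi1 x)"
    unfolding scal nrm_e using g y \<tau> pos by (simp add: abs_mult)
  also have "\<dots> \<le> 3 / 2 * g * y + b * \<tau> / 2 * (C\<psi> * r)"
    using psi1_bound xn pos \<tau> by (intro add_left_mono mult_left_mono) auto
  finally show ?thesis .
qed

text \<open>Here the decay \<open>E / nrm x\<close> of the coefficient gradient is spent. The vector
  \<open>\<eta>\<close> grows like \<open>g * y\<close> and like \<open>r\<close>, but
  \<open>y\<^sup>2 = x n \<le> r\<close> gives \<open>g * y / r \<le> \<rho>\<close>, so the product
  is bounded by \<open>E\<close> times the size of the Hessian of the weight.\<close>

lemma \<epsilon>_ge: "E / r * h \<le> \<epsilon>" "\<epsilon> \<ge> 0"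
proof -
  have "\<rho> * (y\<^sup>2 / r) \<le> \<rho> * 1" using r \<rho>_nonneg by (intro mult_left_mono) (auto simp: divide_le_eq)
  moreover have gy2: "g * y = \<rho> * y\<^sup>2" unfolding \<rho>_def using y(3) by (simp add: power2_eq_square)
  ultimately have 1: "g * y / r \<le> \<rho>" unfolding gy2 by simp
  have "E / r * h \<le> E / r * (3 / 2 * g * y + b * \<tau> / 2 * (C\<psi> * r))"
    using h_le pos r by (intro mult_left_mono) auto
  also have "\<dots> = E * (3 / 2 * (g * y / r) + b * C\<psi> * \<tau> / 2)"
    using r by (simp add: field_simps)
  also have "\<dots> \<le> \<epsilon>" unfolding \<epsilon>_def using 1 pos by (intro mult_left_mono add_mono order_refl) simp_all
  finally show "E / r * h \<le> \<epsilon>" .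
  show "\<epsilon> \<ge> 0" unfolding \<epsilon>_def using pos \<rho>_nonneg \<tau> C\<psi>_pos by simp
qed

text \<open>\<open>F\<close> and the trace of \<open>dB\<close> share the term
  \<open>3 / 4 * a n n * \<rho>\<close>, which cancels and leaves \<open>R0\<close>. What remains of
  the trace comes from the coefficient derivatives and the Hessian of \<open>\<psi>\<close> and is
  at most \<open>R0 / 2\<close> by \<open>A3\<close>: its \<open>\<rho>\<close> part is absorbed by
  \<open>c\<close>, its \<open>\<tau>\<close> part by \<open>\<Theta>\<close>.\<close>

lemma R_bounds: "R0 - N\<^sup>2 * \<epsilon> - b * \<tau> / 2 * (N\<^sup>2 * Lam * C\<psi>) \<le> R" "R0 / 2 \<le> R" "R \<le> 3 / 2 * R0" "R0 \<ge> \<Theta> * \<tau>" "R0 > 0"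
proof -
  define D1 where "D1 = (\<Sum>i\<in>{1..n}. \<Sum>l\<in>{1..n}. da i i l * \<eta> l)"
  define S2 where "S2 = (\<Sum>i\<in>{1..n}. \<Sum>l\<in>{1..n}. a i l * psi2 x i l)"
  have "(\<Sum>i\<in>{1..n}. \<Sum>l\<in>{1..n}. a i l * P2 i l) =
     3 / 4 * \<rho> * Af e e - b * \<tau> / 2 * S2"
    unfolding P2_def Af_def Av_def S2_def
    by (simp add: algebra_simps sum_subtractf sum_distrib_left sum_distrib_right)
  then have "(\<Sum>i\<in>{1..n}. dB i i) = D1 + 3 / 4 * \<rho> * a n n - b * \<tau> / 2 * S2"
    unfolding dB_def D1_def by (simp add: sum.distrib Af_e Av_e)
  then have R: "R = R0 - D1 + b * \<tau> / 2 * S2"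
    unfolding R_def F_def R0_def by (simp add: algebra_simps)
  have "\<bar>D1\<bar> \<le> N * (N * (E / r * h))"
    unfolding D1_def using pos r by (intro abs_sum_le abs_sum_mult_le dak) auto
  also have "\<dots> \<le> N * (N * \<epsilon>)" using \<epsilon>_ge by (intro mult_left_mono) auto
  finally have D1: "\<bar>D1\<bar> \<le> N\<^sup>2 * \<epsilon>" by (simp add: power2_eq_square)
  have S: "\<bar>S2\<bar> \<le> N * (N * (Lam * C\<psi>))"
    unfolding S2_def
  proof (intro abs_sum_le)
    show "\<bar>a i l * psi2 x i l\<bar> \<le> Lam * C\<psi>" if "i \<in> {1..n}" "l \<in> {1..n}" for i l
      unfolding abs_mult using that xn Lam_pos by (intro mult_mono a_entry psi2_bound) auto
  qed
  have bt: "0 \<le> b * \<tau> / 2" using pos \<tau> by simp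
  have S2: "\<bar>b * \<tau> / 2 * S2\<bar> \<le> b * \<tau> / 2 * (N\<^sup>2 * Lam * C\<psi>)"
    using mult_left_mono[OF S bt] unfolding abs_mult abs_of_nonneg[OF bt] by (simp add: power2_eq_square mult_ac)
  show "R0 - N\<^sup>2 * \<epsilon> - b * \<tau> / 2 * (N\<^sup>2 * Lam * C\<psi>) \<le> R" using D1 S2 unfolding R by linarith
  have "3 * N\<^sup>2 * E * \<rho> \<le> c * \<rho>" by (rule mult_right_mono[OF A3(1) \<rho>_nonneg])
  moreover have "(N\<^sup>2 * E * b * C\<psi> + b * N\<^sup>2 * Lam * C\<psi>) * \<tau> \<le> \<Theta> * \<tau>" using A3(2) \<tau> by (intro mult_right_mono) auto
  ultimately have "N\<^sup>2 * \<epsilon> + b * \<tau> / 2 * (N\<^sup>2 * Lam * C\<psi>) \<le> R0 / 2"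
    unfolding \<epsilon>_def R0_def by (simp add: algebra_simps)
  then show "R0 / 2 \<le> R" "R \<le> 3 / 2 * R0" using D1 S2 unfolding R by linarith+
  show "R0 \<ge> \<Theta> * \<tau>" unfolding R0_def using \<rho>_nonneg pos by simp
  have "0 < \<Theta> * \<tau>" using pos \<tau> by simp
  then show "R0 > 0" using \<open>R0 \<ge> \<Theta> * \<tau>\<close> by linarith
qed

text \<open>\<open>dB\<close> differentiates \<open>A \<eta>\<close>. The first sum collects the
  derivatives of the coefficients; in the second the symmetry of \<open>a\<close> turns the Hessian
  of \<open>\<phi>\<close> into a form in \<open>A \<xi>\<close>.\<close>

lemma dB_form: "(\<Sum>i\<in>{1..n}. Av \<xi> i * (\<Sum>k\<in>{1..n}. dB i k * \<xi> k)) =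
  (\<Sum>i\<in>{1..n}. (\<Sum>k\<in>{1..n}. \<Sum>l\<in>{1..n}. da i k l * \<xi> k * \<eta> l) * Av \<xi> i)
  + (\<Sum>i\<in>{1..n}. \<Sum>l\<in>{1..n}. P2 i l * Av \<xi> i * Av \<xi> l)"
proof -
  have dB: "(\<Sum>k\<in>{1..n}. dB i k * \<xi> k) = (\<Sum>k\<in>{1..n}. \<Sum>l\<in>{1..n}. da i k l * \<xi> k * \<eta> l) + (\<Sum>l\<in>{1..n}. P2 i l * Av \<xi> l)" for i
  proof -
    have "(\<Sum>k\<in>{1..n}. dB i k * \<xi> k) = (\<Sum>k\<in>{1..n}. \<Sum>l\<in>{1..n}. da i k l * \<xi> k * \<eta> l)
      + (\<Sum>k\<in>{1..n}. \<Sum>l\<in>{1..n}. P2 i l * (a k l * \<xi> k))"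
      unfolding dB_def sum_distrib_right by (simp add: sum.distrib algebra_simps)
    also have "(\<Sum>k\<in>{1..n}. \<Sum>l\<in>{1..n}. P2 i l * (a k l * \<xi> k)) = (\<Sum>l\<in>{1..n}. P2 i l * Av \<xi> l)"
      unfolding Av_def sum_distrib_left by (subst sum.swap) (auto intro!: sum.cong simp: a_sym)
    finally show ?thesis .
  qed
  have "Av \<xi> i * (\<Sum>k\<in>{1..n}. dB i k * \<xi> k) = (\<Sum>k\<in>{1..n}. \<Sum>l\<in>{1..n}. da i k l * \<xi> k * \<eta> l) * Av \<xi> i
      + (\<Sum>l\<in>{1..n}. P2 i l * Av \<xi> i * Av \<xi> l)" for i
  proof -
    have "Av \<xi> i * (\<Sum>l\<in>{1..n}. P2 i l * Av \<xi> l) = (\<Sum>l\<in>{1..n}. P2 i l * Av \<xi> i * Av \<xi> l)"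
      by (simp add: sum_distrib_left mult_ac)
    then show ?thesis unfolding dB distrib_left by (simp only: mult.commute[of "Av \<xi> i" "\<Sum>k\<in>{1..n}. \<Sum>l\<in>{1..n}. da i k l * \<xi> k * \<eta> l"])
  qed
  then show ?thesis by (simp only: sum.distrib)
qed

text \<open>The rank-one term is displayed because at \<open>\<xi> = \<eta>\<close> it is the gain
  of order \<open>\<rho>\<close> in \<open>Z_lower\<close>; the Hessian of \<open>\<psi>\<close>
  costs only a term of order \<open>b * \<tau>\<close>.\<close>

lemma P2_form_lower:
  "(\<Sum>i\<in>{1..n}. \<Sum>l\<in>{1..n}. P2 i l * Av \<xi> i * Av \<xi> l) \<ge> 3 / 4 * \<rho> * (Av \<xi> n)\<^sup>2 - b * \<tau> / 2 * (N\<^sup>2 * C\<psi> * Lam\<^sup>2 * (nrm \<xi>)\<^sup>2)"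
proof -
  let ?w = "Av \<xi>"
  define S where "S = (\<Sum>i\<in>{1..n}. \<Sum>l\<in>{1..n}. psi2 x i l * ?w i * ?w l)"
  have ew: "(\<Sum>i\<in>{1..n}. e i * ?w i) = ?w n"
  proof -
    have "Af \<xi> e = ?w n" using Af_e Af_commute by metis
    then show ?thesis unfolding Af_def by (simp only: mult.commute)
  qed
  have "(\<Sum>i\<in>{1..n}. \<Sum>l\<in>{1..n}. (e i * ?w i) * (e l * ?w l)) = (?w n)\<^sup>2"
    unfolding sum_product[symmetric] ew by (simp add: power2_eq_square)
  then have "3 / 4 * \<rho> * (?w n)\<^sup>2 - b * \<tau> / 2 * S = 
    3 / 4 * \<rho> * (\<Sum>i\<in>{1..n}. \<Sum>l\<in>{1..n}. (e i * ?w i) * (e l * ?w l)) - b * \<tau> / 2 * S" by simp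
  also have "\<dots> = (\<Sum>i\<in>{1..n}. \<Sum>l\<in>{1..n}. P2 i l * ?w i * ?w l)"
    unfolding P2_def S_def by (simp add: algebra_simps sum_subtractf sum_distrib_left)
  finally have eq: "(\<Sum>i\<in>{1..n}. \<Sum>l\<in>{1..n}. P2 i l * ?w i * ?w l) = 3 / 4 * \<rho> * (?w n)\<^sup>2 - b * \<tau> / 2 * S" ..
  have "\<bar>S\<bar> \<le> N * (N * (C\<psi> * nrm ?w * nrm ?w))"
    unfolding S_def using xn C\<psi>_pos by (intro abs_double_sum_le psi2_bound) auto
  also have "\<dots> \<le> N * (N * (C\<psi> * (Lam * nrm \<xi>) * (Lam * nrm \<xi>)))"
    using nrm_Av C\<psi>_pos Lam_pos by (intro mult_left_mono mult_mono) auto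
  also have "\<dots> = N\<^sup>2 * C\<psi> * Lam\<^sup>2 * (nrm \<xi>)\<^sup>2" by (simp add: power2_eq_square)
  finally have "S \<le> N\<^sup>2 * C\<psi> * Lam\<^sup>2 * (nrm \<xi>)\<^sup>2" by linarith
  then show ?thesis unfolding eq using pos \<tau> by (intro diff_left_mono mult_left_mono) auto
qed

lemma cubic_bound:
  assumes "\<And>i k l. i \<in> {1..n} \<Longrightarrow> k \<in> {1..n} \<Longrightarrow> l \<in> {1..n} \<Longrightarrow> \<bar>f i k l\<bar> \<le> E / r"
  shows "\<bar>\<Sum>i\<in>{1..n}. (\<Sum>k\<in>{1..n}. \<Sum>l\<in>{1..n}. f i k l * \<xi> k * \<zeta> l) * Av \<omega> i\<bar>
    \<le> N ^ 3 * Lam * (E / r * nrm \<xi> * nrm \<zeta> * nrm \<omega>)"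
proof -
  have "\<bar>\<Sum>i\<in>{1..n}. (\<Sum>k\<in>{1..n}. \<Sum>l\<in>{1..n}. f i k l * \<xi> k * \<zeta> l) * Av \<omega> i\<bar>
     \<le> N * (N * (N * (E / r * nrm \<xi> * nrm \<zeta>)) * nrm (Av \<omega>))"
    using pos r by (intro abs_sum_mult_le abs_double_sum_le assms) auto
  also have "\<dots> \<le> N * (N * (N * (E / r * nrm \<xi> * nrm \<zeta>)) * (Lam * nrm \<omega>))"
    using nrm_Av pos r by (intro mult_left_mono) auto
  also have "\<dots> = N ^ 3 * Lam * (E / r * nrm \<xi> * nrm \<zeta> * nrm \<omega>)" by (simp add: power3_eq_cube)
  finally show ?thesis .
qed

text \<open>The part of \<open>Qf\<close> quadratic in \<open>V\<close>. With
  \<open>F = R + (\<Sum>i\<in>{1..n}. dB i i)\<close> the trace of \<open>dB\<close> cancels, and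
  \<open>2 * R * Af \<xi> \<xi>\<close> is left.\<close>

definition GT :: "(nat \<Rightarrow> real) \<Rightarrow> real" where
  "GT \<xi> = (\<Sum>i\<in>{1..n}. \<Sum>j\<in>{1..n}. da 0 i j * \<xi> i * \<xi> j) + 4 * (\<Sum>i\<in>{1..n}. Av \<xi> i * (\<Sum>k\<in>{1..n}. dB i k * \<xi> k))
     - 2 * (\<Sum>k\<in>{1..n}. Av \<eta> k * (\<Sum>i\<in>{1..n}. \<Sum>j\<in>{1..n}. da k i j * \<xi> i * \<xi> j)) + 2 * R * Af \<xi> \<xi>"

lemma GT_lower: "GT \<xi> \<ge> (lam * c * \<rho> + 2) * (nrm \<xi>)\<^sup>2"
proof -
  define X where "X = nrm \<xi>"
  have X: "X \<ge> 0" by (simp add: X_def)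
  have T0: "\<bar>\<Sum>i\<in>{1..n}. \<Sum>j\<in>{1..n}. da 0 i j * \<xi> i * \<xi> j\<bar> \<le> N * (N * (M * X * X))"
    unfolding X_def using pos by (intro abs_double_sum_le da0) auto
  have \<epsilon>X: "N ^ 3 * Lam * (E / r * h * X * X) \<le> N ^ 3 * Lam * (\<epsilon> * X * X)"
    using \<epsilon>_ge Lam_pos X by (intro mult_left_mono mult_right_mono) auto
  have T1: "\<bar>\<Sum>i\<in>{1..n}. (\<Sum>k\<in>{1..n}. \<Sum>l\<in>{1..n}. da i k l * \<xi> k * \<eta> l) * Av \<xi> i\<bar> \<le> N ^ 3 * Lam * (\<epsilon> * X * X)"
    using cubic_bound[of da \<xi> \<eta> \<xi>, OF dak] \<epsilon>X by (simp add: X_def mult_ac)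
  have T3: "\<bar>\<Sum>k\<in>{1..n}. Av \<eta> k * (\<Sum>i\<in>{1..n}. \<Sum>j\<in>{1..n}. da k i j * \<xi> i * \<xi> j)\<bar> \<le> N ^ 3 * Lam * (\<epsilon> * X * X)"
    using cubic_bound[of da \<xi> \<xi> \<eta>, OF dak] \<epsilon>X by (simp add: X_def mult_ac)
  have T2: "(\<Sum>i\<in>{1..n}. \<Sum>l\<in>{1..n}. P2 i l * Av \<xi> i * Av \<xi> l) \<ge> - (b * \<tau> / 2 * (N\<^sup>2 * C\<psi> * Lam\<^sup>2 * X\<^sup>2))"
  proof -
    have "0 \<le> 3 / 4 * \<rho> * (Av \<xi> n)\<^sup>2" by (intro mult_nonneg_nonneg \<rho>_nonneg) auto
    then show ?thesis using P2_form_lower[of \<xi>] by (simp add: X_def)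
  qed
  have "R * (lam * X\<^sup>2) \<le> R * Af \<xi> \<xi>"
    using R_bounds Af_lower[of \<xi>] by (intro mult_left_mono) (auto simp: X_def)
  moreover have "(R0 - N\<^sup>2 * \<epsilon> - b * \<tau> / 2 * (N\<^sup>2 * Lam * C\<psi>)) * (lam * X\<^sup>2) \<le> R * (lam * X\<^sup>2)"
    using R_bounds lam by (intro mult_right_mono) auto
  ultimately have T4: "(R0 - N\<^sup>2 * \<epsilon> - b * \<tau> / 2 * (N\<^sup>2 * Lam * C\<psi>)) * lam * X\<^sup>2 \<le> R * Af \<xi> \<xi>" by (simp add: mult.assoc)
  define G where "G = 2 * (R0 - N\<^sup>2 * \<epsilon> - b * \<tau> / 2 * (N\<^sup>2 * Lam * C\<psi>)) * lam - N\<^sup>2 * M - 6 * N ^ 3 * Lam * \<epsilon> - 2 * b * \<tau> * N\<^sup>2 * C\<psi> * Lam\<^sup>2"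
  have 1: "G * X\<^sup>2 \<le> GT \<xi>"
  proof -
    have "G * X\<^sup>2 = 2 * ((R0 - N\<^sup>2 * \<epsilon> - b * \<tau> / 2 * (N\<^sup>2 * Lam * C\<psi>)) * lam * X\<^sup>2) - N * (N * (M * X * X))
      - 6 * (N ^ 3 * Lam * (\<epsilon> * X * X)) - 4 * (b * \<tau> / 2 * (N\<^sup>2 * C\<psi> * Lam\<^sup>2 * X\<^sup>2))"
      unfolding G_def by (simp add: algebra_simps power2_eq_square)
    moreover have "2 * R * Af \<xi> \<xi> = 2 * (R * Af \<xi> \<xi>)" by simp
    ultimately show ?thesis
      using T0 T1 T2 T3 T4 unfolding GT_def dB_form abs_le_iff distrib_left by linarith
  qed
  \<comment> \<open>Origin of the constants in \<open>A1\<close> and \<open>A2\<close>: the errors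
    add up to \<open>8 * N ^ 3 * Lam * \<epsilon>\<close>, namely 4 from the \<open>dB\<close> form,
    2 from the derivative along \<open>A \<eta>\<close> and 2 from the lower bound of
    \<open>R\<close>. Half of \<open>2 * lam * c * \<rho>\<close> absorbs their
    \<open>\<rho>\<close> part; the other half is reserved for \<open>cross_lower\<close>.\<close>
  have e1: "N\<^sup>2 * \<epsilon> * lam \<le> N ^ 3 * \<epsilon> * Lam"
    using N_power_le \<epsilon>_ge lam lam_Lam by (intro mult_mono) auto
  have e2: "b * \<tau> * N\<^sup>2 * C\<psi> * (Lam * lam) \<le> b * \<tau> * N\<^sup>2 * C\<psi> * Lam\<^sup>2"
    using pos \<tau> C\<psi>_pos lam_Lam Lam_pos by (intro mult_left_mono) (auto simp: power2_eq_square)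
  have e3: "8 * N ^ 3 * Lam * \<epsilon> = 12 * N ^ 3 * Lam * E * \<rho> + 4 * N ^ 3 * Lam * E * b * C\<psi> * \<tau>"
    unfolding \<epsilon>_def by (simp add: algebra_simps)
  have e4: "12 * N ^ 3 * Lam * E * \<rho> \<le> lam * c * \<rho>" by (rule mult_right_mono[OF A1 \<rho>_nonneg])
  have e5: "(4 * N ^ 3 * Lam * E * b * C\<psi> + N\<^sup>2 * M + 3 * b * N\<^sup>2 * C\<psi> * Lam\<^sup>2 + 2) * \<tau> \<le> 2 * lam * \<Theta> * \<tau>"
    using \<tau> by (intro mult_right_mono[OF A2]) auto
  have e6: "N\<^sup>2 * M * 1 \<le> N\<^sup>2 * M * \<tau>" using \<tau> pos by (intro mult_left_mono) auto
  have "G \<ge> lam * c * \<rho> + 2"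
  proof -
    have "G = 2 * lam * c * \<rho> + 2 * lam * \<Theta> * \<tau> - 2 * (N\<^sup>2 * \<epsilon> * lam) - b * \<tau> * N\<^sup>2 * C\<psi> * (Lam * lam) 
       - N\<^sup>2 * M * 1 - 6 * (N ^ 3 * \<epsilon> * Lam) - 2 * (b * \<tau> * N\<^sup>2 * C\<psi> * Lam\<^sup>2)"
      unfolding G_def R0_def by (simp add: algebra_simps)
    moreover have "8 * N ^ 3 * Lam * \<epsilon> = 8 * (N ^ 3 * \<epsilon> * Lam)" by simp
    moreover have "(4 * N ^ 3 * Lam * E * b * C\<psi> + N\<^sup>2 * M + 3 * b * N\<^sup>2 * C\<psi> * Lam\<^sup>2 + 2) * \<tau>
      = 4 * N ^ 3 * Lam * E * b * C\<psi> * \<tau> + N\<^sup>2 * M * \<tau> + 3 * (b * \<tau> * N\<^sup>2 * C\<psi> * Lam\<^sup>2) + 2 * \<tau>"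
      by (simp add: algebra_simps)
    ultimately show ?thesis using e1 e2 e3 e4 e5 e6 \<tau> by linarith
  qed
  then have "(lam * c * \<rho> + 2) * X\<^sup>2 \<le> G * X\<^sup>2" by (intro mult_right_mono) auto
  then show ?thesis using 1 by (simp add: X_def)
qed

text \<open>Spends the reserve \<open>lam * c * \<rho>\<close> of \<open>GT_lower\<close> by
  completing a square in \<open>nrm \<xi>\<close> and \<open>\<bar>v\<bar>\<close>. This works
  because \<open>dF\<close> is of order \<open>\<rho>\<close>: the summand
  \<open>\<Theta> * \<tau>\<close> of \<open>F\<close> does not depend on \<open>x\<close>.\<close>

lemma cross_lower:
  "(lam * c * \<rho>) * (nrm \<xi>)\<^sup>2 + 2 * v * (\<Sum>i\<in>{1..n}. Av \<xi> i * dF i)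
     \<ge> - ((real n * (E + Lam + c) * Lam)\<^sup>2 / (lam * c) * \<rho> * v\<^sup>2)"
proof -
  define CF where "CF = E + Lam + c"
  define X where "X = nrm \<xi>"
  have CF: "CF \<ge> 0" using pos Lam_pos by (simp add: CF_def)
  have dF: "\<bar>dF i\<bar> \<le> CF * \<rho>" if i: "i \<in> {1..n}" for i
  proof -
    have "\<bar>da i n n\<bar> \<le> E / r" by (rule dak[OF i n_in n_in])
    also have "\<dots> \<le> E" using r pos by (simp add: divide_le_eq)
    finally have d: "\<bar>da i n n\<bar> \<le> E" .
    have "y * 1 \<le> y * (2 * y\<^sup>2)" using y one_le_power[OF y(1), of 2] by (intro mult_left_mono) linarith+
    then have "y \<le> 2 * y ^ 3" by (simp add: power3_eq_cube power2_eq_square)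
    then have y3: "g / (2 * y ^ 3) \<le> \<rho>"
      unfolding \<rho>_def by (rule divide_left_mono) (use y g in simp_all)
    have y30: "0 \<le> g / (2 * y ^ 3)" using y g by simp
    have a0: "0 \<le> 3 / 4 * a n n + c" "3 / 4 * a n n + c \<le> Lam + c" using ann lam pos by auto
    define z where "z = g / (2 * y ^ 3)"
    note y3 = y3[folded z_def] and y30 = y30[folded z_def]
    have "\<bar>dF i\<bar> \<le> \<bar>3 / 4 * da i n n * \<rho>\<bar> + \<bar>(3 / 4 * a n n + c) * z * e i\<bar>"
      unfolding dF_def z_def by (rule abs_triangle_ineq4)
    also have "\<dots> = 3 / 4 * \<bar>da i n n\<bar> * \<rho> + (3 / 4 * a n n + c) * z * \<bar>e i\<bar>"
      unfolding abs_mult abs_of_nonneg[OF \<rho>_nonneg] abs_of_nonneg[OF a0(1)] abs_of_nonneg[OF y30] by simp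
    also have "\<dots> \<le> E * \<rho> + (Lam + c) * \<rho> * 1"
      using d \<rho>_nonneg a0 y3 y30 pos Lam_pos by (intro add_mono mult_mono) (auto simp: e_def)
    finally show ?thesis by (simp add: CF_def algebra_simps)
  qed
  have "\<bar>\<Sum>i\<in>{1..n}. dF i * Av \<xi> i\<bar> \<le> N * (CF * \<rho> * nrm (Av \<xi>))"
    using CF \<rho>_nonneg by (intro abs_sum_mult_le dF) auto
  also have "\<dots> \<le> N * (CF * \<rho> * (Lam * X))"
    unfolding X_def using nrm_Av CF \<rho>_nonneg by (intro mult_left_mono) auto
  finally have S: "\<bar>\<Sum>i\<in>{1..n}. Av \<xi> i * dF i\<bar> \<le> (N * CF * Lam) * X * \<rho>" by (simp add: mult_ac)
  define P where "P = N * CF * Lam"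
  have "\<bar>v * (\<Sum>i\<in>{1..n}. Av \<xi> i * dF i)\<bar> \<le> \<bar>v\<bar> * (P * X * \<rho>)"
    unfolding abs_mult P_def using S by (intro mult_left_mono) auto
  moreover have "2 * v * (\<Sum>i\<in>{1..n}. Av \<xi> i * dF i) = 2 * (v * (\<Sum>i\<in>{1..n}. Av \<xi> i * dF i))" by simp
  moreover have "\<rho> * (2 * P * \<bar>v\<bar> * X) = 2 * (\<bar>v\<bar> * (P * X * \<rho>))" by simp
  ultimately have 1: "2 * v * (\<Sum>i\<in>{1..n}. Av \<xi> i * dF i) \<ge> - (\<rho> * (2 * P * \<bar>v\<bar> * X))"
    by linarith
  have lc: "lam * c > 0" using lam pos by simp
  have "(lam * c * X - P * \<bar>v\<bar>)\<^sup>2 = (lam * c) * (lam * c * X\<^sup>2 - 2 * P * \<bar>v\<bar> * X) + P\<^sup>2 * \<bar>v\<bar>\<^sup>2"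
    by (simp add: power2_eq_square algebra_simps)
  moreover have "(d * A + B) / d = A + B / d" if "d > 0" for d A B :: real using that by (simp add: add_divide_distrib)
  ultimately have "(lam * c * X - P * \<bar>v\<bar>)\<^sup>2 / (lam * c) = lam * c * X\<^sup>2 - 2 * P * \<bar>v\<bar> * X + P\<^sup>2 * v\<^sup>2 / (lam * c)"
    using lc by (simp only: power2_abs)
  moreover have "0 \<le> (lam * c * X - P * \<bar>v\<bar>)\<^sup>2 / (lam * c)" using lc by simp
  ultimately have "2 * P * \<bar>v\<bar> * X \<le> lam * c * X\<^sup>2 + P\<^sup>2 * v\<^sup>2 / (lam * c)" by linarith
  then have "\<rho> * (2 * P * \<bar>v\<bar> * X) \<le> \<rho> * (lam * c * X\<^sup>2 + P\<^sup>2 * v\<^sup>2 / (lam * c))"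
    by (rule mult_left_mono[OF _ \<rho>_nonneg])
  moreover have "\<rho> * (lam * c * X\<^sup>2 + P\<^sup>2 * v\<^sup>2 / (lam * c)) = lam * c * \<rho> * X\<^sup>2 + P\<^sup>2 / (lam * c) * \<rho> * v\<^sup>2"
    by (simp add: distrib_left)
  ultimately show ?thesis using 1 unfolding X_def[symmetric] P_def[symmetric] CF_def[symmetric]
    by linarith
qed

end

section \<open>The zero-order coefficient of the quadratic form\<close>

context carleman_point
begin

text \<open>The coefficient of \<open>v\<^sup>2\<close> in \<open>Qf\<close>, diminished by
  \<open>R\<^sup>2\<close>; replacing \<open>F\<close> by \<open>R\<close> plus the trace of
  \<open>dB\<close> merges the two terms of \<open>Qf\<close> with factor \<open>W\<close> into
  \<open>- 2 * W * R\<close>.\<close>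

definition Z :: real where
  "Z = 2 * (\<Sum>k\<in>{1..n}. Av \<eta> k * dW k) - dW 0 - 2 * W * R - R\<^sup>2"

lemma sum_e: "(\<Sum>k\<in>{1..n}. f k * e k) = f n"
proof -
  have "(\<Sum>k\<in>{1..n}. f k * e k) = (\<Sum>k\<in>{1..n}. if k = n then f k else 0)"
    unfolding e_def by (intro sum.cong) auto
  then show ?thesis using n by simp
qed

text \<open>The mixed derivatives \<open>P02\<close> enter through \<open>dW k\<close> and through
  \<open>dW 0\<close>, with total factor \<open>-4\<close>. This is the source of
  \<open>6 * K * q * \<tau> * y * Av \<eta> n\<close>, the gain of order \<open>K\<close>.\<close>

lemma Z_eq: "Z = 2 * (\<Sum>k\<in>{1..n}. (\<Sum>i\<in>{1..n}. \<Sum>j\<in>{1..n}. da k i j * \<eta> i * \<eta> j) * Av \<eta> k)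
   + 4 * (\<Sum>k\<in>{1..n}. \<Sum>i\<in>{1..n}. P2 k i * Av \<eta> k * Av \<eta> i)
   - (2 * b * \<tau>\<^sup>2 * Af \<eta> (psi1 x) - 6 * K * q * \<tau> * y * Av \<eta> n)
   - (\<Sum>i\<in>{1..n}. \<Sum>j\<in>{1..n}. da 0 i j * \<eta> i * \<eta> j) + P00 - 2 * W * R - R\<^sup>2"
proof -
  define S where "S = (\<Sum>k\<in>{1..n}. Av \<eta> k * P02 k)"
  have S: "S = b * \<tau>\<^sup>2 / 2 * Af \<eta> (psi1 x) - 3 / 2 * K * q * \<tau> * y * Av \<eta> n"
  proof -
    have "S = (\<Sum>k\<in>{1..n}. b * \<tau>\<^sup>2 / 2 * (Av \<eta> k * psi1 x k)) - (\<Sum>k\<in>{1..n}. 3 / 2 * K * q * \<tau> * y * (Av \<eta> k * e k))"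
      unfolding S_def P02_def sum_subtractf[symmetric] by (intro sum.cong refl) (simp add: algebra_simps)
    then show ?thesis unfolding sum_distrib_left[symmetric] sum_e Af_def .
  qed
  have "Av \<eta> k * dW k = (\<Sum>i\<in>{1..n}. \<Sum>j\<in>{1..n}. da k i j * \<eta> i * \<eta> j) * Av \<eta> k
     + 2 * (\<Sum>i\<in>{1..n}. P2 k i * Av \<eta> k * Av \<eta> i) - Av \<eta> k * P02 k" if "k \<in> {1..n}" for k
  proof -
    have "dW k = (\<Sum>i\<in>{1..n}. \<Sum>j\<in>{1..n}. da k i j * \<eta> i * \<eta> j) + 2 * (\<Sum>i\<in>{1..n}. Av \<eta> i * P2 k i) - P02 k"
      using that unfolding dW_def by simp
    moreover have "Av \<eta> k * (\<Sum>i\<in>{1..n}. Av \<eta> i * P2 k i) = (\<Sum>i\<in>{1..n}. P2 k i * Av \<eta> k * Av \<eta> i)"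
      unfolding sum_distrib_left by (intro sum.cong refl) simp
    ultimately show ?thesis by (simp add: right_diff_distrib distrib_left)
  qed
  then have "(\<Sum>k\<in>{1..n}. Av \<eta> k * dW k) = (\<Sum>k\<in>{1..n}. (\<Sum>i\<in>{1..n}. \<Sum>j\<in>{1..n}. da k i j * \<eta> i * \<eta> j) * Av \<eta> k
     + 2 * (\<Sum>i\<in>{1..n}. P2 k i * Av \<eta> k * Av \<eta> i) - Av \<eta> k * P02 k)"
    by (intro sum.cong refl)
  also have "\<dots> = (\<Sum>k\<in>{1..n}. (\<Sum>i\<in>{1..n}. \<Sum>j\<in>{1..n}. da k i j * \<eta> i * \<eta> j) * Av \<eta> k)
     + 2 * (\<Sum>k\<in>{1..n}. \<Sum>i\<in>{1..n}. P2 k i * Av \<eta> k * Av \<eta> i) - S"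
    unfolding S_def sum_subtractf sum.distrib sum_distrib_left[symmetric] ..
  finally have 1: "(\<Sum>k\<in>{1..n}. Av \<eta> k * dW k) = \<dots>" .
  have 2: "dW 0 = (\<Sum>i\<in>{1..n}. \<Sum>j\<in>{1..n}. da 0 i j * \<eta> i * \<eta> j) + 2 * S - P00"
    unfolding dW_def S_def by simp
  show ?thesis unfolding Z_def 1 2 S by (simp add: algebra_simps)
qed

lemma Af_\<eta>_psi1: "Af \<eta> (psi1 x) = 3 / 2 * g * y * Av (psi1 x) n - b * \<tau> / 2 * Af (psi1 x) (psi1 x)"
  and Av_\<eta>_n: "Av \<eta> n = 3 / 2 * g * y * a n n - b * \<tau> / 2 * Av (psi1 x) n"
proof -
  have Av_\<eta>: "Av \<eta> i = 3 / 2 * g * y * Av e i - b * \<tau> / 2 * Av (psi1 x) i" for i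
    unfolding Av_def \<eta>_def by (simp add: right_diff_distrib sum_subtractf sum_distrib_left mult.left_commute)
  show "Av \<eta> n = 3 / 2 * g * y * a n n - b * \<tau> / 2 * Av (psi1 x) n" unfolding Av_\<eta> Av_e ..
  have "Af \<eta> (psi1 x) = 3 / 2 * g * y * Af e (psi1 x) - b * \<tau> / 2 * Af (psi1 x) (psi1 x)"
    unfolding Af_def Av_\<eta> by (simp add: left_diff_distrib sum_subtractf sum_distrib_left mult.assoc)
  then show "Af \<eta> (psi1 x) = 3 / 2 * g * y * Av (psi1 x) n - b * \<tau> / 2 * Af (psi1 x) (psi1 x)"
    unfolding Af_e .
qed

text \<open>Every term of \<open>Z\<close> is estimated by multiples of the six quantities
  \<open>m1\<close> to \<open>m6\<close>. The gains are \<open>K * (K + 1) * m4\<close> from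
  \<open>P00\<close>, one of order \<open>K\<close> in \<open>m3\<close> from the mixed derivatives,
  \<open>3 / 2 * c1\<^sup>2 * m1\<close> from the rank-one Hessian, and
  \<open>\<Theta> / 2 * m6\<close> and \<open>\<Theta> / 2 * K * m5\<close> from
  \<open>- 2 * W * R\<close>, since \<open>- W\<close> contains \<open>P0\<close>. Only
  \<open>m2\<close> has no gain of its own; \<open>F8\<close> trades it for \<open>m3\<close> and
  \<open>m6\<close>.\<close>

lemma Z_lower: "Z \<ge> 1 + 2 * h\<^sup>2 + (real n * (E + Lam + c) * Lam)\<^sup>2 / (lam * c) * \<rho>"
proof -
  let ?\<psi> = "psi n Lam lam x"
  define PC where "PC = (real n * (E + Lam + c) * Lam)\<^sup>2 / (lam * c)"
  define m1 where "m1 = \<rho> * h\<^sup>2"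
  define m2 where "m2 = \<tau> * h\<^sup>2"
  define m3 where "m3 = q * \<tau> * g * y\<^sup>2"
  define m4 where "m4 = q * \<tau>\<^sup>2 * y ^ 3"
  define m5 where "m5 = \<tau> ^ 3"
  define m6 where "m6 = b * ?\<psi> * \<tau> ^ 3"
  have q0: "q \<ge> 0" using g by simp
  have h0: "h \<ge> 0" by simp
  have xy: "x n = y\<^sup>2" using y by simp
  have xn0: "x n > 0" using xn by simp
  have lc: "lam * c > 0" using lam pos by simp
  have PC0: "PC \<ge> 0" using lc by (simp add: PC_def)
  have y1: "1 \<le> y ^ 2" "1 \<le> y ^ 3" using one_le_power[OF y(1)] by blast+
  have t1: "1 \<le> \<tau> ^ 2" "1 \<le> \<tau> ^ 3" "\<tau>\<^sup>2 \<le> \<tau> ^ 3" using \<tau> by (simp_all add: one_le_power power_increasing)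
  have r2: "r\<^sup>2 \<le> 2 * ?\<psi>" using psi_lower[of x, OF xn0] by simp
  have \<psi>0: "0 \<le> ?\<psi>" using r2 by (smt (verit) zero_le_power2)
  have \<rho>g: "\<rho> \<le> g" unfolding \<rho>_def using y(1,3) mult_left_mono[OF y(1) g(1)] by (simp add: divide_le_eq)
  have \<rho>y: "\<rho> * y = g" unfolding \<rho>_def using y by simp
  have m0: "m1 \<ge> 0" "m2 \<ge> 0" "m3 \<ge> 0" "m4 \<ge> 0" "m5 \<ge> 1" "m6 \<ge> 0"
    unfolding m1_def m2_def m3_def m4_def m5_def m6_def using \<rho>_nonneg \<tau> q0 g(1) y(3) pos \<psi>0 t1(2) by simp_all
  have gq: "\<tau>\<^sup>2 * g * y ^ 3 \<le> m4"
    unfolding m4_def using g \<tau> y by (simp add: mult_right_mono mult_left_mono)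
  have \<rho>4: "\<rho> \<le> m4"
  proof -
    have "1 * 1 \<le> \<tau>\<^sup>2 * y ^ 3" using t1 y1 by (intro mult_mono) auto
    then have "q * 1 \<le> q * (\<tau>\<^sup>2 * y ^ 3)" using q0 by (intro mult_left_mono) auto
    then show ?thesis using \<rho>g g unfolding m4_def by (simp add: mult.assoc)
  qed
  have gg3: "g\<^sup>2 * (\<tau> * y\<^sup>2) \<le> m3"
  proof -
    have "g * (g * \<tau> * y\<^sup>2) \<le> q * (g * \<tau> * y\<^sup>2)" using g \<tau> y(3) by (intro mult_right_mono) auto
    then show ?thesis unfolding m3_def by (simp add: power2_eq_square mult_ac)
  qed
  have \<rho>2: "\<rho>\<^sup>2 \<le> m3"
  proof -
    have "\<rho>\<^sup>2 \<le> g\<^sup>2" using \<rho>g \<rho>_nonneg by (intro power_mono) auto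
    also have "1 * 1 \<le> \<tau> * y\<^sup>2" using \<tau> y1 by (intro mult_mono) auto
    then have "g\<^sup>2 \<le> g\<^sup>2 * (\<tau> * y\<^sup>2)" by (simp add: mult_le_cancel_left1)
    finally show ?thesis using gg3 by simp
  qed
  define D where "D = - Av (psi1 x) n"
  have D: "D \<ge> (Lam + lam) * r - C2 * y\<^sup>2" using conormal_psi[of x, OF xn0] unfolding D_def xy .
  have D': "D \<ge> - (C2 * y\<^sup>2)" using D r lam Lam_pos mult_nonneg_nonneg[of "Lam + lam" r] by linarith
  have C2: "C2 \<ge> 0" unfolding C2_def using Lam_pos \<kappa>1 by simp
  define Bn where "Bn = Av \<eta> n"
  have bt: "0 \<le> b * \<tau> / 2" "0 \<le> 3 / 2 * g * y" using pos \<tau> g y by simp_all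
  have Bn_eq: "Bn = 3 / 2 * g * y * a n n + b * \<tau> / 2 * D" unfolding Bn_def Av_\<eta>_n D_def by simp
  have gyl: "3 / 2 * g * y * lam \<le> 3 / 2 * g * y * a n n" by (rule mult_left_mono[OF ann(1) bt(2)])
  have Bn1: "Bn \<ge> 3 / 2 * g * y * lam - b * \<tau> / 2 * (C2 * y\<^sup>2)"
    using gyl mult_left_mono[OF D' bt(1)] unfolding Bn_eq mult_minus_right by linarith
  \<comment> \<open>\<open>c1\<close> is small enough for both parts of \<open>\<eta>\<close>: along
    \<open>e\<close> by ellipticity, along \<open>psi1\<close> by \<open>conormal_psi\<close>. Thus
    the last component of \<open>A \<eta>\<close> controls all of \<open>h\<close> up to an error
    proportional to \<open>x n\<close>.\<close>
  have Bn2: "Bn \<ge> c1 * h - b * \<tau> / 2 * (C2 * y\<^sup>2)"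
  proof -
    have "c1 * h \<le> c1 * (3 / 2 * g * y + b * \<tau> / 2 * (C\<psi> * r))" using h_le pos by (intro mult_left_mono) auto
    also have "\<dots> = 3 / 2 * g * y * c1 + b * \<tau> / 2 * (c1 * C\<psi> * r)" by (simp add: algebra_simps)
    also have "\<dots> \<le> 3 / 2 * g * y * lam + b * \<tau> / 2 * ((Lam + lam) * r)"
      using A5 r bt by (intro add_mono mult_left_mono mult_right_mono) auto
    finally show ?thesis using gyl mult_left_mono[OF D bt(1)] unfolding Bn_eq right_diff_distrib by linarith
  qed
  \<comment> \<open>A lower bound \<open>u - d\<close> yields
    \<open>u\<^sup>2 / 2 - d\<^sup>2\<close> for the square, also when \<open>u - d\<close> is
    negative.\<close>
  have Bn3: "Bn\<^sup>2 \<ge> (c1 * h)\<^sup>2 / 2 - (b * \<tau> / 2 * (C2 * y\<^sup>2))\<^sup>2"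
  proof -
    define u where "u = c1 * h"
    define d where "d = b * \<tau> / 2 * (C2 * y\<^sup>2)"
    have u: "u \<ge> 0" using pos h0 by (simp add: u_def)
    have d: "d \<ge> 0" using bt C2 by (simp add: d_def)
    have B: "Bn \<ge> u - d" using Bn2 by (simp add: u_def d_def)
    have "u\<^sup>2 / 2 - d\<^sup>2 \<le> Bn\<^sup>2"
    proof (cases "u \<ge> d")
      case True
      have "(u - d)\<^sup>2 \<le> Bn\<^sup>2" using B True by (intro power_mono) auto
      moreover have "0 \<le> (u - 2 * d)\<^sup>2" by simp
      ultimately show ?thesis by (simp add: power2_eq_square algebra_simps)
    next
      case False
      then have "u\<^sup>2 \<le> d\<^sup>2" using u by (intro power_mono) auto
      then show ?thesis using zero_le_power2[of Bn] zero_le_power2[of u] by linarith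
    qed
    then show ?thesis by (simp add: u_def d_def)
  qed
  have \<epsilon>h: "\<epsilon> * h\<^sup>2 = E * (3 / 2 * m1 + b * C\<psi> / 2 * m2)"
    unfolding \<epsilon>_def m1_def m2_def by (simp add: algebra_simps)
  have F1: "2 * (\<Sum>k\<in>{1..n}. (\<Sum>i\<in>{1..n}. \<Sum>j\<in>{1..n}. da k i j * \<eta> i * \<eta> j) * Av \<eta> k)
      \<ge> - (3 * N ^ 3 * Lam * E * m1 + N ^ 3 * Lam * E * b * C\<psi> * m2)"
  proof -
    have "\<bar>\<Sum>k\<in>{1..n}. (\<Sum>i\<in>{1..n}. \<Sum>j\<in>{1..n}. da k i j * \<eta> i * \<eta> j) * Av \<eta> k\<bar>
       \<le> N ^ 3 * Lam * (E / r * h * h * h)" by (rule cubic_bound[of da \<eta> \<eta> \<eta>, OF dak])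
    also have "E / r * h * h * h \<le> \<epsilon> * h\<^sup>2"
      using mult_right_mono[OF \<epsilon>_ge(1), of "h\<^sup>2"] by (simp add: power2_eq_square)
    then have "N ^ 3 * Lam * (E / r * h * h * h) \<le> N ^ 3 * Lam * (\<epsilon> * h\<^sup>2)"
      using Lam_pos by (intro mult_left_mono) auto
    also have "\<dots> = (3 * N ^ 3 * Lam * E * m1 + N ^ 3 * Lam * E * b * C\<psi> * m2) / 2"
      unfolding \<epsilon>h by (simp add: algebra_simps)
    finally show ?thesis unfolding distrib_left right_diff_distrib add_divide_distrib diff_divide_distrib minus_add_distrib by linarith
  qed
  \<comment> \<open>The error of \<open>Bn3\<close> ends up in \<open>m4\<close> because
    \<open>\<rho> * y = g \<le> q\<close>.\<close>
  have F2: "4 * (\<Sum>k\<in>{1..n}. \<Sum>i\<in>{1..n}. P2 k i * Av \<eta> k * Av \<eta> i)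
     \<ge> 3 / 2 * c1\<^sup>2 * m1 - 3 / 4 * b\<^sup>2 * C2\<^sup>2 * m4 - 2 * b * N\<^sup>2 * C\<psi> * Lam\<^sup>2 * m2"
  proof -
    have "\<rho> * ((c1 * h)\<^sup>2 / 2 - (b * \<tau> / 2 * (C2 * y\<^sup>2))\<^sup>2) \<le> \<rho> * Bn\<^sup>2" by (rule mult_left_mono[OF Bn3 \<rho>_nonneg])
    moreover have "\<rho> * ((c1 * h)\<^sup>2 / 2 - (b * \<tau> / 2 * (C2 * y\<^sup>2))\<^sup>2) = c1\<^sup>2 / 2 * m1 - 1 / 4 * b\<^sup>2 * C2\<^sup>2 * (\<tau>\<^sup>2 * (\<rho> * y) * y ^ 3)"
      unfolding m1_def by (simp add: power2_eq_square power3_eq_cube algebra_simps)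
    moreover have "1 / 4 * b\<^sup>2 * C2\<^sup>2 * (\<tau>\<^sup>2 * (\<rho> * y) * y ^ 3) \<le> 1 / 4 * b\<^sup>2 * C2\<^sup>2 * m4"
      unfolding \<rho>y using gq by (intro mult_left_mono) auto
    moreover have "4 * (\<Sum>k\<in>{1..n}. \<Sum>i\<in>{1..n}. P2 k i * Av \<eta> k * Av \<eta> i)
       \<ge> 4 * (3 / 4 * \<rho> * Bn\<^sup>2 - b * \<tau> / 2 * (N\<^sup>2 * C\<psi> * Lam\<^sup>2 * h\<^sup>2))"
      using P2_form_lower[of \<eta>] unfolding Bn_def by (intro mult_left_mono) auto
    moreover have "4 * (3 / 4 * \<rho> * Bn\<^sup>2 - b * \<tau> / 2 * (N\<^sup>2 * C\<psi> * Lam\<^sup>2 * h\<^sup>2)) = 3 * (\<rho> * Bn\<^sup>2) - 2 * b * N\<^sup>2 * C\<psi> * Lam\<^sup>2 * m2"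
      unfolding m2_def by (simp add: algebra_simps)
    ultimately show ?thesis unfolding distrib_left right_diff_distrib add_divide_distrib diff_divide_distrib minus_add_distrib by linarith
  qed
  have F3: "6 * K * q * \<tau> * y * Av \<eta> n \<ge> 9 * K * lam * m3 - 3 * K * b * C2 * m4"
  proof -
    have "6 * K * q * \<tau> * y * (3 / 2 * g * y * lam - b * \<tau> / 2 * (C2 * y\<^sup>2)) \<le> 6 * K * q * \<tau> * y * Bn"
      using pos q0 \<tau> y by (intro mult_left_mono[OF Bn1]) auto
    moreover have "6 * K * q * \<tau> * y * (3 / 2 * g * y * lam - b * \<tau> / 2 * (C2 * y\<^sup>2)) = 9 * K * lam * m3 - 3 * K * b * C2 * m4"
      unfolding m3_def m4_def by (simp add: algebra_simps power2_eq_square power3_eq_cube)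
    ultimately show ?thesis unfolding Bn_def by simp
  qed
  \<comment> \<open>The term with \<open>Af (psi1 x) (psi1 x)\<close> has the favourable sign and is
    dropped; the one linear in \<open>psi1\<close> is bounded through
    \<open>conormal_psi\<close>.\<close>
  have F3': "2 * b * \<tau>\<^sup>2 * Af \<eta> (psi1 x) \<le> 3 * b * C2 * m4"
  proof -
    have "0 \<le> b * \<tau> / 2 * Af (psi1 x) (psi1 x)" using bt Af_nonneg by (intro mult_nonneg_nonneg) auto
    moreover have "3 / 2 * g * y * Av (psi1 x) n \<le> 3 / 2 * g * y * (C2 * y\<^sup>2)"
      using D' bt(2) unfolding D_def by (intro mult_left_mono) auto
    ultimately have "Af \<eta> (psi1 x) \<le> 3 / 2 * g * y * (C2 * y\<^sup>2)" unfolding Af_\<eta>_psi1 by linarith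
    then have "2 * b * \<tau>\<^sup>2 * Af \<eta> (psi1 x) \<le> 2 * b * \<tau>\<^sup>2 * (3 / 2 * g * y * (C2 * y\<^sup>2))"
      using pos by (intro mult_left_mono) auto
    also have "\<dots> = 3 * b * C2 * (\<tau>\<^sup>2 * g * y ^ 3)" by (simp add: power2_eq_square power3_eq_cube)
    also have "\<dots> \<le> 3 * b * C2 * m4" using pos C2 by (intro mult_left_mono[OF gq]) auto
    finally show ?thesis .
  qed
  have F4: "(\<Sum>i\<in>{1..n}. \<Sum>j\<in>{1..n}. da 0 i j * \<eta> i * \<eta> j) \<le> N\<^sup>2 * M * m2"
  proof -
    have "\<bar>\<Sum>i\<in>{1..n}. \<Sum>j\<in>{1..n}. da 0 i j * \<eta> i * \<eta> j\<bar> \<le> N * (N * (M * h * h))"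
      using pos by (intro abs_double_sum_le da0) auto
    moreover have "N\<^sup>2 * M * (1 * h\<^sup>2) \<le> N\<^sup>2 * M * m2"
      unfolding m2_def using \<tau> pos by (intro mult_left_mono mult_right_mono) auto
    ultimately show ?thesis by (simp add: power2_eq_square mult_ac)
  qed
  have F5: "P00 = K * (K + 1) * m4 - m6 - K * m5"
    unfolding P00_def m4_def m5_def m6_def by (simp add: algebra_simps)
  have R0R: "R \<ge> 0" using R_bounds by linarith
  \<comment> \<open>\<open>R\<close> is replaced by \<open>3 / 2 * R0\<close> where it hurts and by
    \<open>\<Theta> * \<tau> / 2\<close> in front of \<open>B1\<close>, the favourable part of
    \<open>P0\<close>.\<close>
  have F6: "2 * W * R \<le> 3 * Lam * c * m1 + 3 * Lam * \<Theta> * m2 - \<Theta> / 2 * m6 - \<Theta> / 2 * K * m5 + 3 * K * c * m3 + 3 * \<Theta> * K * m4"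
  proof -
    define B1 where "B1 = (b * ?\<psi> + K) * \<tau>\<^sup>2"
    define B2 where "B2 = K * q * \<tau> * y ^ 3"
    have B1: "B1 \<ge> 0" unfolding B1_def using pos \<psi>0 by simp
    have B2: "B2 \<ge> 0" unfolding B2_def using pos q0 \<tau> y by simp
    have "R * Af \<eta> \<eta> \<le> 3 / 2 * R0 * (Lam * h\<^sup>2)"
      using R_bounds R0R Af_upper[of \<eta>] Af_nonneg by (intro mult_mono) auto
    moreover have "\<Theta> * \<tau> / 2 * B1 \<le> R * B1" using R_bounds B1 by (intro mult_right_mono) auto
    moreover have "R * B2 \<le> 3 / 2 * R0 * B2" using R_bounds B2 by (intro mult_right_mono) auto
    moreover have "2 * W * R = 2 * (R * Af \<eta> \<eta>) - R * B1 + 2 * (R * B2)"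
      unfolding W_def P0_def B1_def B2_def by (simp add: algebra_simps)
    moreover have "3 / 2 * R0 * (Lam * h\<^sup>2) = (3 * Lam * c * m1 + 3 * Lam * \<Theta> * m2) / 2"
      unfolding R0_def m1_def m2_def by (simp add: algebra_simps)
    moreover have "\<Theta> * \<tau> / 2 * B1 = \<Theta> / 2 * m6 + \<Theta> / 2 * K * m5"
      unfolding B1_def m5_def m6_def by (simp add: algebra_simps power2_eq_square power3_eq_cube)
    moreover have "3 / 2 * R0 * B2 = (3 * K * c * (q * \<tau> * (\<rho> * y) * y\<^sup>2) + 3 * \<Theta> * K * m4) / 2"
      unfolding R0_def B2_def m4_def by (simp add: algebra_simps power2_eq_square power3_eq_cube)
    then have "3 / 2 * R0 * B2 = (3 * K * c * m3 + 3 * \<Theta> * K * m4) / 2"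
      unfolding \<rho>y m3_def .
    ultimately show ?thesis unfolding distrib_left right_diff_distrib add_divide_distrib diff_divide_distrib minus_add_distrib by linarith
  qed
  have F7: "R\<^sup>2 \<le> 9 / 2 * \<Theta>\<^sup>2 * m5 + 9 / 2 * c\<^sup>2 * m3"
  proof -
    have "R\<^sup>2 \<le> (3 / 2 * R0)\<^sup>2" using R_bounds R0R by (intro power_mono) auto
    also have "\<dots> \<le> 9 / 2 * (c\<^sup>2 * \<rho>\<^sup>2) + 9 / 2 * (\<Theta>\<^sup>2 * \<tau>\<^sup>2)"
    proof -
      have "0 \<le> 9 / 4 * (c * \<rho> - \<Theta> * \<tau>)\<^sup>2" by simp
      then show ?thesis unfolding R0_def by (simp add: power2_eq_square algebra_simps)
    qed
    also have "\<dots> \<le> 9 / 2 * (c\<^sup>2 * m3) + 9 / 2 * (\<Theta>\<^sup>2 * m5)"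
      unfolding m5_def using \<rho>2 t1 by (intro add_mono mult_left_mono) auto
    finally show ?thesis by simp
  qed
  \<comment> \<open>Splits \<open>h\<close> by \<open>h_le\<close>: the \<open>g\<close> part goes
    to \<open>m3\<close> because \<open>g \<le> q\<close>, the \<open>psi1\<close> part to
    \<open>m6\<close> because \<open>r\<^sup>2\<close> is at most twice
    \<open>\<psi>\<close>.\<close>
  have F8: "m2 \<le> 9 / 2 * m3 + b * C\<psi>\<^sup>2 * m6"
  proof -
    define u where "u = 3 / 2 * g * y"
    define w where "w = b * \<tau> / 2 * (C\<psi> * r)"
    have "h\<^sup>2 \<le> (u + w)\<^sup>2" using h_le h0 unfolding u_def w_def by (intro power_mono) auto
    also have "\<dots> \<le> 2 * u\<^sup>2 + 2 * w\<^sup>2"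
    proof -
      have "0 \<le> (u - w)\<^sup>2" by simp
      then show ?thesis by (simp add: power2_eq_square algebra_simps)
    qed
    finally have "m2 \<le> \<tau> * (2 * u\<^sup>2 + 2 * w\<^sup>2)" unfolding m2_def using \<tau> by (intro mult_left_mono) auto
    also have "\<dots> = 9 / 2 * (g\<^sup>2 * (\<tau> * y\<^sup>2)) + b\<^sup>2 * C\<psi>\<^sup>2 * \<tau> ^ 3 / 2 * r\<^sup>2"
      unfolding u_def w_def by (simp add: power2_eq_square power3_eq_cube algebra_simps)
    also have "\<dots> \<le> 9 / 2 * m3 + b\<^sup>2 * C\<psi>\<^sup>2 * \<tau> ^ 3 / 2 * (2 * ?\<psi>)"
      using gg3 r2 \<tau> by (intro add_mono mult_left_mono) auto
    also have "b\<^sup>2 * C\<psi>\<^sup>2 * \<tau> ^ 3 / 2 * (2 * ?\<psi>) = b * C\<psi>\<^sup>2 * m6"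
      unfolding m6_def by (simp add: power2_eq_square)
    finally show ?thesis .
  qed
  have h2: "h\<^sup>2 \<le> m2" unfolding m2_def using mult_right_mono[OF \<tau>, of "h\<^sup>2"] by simp
  have \<Theta>0: "0 \<le> (3 * Lam + 1) * \<Theta>" using Lam_pos pos by simp
  have G1: "0 \<le> (3 / 2 * c1\<^sup>2 - (3 * N ^ 3 * Lam * E + 3 * Lam * c)) * m1"
    using A5(1) m0 by (intro mult_nonneg_nonneg) auto
  have G2: "(2 * b * N\<^sup>2 * C\<psi> * Lam\<^sup>2 + N\<^sup>2 * M + N ^ 3 * Lam * E * b * C\<psi> + 2 + 3 * Lam * \<Theta>) * m2
     \<le> (3 * Lam + 1) * \<Theta> * (9 / 2 * m3 + b * C\<psi>\<^sup>2 * m6)"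
  proof -
    have "2 * b * N\<^sup>2 * C\<psi> * Lam\<^sup>2 + N\<^sup>2 * M + N ^ 3 * Lam * E * b * C\<psi> + 2 + 3 * Lam * \<Theta> \<le> (3 * Lam + 1) * \<Theta>"
      using A4 by (simp add: algebra_simps)
    then show ?thesis using F8 \<Theta>0 m0 by (intro mult_mono) auto
  qed
  have G3: "0 \<le> (9 * K * lam - 3 * K * c - 9 / 2 * ((3 * Lam + 1) * \<Theta>) - 9 / 2 * c\<^sup>2) * m3"
  proof -
    have "3 * K * c \<le> 3 * K * lam" using A6(1) pos by (intro mult_left_mono) auto
    then have "0 \<le> 9 * K * lam - 3 * K * c - 9 / 2 * ((3 * Lam + 1) * \<Theta>) - 9 / 2 * c\<^sup>2" using A6(2) by linarith
    then show ?thesis using m0(3) by (rule mult_nonneg_nonneg)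
  qed
  have G4: "0 \<le> (K * (K + 1) - (3 * K * b * C2 + 3 * b * C2 + 3 / 4 * b\<^sup>2 * C2\<^sup>2 + 3 * \<Theta> * K + PC)) * m4"
    using A7 m0 unfolding PC_def by (intro mult_nonneg_nonneg) auto
  \<comment> \<open>\<open>A8\<close> limits the cost to \<open>\<Theta> / 4\<close>, and
    \<open>\<Theta> \<ge> 4\<close> covers the remaining 1. This condition fixes \<open>b\<close> in
    terms of \<open>lam\<close> and \<open>Lam\<close>.\<close>
  have G6: "0 \<le> (\<Theta> / 2 - 1 - (3 * Lam + 1) * \<Theta> * (b * C\<psi>\<^sup>2)) * m6"
  proof -
    have "\<Theta> * ((3 * Lam + 1) * b * C\<psi>\<^sup>2) \<le> \<Theta> * (1 / 4)" using A8 pos by (intro mult_left_mono) auto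
    moreover have "(3 * Lam + 1) * \<Theta> * (b * C\<psi>\<^sup>2) = \<Theta> * ((3 * Lam + 1) * b * C\<psi>\<^sup>2)" by (simp add: mult_ac)
    ultimately have "(3 * Lam + 1) * \<Theta> * (b * C\<psi>\<^sup>2) \<le> \<Theta> * (1 / 4)" by (simp only:)
    moreover have "0 \<le> \<theta> / 2 - 1 - z" if "z \<le> \<theta> * (1 / 4)" "4 \<le> \<theta>" for z \<theta> :: real using that by linarith
    ultimately have "0 \<le> \<Theta> / 2 - 1 - (3 * Lam + 1) * \<Theta> * (b * C\<psi>\<^sup>2)" using pos(4) by blast
    then show ?thesis using m0(6) by (rule mult_nonneg_nonneg)
  qed
  have G5: "1 \<le> (\<Theta> / 2 * K - K - 9 / 2 * \<Theta>\<^sup>2) * m5"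
  proof -
    have "4 * K \<le> \<Theta> * K" using pos by (intro mult_right_mono) auto
    then have "1 \<le> \<Theta> / 2 * K - K - 9 / 2 * \<Theta>\<^sup>2" using A9 by simp
    then show ?thesis using m0(5) mult_mono[of 1 _ 1 m5] by fastforce
  qed
  have G7: "PC * \<rho> \<le> PC * m4" by (rule mult_left_mono[OF \<rho>4 PC0])
  have Zge: "Z \<ge> 3 / 2 * c1\<^sup>2 * m1 - 3 / 4 * b\<^sup>2 * C2\<^sup>2 * m4 - 2 * b * N\<^sup>2 * C\<psi> * Lam\<^sup>2 * m2
      - (3 * N ^ 3 * Lam * E * m1 + N ^ 3 * Lam * E * b * C\<psi> * m2) + 9 * K * lam * m3 - 3 * K * b * C2 * m4 - 3 * b * C2 * m4
      - N\<^sup>2 * M * m2 + K * (K + 1) * m4 - m6 - K * m5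
      - (3 * Lam * c * m1 + 3 * Lam * \<Theta> * m2 - \<Theta> / 2 * m6 - \<Theta> / 2 * K * m5 + 3 * K * c * m3 + 3 * \<Theta> * K * m4)
      - (9 / 2 * \<Theta>\<^sup>2 * m5 + 9 / 2 * c\<^sup>2 * m3)"
    unfolding Z_eq using F1 F2 F3 F3' F4 F5 F6 F7 by linarith
  show ?thesis unfolding PC_def[symmetric]
    using Zge G1 G2 G3 G4 G5 G6 G7 h2 unfolding left_diff_distrib distrib_right distrib_left
    by (simp add: mult.assoc)
qed

text \<open>\<open>GT_lower\<close> leaves the surplus that \<open>cross_lower\<close> spends, and
  \<open>Z_lower\<close> leaves the multiple of \<open>\<rho>\<close> that
  \<open>cross_lower\<close> costs. The term \<open>2 * h\<^sup>2\<close> is kept for the passage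
  from \<open>V\<close> back to the gradient of \<open>u\<close>.\<close>

lemma pointwise_inequality:
  fixes H :: "nat \<Rightarrow> nat \<Rightarrow> real"
  assumes H: "\<And>i j. i \<le> n \<Longrightarrow> j \<le> n \<Longrightarrow> H i j = H j i"
  shows "jet.Qf n a da v V (Av \<eta>) dB F W dF dW - R\<^sup>2 * v\<^sup>2 \<ge> 2 * (nrm V)\<^sup>2 + (1 + 2 * h\<^sup>2) * v\<^sup>2"
proof -
  interpret jet n a da v V H "Av \<eta>" dB F W dF dW
    by unfold_locales (fact a_sym, fact H)
  define DB where "DB = (\<Sum>i\<in>{1..n}. dB i i)"
  define SdW where "SdW = (\<Sum>i\<in>{1..n}. Av \<eta> i * dW i)"
  define PC where "PC = (real n * (E + Lam + c) * Lam)\<^sup>2 / (lam * c)"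
  have w: "w = Av V" by (rule ext) (simp add: w_def Av_def)
  have s: "s = Af V V" by (simp add: s_def w Af_def)
  have R: "F = R + DB" by (simp add: R_def DB_def)
  have "Qf - R\<^sup>2 * v\<^sup>2 = GT V + 2 * v * (\<Sum>i\<in>{1..n}. Av V i * dF i) + Z * v\<^sup>2"
    unfolding Qf_def GT_def Z_def w s DB_def[symmetric] SdW_def[symmetric] unfolding R
    by (simp add: algebra_simps)
  moreover have "GT V \<ge> (lam * c * \<rho> + 2) * (nrm V)\<^sup>2" by (rule GT_lower)
  moreover have "(lam * c * \<rho>) * (nrm V)\<^sup>2 + 2 * v * (\<Sum>i\<in>{1..n}. Av V i * dF i) \<ge> - (PC * \<rho> * v\<^sup>2)"
    unfolding PC_def by (rule cross_lower)
  moreover have "(1 + 2 * h\<^sup>2 + PC * \<rho>) * v\<^sup>2 \<le> Z * v\<^sup>2"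
    using Z_lower unfolding PC_def by (intro mult_right_mono) auto
  ultimately show ?thesis unfolding distrib_right by linarith
qed

end

section \<open>Derivatives of the weight\<close>

lemma has_pd_eqI: "has_pd i f p d \<Longrightarrow> d = d' \<Longrightarrow> has_pd i f p d'"
  by simp

lemma slip_cmult:
  assumes "slip n B f" "compact B" "B \<subseteq> Om n"
  shows "slip n B (\<lambda>p. c * f p)"
  by (rule slip_mult[OF slip_const assms])

lemma slip_uminus:
  assumes "slip n B f" "compact B" "B \<subseteq> Om n"
  shows "slip n B (\<lambda>p. - f p)"
  using slip_cmult[OF assms, of "-1"] by simp

lemma slip_diff:
  assumes "slip n B f" "slip n B g" "compact B" "B \<subseteq> Om n"
  shows "slip n B (\<lambda>p. f p - g p)"
  using slip_add[OF assms(1) slip_uminus[OF assms(2-4)]] by simp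

lemma slip_exp:
  assumes f: "slip n (cuboid n l r) f" and B: "cuboid n l r \<subseteq> Om n"
    and d: "\<And>i p. i \<le> n \<Longrightarrow> p \<in> Om n \<Longrightarrow> has_pd i f p (f' i p)"
    and c: "\<And>i. i \<le> n \<Longrightarrow> continuous_on (Om n) (f' i)"
  shows "slip n (cuboid n l r) (\<lambda>p. exp (f p))"
proof (rule slip_C1[where f' = "\<lambda>i p. exp (f p) * f' i p"])
  show "continuous_on (Om n) (\<lambda>p. exp (f p))"
    by (rule continuous_on_exp[OF slip_continuous[OF f]])
  show "has_pd i (\<lambda>p. exp (f p)) p (exp (f p) * f' i p)" if "i \<le> n" "p \<in> Om n" for i p
    by (rule has_pd_chain[OF DERIV_exp d[OF that]])
  show "continuous_on (Om n) (\<lambda>p. exp (f p) * f' i p)" if "i \<le> n" for i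
    by (rule continuous_on_mult[OF continuous_on_exp[OF slip_continuous[OF f]] c[OF that]])
qed (rule B)

locale weight =
  fixes n :: nat and lam Lam b c \<Theta> K \<gamma> :: real
  assumes n1: "n \<ge> 1" and K0: "K > 0" and \<gamma>0: "\<gamma> > 0"
begin

definition ka :: real where "ka = Lam / lam"
definition en :: "nat \<Rightarrow> real" where "en i = (if i = n then 1 else 0)"
definition tau :: "point \<Rightarrow> real" where "tau p = 1 / crd 0 p"
definition qf :: "point \<Rightarrow> real" where "qf p = \<gamma> * crd 0 p powr (- K)"
definition yf :: "point \<Rightarrow> real" where "yf p = sqrt (crd n p)"
text \<open>The reciprocals of \<open>yf\<close> and \<open>rf\<close> get their own names so that
  all derivatives of the weight are polynomials in a few base functions; \<open>yf_mult_iy\<close>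
  and \<open>rf_mult_ir\<close> then settle the algebra.\<close>

definition iy :: "point \<Rightarrow> real" where "iy p = 1 / yf p"
definition rf :: "point \<Rightarrow> real" where "rf p = sqrt (\<Sum>i\<in>{1..n}. (crd i p)\<^sup>2)"
definition ir :: "point \<Rightarrow> real" where "ir p = 1 / rf p"

lemma Om_pos:
  assumes "p \<in> Om n"
  shows "crd 0 p > 0" "crd 0 p < 1" "crd n p > 0" "yf p > 0" "rf p > 0"
proof -
  show 1: "crd 0 p > 0" "crd 0 p < 1" "crd n p > 0" using assms n1 by (simp_all add: Om_iff crd_def)
  show "yf p > 0" using 1 by (simp add: yf_def)
  have "0 < (crd n p)\<^sup>2" using 1(3) by simp
  also have "\<dots> \<le> (\<Sum>i\<in>{1..n}. (crd i p)\<^sup>2)" using n1 by (intro member_le_sum) auto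
  finally show "rf p > 0" by (simp add: rf_def)
qed

lemma yf_sq: "p \<in> Om n \<Longrightarrow> yf p * yf p = crd n p"
  using Om_pos(3)[of p] by (simp add: yf_def)

lemma has_pd_tau: "p \<in> Om n \<Longrightarrow> has_pd i tau p (if i = 0 then - (tau p * tau p) else 0)"
proof -
  assume p: "p \<in> Om n"
  have "((\<lambda>x. 1 / x) has_real_derivative - (tau p * tau p)) (at (crd 0 p))"
    using Om_pos[OF p] by (auto intro!: derivative_eq_intros simp: tau_def power2_eq_square)
  from has_pd_chain[OF this has_pd_crd, of i] show ?thesis
    unfolding tau_def[abs_def] by (rule has_pd_eqI) simp
qed

lemma has_pd_qf: "p \<in> Om n \<Longrightarrow> has_pd i qf p (if i = 0 then - (K * qf p * tau p) else 0)"
proof -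
  assume p: "p \<in> Om n"
  have "((\<lambda>x. \<gamma> * x powr (- K)) has_real_derivative \<gamma> * (- K * crd 0 p powr (- K - 1))) (at (crd 0 p))"
    using Om_pos[OF p] by (intro DERIV_cmult has_real_derivative_powr) auto
  moreover have "crd 0 p powr (- K - 1) = crd 0 p powr (- K) * tau p"
    using Om_pos[OF p] by (simp add: powr_diff tau_def)
  ultimately have "((\<lambda>x. \<gamma> * x powr (- K)) has_real_derivative - (K * qf p * tau p)) (at (crd 0 p))"
    by (simp add: qf_def mult_ac)
  from has_pd_chain[OF this has_pd_crd, of i] show ?thesis
    unfolding qf_def[abs_def] by (rule has_pd_eqI) (simp add: qf_def)
qed

lemma has_pd_yf: "p \<in> Om n \<Longrightarrow> has_pd i yf p (en i * iy p / 2)"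
proof -
  assume p: "p \<in> Om n"
  have "(sqrt has_real_derivative (inverse (sqrt (crd n p)) / 2)) (at (crd n p))"
    using Om_pos[OF p] by (intro DERIV_real_sqrt)
  from has_pd_chain[OF this has_pd_crd, of i] show ?thesis
    unfolding yf_def[abs_def] by (rule has_pd_eqI) (simp add: en_def iy_def yf_def inverse_eq_divide)
qed

lemma has_pd_iy: "p \<in> Om n \<Longrightarrow> has_pd i iy p (- (en i * iy p * iy p * iy p / 2))"
proof -
  assume p: "p \<in> Om n"
  have "((\<lambda>x. 1 / x) has_real_derivative - (iy p * iy p)) (at (yf p))"
    using Om_pos[OF p] by (auto intro!: derivative_eq_intros simp: iy_def power2_eq_square)
  from has_pd_chain[OF this has_pd_yf[OF p], of i] show ?thesis
    unfolding iy_def[abs_def] by (rule has_pd_eqI) (simp add: iy_def)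
qed

lemma has_pd_rf: "p \<in> Om n \<Longrightarrow> i \<le> n \<Longrightarrow> has_pd i rf p (if i = 0 then 0 else crd i p * ir p)"
proof -
  assume p: "p \<in> Om n" and i: "i \<le> n"
  have "0 < (\<Sum>j\<in>{1..n}. (crd j p)\<^sup>2)" using Om_pos(5)[OF p] by (simp add: rf_def)
  then have 1: "(sqrt has_real_derivative (inverse (rf p) / 2)) (at (\<Sum>j\<in>{1..n}. (crd j p)\<^sup>2))"
    unfolding rf_def by (rule DERIV_real_sqrt)
  have "has_pd i (\<lambda>q. \<Sum>j\<in>{1..n}. (crd j q)\<^sup>2) p (\<Sum>j\<in>{1..n}. 2 * crd j p * (if i = j then 1 else 0))"
  proof (rule has_pd_sum)
    fix j
    have "((\<lambda>x. x\<^sup>2) has_real_derivative (2 * crd j p)) (at (crd j p))" by (auto intro!: derivative_eq_intros)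
    from has_pd_chain[OF this has_pd_crd, of i] show "has_pd i (\<lambda>q. (crd j q)\<^sup>2) p (2 * crd j p * (if i = j then 1 else 0))" .
  qed
  moreover have "(\<Sum>j\<in>{1..n}. 2 * crd j p * (if i = j then 1 else 0)) = (if i = 0 then 0 else 2 * crd i p)"
    using i by (simp add: if_distrib cong: if_cong)
  ultimately have 2: "has_pd i (\<lambda>q. \<Sum>j\<in>{1..n}. (crd j q)\<^sup>2) p (if i = 0 then 0 else 2 * crd i p)" by simp
  show ?thesis
    unfolding rf_def[abs_def]
    by (rule has_pd_eqI[OF has_pd_chain[OF 1 2]]) (simp add: ir_def rf_def inverse_eq_divide)
qed

lemma has_pd_ir: "p \<in> Om n \<Longrightarrow> i \<le> n \<Longrightarrow> has_pd i ir p (if i = 0 then 0 else - (crd i p * ir p * ir p * ir p))"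
proof -
  assume p: "p \<in> Om n" and i: "i \<le> n"
  have "((\<lambda>x. 1 / x) has_real_derivative - (ir p * ir p)) (at (rf p))"
    using Om_pos[OF p] by (auto intro!: derivative_eq_intros simp: ir_def power2_eq_square)
  from has_pd_chain[OF this has_pd_rf[OF p i]] show ?thesis
    unfolding ir_def[abs_def] by (rule has_pd_eqI) (simp add: ir_def)
qed

lemma continuous_base:
  "continuous_on (Om n) tau" "continuous_on (Om n) qf" "continuous_on (Om n) yf" "continuous_on (Om n) iy"
  "continuous_on (Om n) rf" "continuous_on (Om n) ir"
proof -
  have nz: "\<forall>p\<in>Om n. crd 0 p \<noteq> 0" "\<forall>p\<in>Om n. yf p \<noteq> 0" "\<forall>p\<in>Om n. rf p \<noteq> 0"
    by (intro ballI; use Om_pos in force)+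
  show "continuous_on (Om n) tau" unfolding tau_def[abs_def]
    by (intro continuous_on_divide continuous_on_const continuous_on_crd nz)
  show "continuous_on (Om n) qf" unfolding qf_def[abs_def]
    by (intro continuous_on_mult continuous_on_powr continuous_on_const continuous_on_crd nz)
  show y: "continuous_on (Om n) yf" unfolding yf_def[abs_def]
    by (intro continuous_on_real_sqrt continuous_on_crd)
  show "continuous_on (Om n) iy" unfolding iy_def[abs_def]
    by (intro continuous_on_divide continuous_on_const y nz)
  show r: "continuous_on (Om n) rf" unfolding rf_def[abs_def]
    by (intro continuous_on_real_sqrt continuous_on_sum continuous_on_power continuous_on_crd)
  show "continuous_on (Om n) ir" unfolding ir_def[abs_def]
    by (intro continuous_on_divide continuous_on_const r nz)
qed

lemma slip_base:
  assumes B: "cuboid n l r \<subseteq> Om n"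
  shows "slip n (cuboid n l r) tau" "slip n (cuboid n l r) qf" "slip n (cuboid n l r) yf" "slip n (cuboid n l r) iy"
    "slip n (cuboid n l r) rf" "slip n (cuboid n l r) ir" "slip n (cuboid n l r) (crd j)"
proof -
  note c = continuous_base
  have if_c: "continuous_on (Om n) (\<lambda>p. if P then f p else g p)"
    if "continuous_on (Om n) f" "continuous_on (Om n) g" for P and f g :: "point \<Rightarrow> real"
    using that by (cases P) simp_all
  show "slip n (cuboid n l r) tau"
    by (rule slip_C1[OF c(1) has_pd_tau _ B]) (auto intro!: continuous_on_minus continuous_on_mult if_c c continuous_on_const)
  show "slip n (cuboid n l r) qf"
    by (rule slip_C1[OF c(2) has_pd_qf _ B]) (auto intro!: continuous_on_minus continuous_on_mult if_c c continuous_on_const)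
  show "slip n (cuboid n l r) yf"
    by (rule slip_C1[OF c(3) has_pd_yf _ B]) (auto intro!: continuous_on_divide continuous_on_mult c continuous_on_const)
  show "slip n (cuboid n l r) iy"
    by (rule slip_C1[OF c(4) has_pd_iy _ B]) (auto intro!: continuous_on_minus continuous_on_divide continuous_on_mult c continuous_on_const)
  show "slip n (cuboid n l r) rf"
    by (rule slip_C1[OF c(5) has_pd_rf _ B]) (auto intro!: if_c continuous_on_mult c continuous_on_crd continuous_on_const)
  show "slip n (cuboid n l r) ir"
    by (rule slip_C1[OF c(6) has_pd_ir _ B]) (auto intro!: if_c continuous_on_minus continuous_on_mult c continuous_on_crd continuous_on_const)
  show "slip n (cuboid n l r) (crd j)"
    by (rule slip_C1[OF continuous_on_crd has_pd_crd _ B]) (rule continuous_on_const)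
qed

definition gf :: "point \<Rightarrow> real" where "gf p = qf p - \<gamma>"
definition psif :: "point \<Rightarrow> real" where
  "psif p = rf p * rf p - 2 * ka * (rf p * crd n p) + 2 * ka\<^sup>2 * (crd n p * crd n p)"
definition psi1f :: "nat \<Rightarrow> point \<Rightarrow> real" where
  "psi1f i p = 2 * crd i p - 2 * ka * (crd n p * (ir p * crd i p)) + (4 * ka\<^sup>2 * crd n p - 2 * ka * rf p) * en i"
definition psi2f :: "nat \<Rightarrow> nat \<Rightarrow> point \<Rightarrow> real" where
  "psi2f j i p = 2 * (if i = j then 1 else 0) + 4 * ka\<^sup>2 * (en i * en j)
     - 2 * ka * ((if i = j then 1 else 0) * (crd n p * ir p) + en j * (crd i p * ir p) + en i * (crd j p * ir p)
        - crd i p * crd j p * crd n p * (ir p * ir p * ir p))"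

text \<open>Half of the exponent of the weight for the power 3/2, with \<open>yf p ^ 3\<close> in
  place of that power of \<open>x_n\<close>; see \<open>weight_eq\<close>. The formulas in
  \<open>phi2\<close> are laid out to match \<open>P2\<close>, \<open>P02\<close> and
  \<open>P00\<close> of \<open>carleman_point\<close>.\<close>

definition phi :: "point \<Rightarrow> real" where
  "phi p = gf p * (yf p * yf p * yf p) - (b * psif p + K) * tau p / 2"
definition phi1 :: "nat \<Rightarrow> point \<Rightarrow> real" where
  "phi1 i p = (if i = 0 then (b * psif p + K) * (tau p * tau p) / 2 - K * (qf p * tau p * (yf p * yf p * yf p))
     else 3 / 2 * (gf p * yf p) * en i - b / 2 * (tau p * psi1f i p))"
definition phi2 :: "nat \<Rightarrow> nat \<Rightarrow> point \<Rightarrow> real" where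
  "phi2 j i p = (if i = 0 then
       (if j = 0 then K * (K + 1) * qf p * (tau p)\<^sup>2 * yf p ^ 3 - (b * psif p + K) * tau p ^ 3
        else b * (tau p)\<^sup>2 / 2 * psi1f j p - 3 / 2 * K * qf p * tau p * yf p * en j)
     else if j = 0 then b * (tau p)\<^sup>2 / 2 * psi1f i p - 3 / 2 * K * qf p * tau p * yf p * en i
     else 3 / 4 * (gf p * iy p) * (en j * en i) - b * tau p / 2 * psi2f j i p)"

lemmas has_pd_intros = has_pd_const has_pd_add has_pd_diff has_pd_minus has_pd_mult has_pd_crd
  has_pd_tau has_pd_qf has_pd_yf has_pd_iy has_pd_rf has_pd_ir

lemma yf_mult_iy: "p \<in> Om n \<Longrightarrow> yf p * iy p = 1"
  using Om_pos(4)[of p] by (simp add: iy_def)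

lemma rf_mult_ir: "p \<in> Om n \<Longrightarrow> rf p * ir p = 1"
  using Om_pos(5)[of p] by (simp add: ir_def)

lemma has_pd_psif:
  assumes p: "p \<in> Om n" and i: "i \<le> n"
  shows "has_pd i psif p (if i = 0 then 0 else psi1f i p)"
proof -
  have "rf p * (crd i p * ir p) = crd i p" using rf_mult_ir[OF p] by (simp add: mult.left_commute)
  then show ?thesis
    unfolding psif_def[abs_def]
    apply -
    apply (rule has_pd_eqI, (rule has_pd_intros p i)+)
    apply (use n1 in \<open>simp add: psi1f_def en_def algebra_simps\<close>)
    done
qed

lemma has_pd_psi1f:
  assumes p: "p \<in> Om n" and j: "j \<le> n" and i: "i \<noteq> 0"
  shows "has_pd j (psi1f i) p (if j = 0 then 0 else psi2f j i p)"
  unfolding psi1f_def[abs_def]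
  apply (rule has_pd_eqI, (rule has_pd_intros p j)+)
  apply (use n1 i in \<open>simp add: psi2f_def en_def algebra_simps\<close>)
  done

lemma has_pd_gf: "p \<in> Om n \<Longrightarrow> has_pd i gf p (if i = 0 then - (K * qf p * tau p) else 0)"
  unfolding gf_def[abs_def] by (rule has_pd_eqI, rule has_pd_diff[OF has_pd_qf has_pd_const]) simp_all

lemma has_pd_phi:
  assumes p: "p \<in> Om n" and i: "i \<le> n"
  shows "has_pd i phi p (phi1 i p)"
proof -
  have y: "iy p * yf p = 1" using yf_mult_iy[OF p] by (simp add: mult.commute)
  \<comment> \<open>Division by 2 is written as a factor because \<open>has_pd_intros\<close> has
    product rules but no quotient rule. Applying these rules computes a derivative, which is then
    identified with \<open>phi1\<close>.\<close>
  have "has_pd i (\<lambda>p. gf p * (yf p * yf p * yf p) - (b * psif p + K) * (tau p * (1 / 2))) p (phi1 i p)"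
    apply (rule has_pd_eqI, (rule has_pd_intros has_pd_gf has_pd_psif p i)+)
    apply (use n1 y in \<open>simp add: phi1_def en_def algebra_simps add_divide_distrib diff_divide_distrib\<close>)
    done
  then show ?thesis unfolding phi_def[abs_def] by simp
qed

lemma has_pd_phi1:
  assumes p: "p \<in> Om n" and j: "j \<le> n" and i: "i \<le> n"
  shows "has_pd j (phi1 i) p (phi2 j i p)"
proof (cases "i = 0")
  case True
  have y: "iy p * yf p = 1" using yf_mult_iy[OF p] by (simp add: mult.commute)
  have "has_pd j (\<lambda>p. (b * psif p + K) * (tau p * tau p * (1 / 2)) - K * (qf p * tau p * (yf p * yf p * yf p))) p (phi2 j 0 p)"
    apply (rule has_pd_eqI, (rule has_pd_intros has_pd_gf has_pd_psif p j)+)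
    apply (use n1 y in \<open>simp add: phi2_def en_def algebra_simps power2_eq_square power3_eq_cube add_divide_distrib diff_divide_distrib\<close>)
    done
  then show ?thesis using True unfolding phi1_def[abs_def] by simp
next
  case False
  have "has_pd j (\<lambda>p. 3 / 2 * (gf p * yf p) * en i - b / 2 * (tau p * psi1f i p)) p (phi2 j i p)"
    apply (rule has_pd_eqI, (rule has_pd_intros has_pd_gf has_pd_psi1f p j False)+)
    apply (use n1 False in \<open>simp add: phi2_def en_def algebra_simps power2_eq_square\<close>)
    done
  then show ?thesis using False unfolding phi1_def[abs_def] by simp
qed

lemma phi2_commute: "phi2 j i p = phi2 i j p"
  unfolding phi2_def psi2f_def by (simp add: mult_ac add_ac)

lemma slip_phi:
  assumes B: "cuboid n l r \<subseteq> Om n"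
  shows "slip n (cuboid n l r) psif" "slip n (cuboid n l r) phi" "slip n (cuboid n l r) (phi1 i)"
    "slip n (cuboid n l r) (\<lambda>p. gf p * iy p)" "slip n (cuboid n l r) (\<lambda>p. exp (phi p))"
proof -
  note sl = slip_base[OF B] slip_const slip_add slip_mult[OF _ _ compact_cuboid B] slip_diff[OF _ _ compact_cuboid B]
  have g: "slip n (cuboid n l r) gf" unfolding gf_def[abs_def] by (intro sl)
  show psi: "slip n (cuboid n l r) psif" unfolding psif_def[abs_def] by (intro sl)
  have psi1: "slip n (cuboid n l r) (psi1f i)" for i unfolding psi1f_def[abs_def] by (intro sl)
  have eq: "phi = (\<lambda>p. gf p * (yf p * yf p * yf p) - (b * psif p + K) * (tau p * (1 / 2)))"
    by (rule ext) (simp add: phi_def)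
  show phi: "slip n (cuboid n l r) phi" unfolding eq by (intro sl g psi)
  show phi1: "slip n (cuboid n l r) (phi1 i)" for i
  proof (cases "i = 0")
    case True
    have eq: "phi1 i = (\<lambda>p. (b * psif p + K) * (tau p * tau p * (1 / 2)) - K * (qf p * tau p * (yf p * yf p * yf p)))"
      by (rule ext) (simp add: phi1_def True)
    show ?thesis unfolding eq by (intro sl psi)
  next
    case False
    have eq: "phi1 i = (\<lambda>p. 3 / 2 * (gf p * yf p) * en i - b / 2 * (tau p * psi1f i p))"
      by (rule ext) (simp add: phi1_def False)
    show ?thesis unfolding eq by (intro sl psi1 g)
  qed
  show "slip n (cuboid n l r) (\<lambda>p. gf p * iy p)" by (rule slip_mult[OF g slip_base(4)[OF B] compact_cuboid B])
  show "slip n (cuboid n l r) (\<lambda>p. exp (phi p))"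
  proof (rule slip_exp[where f' = phi1, OF phi B])
    show "has_pd i phi p (phi1 i p)" if "i \<le> n" "p \<in> Om n" for i p by (rule has_pd_phi[OF that(2,1)])
    show "continuous_on (Om n) (phi1 i)" for i by (rule slip_continuous[OF phi1])
  qed
qed

lemma has_pd_rho:
  assumes "p \<in> Om n" "i \<le> n" "i \<noteq> 0"
  shows "has_pd i (\<lambda>p. gf p * iy p) p (- (gf p * (en i * iy p * iy p * iy p / 2)))"
  using has_pd_mult[OF has_pd_gf[OF assms(1), of i] has_pd_iy[OF assms(1), of i]] assms(3) by simp

end

section \<open>The integral inequality\<close>

text \<open>With \<open>v = w u\<close>, \<open>\<nabla>w = w \<eta>\<close> and
  \<open>B = A \<eta>\<close> this is \<open>div (A \<nabla>v) = w div (A \<nabla>u) + (div B) v + 2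
  B . \<nabla>v - (B . \<eta>) v\<close>, stated for numbers so that it applies at a single point of
  differentiability.\<close>

lemma conjugated_operator_algebra:
  fixes a da P u2 :: "nat \<Rightarrow> nat \<Rightarrow> real" and u1 \<eta> :: "nat \<Rightarrow> real" and w u :: real
  assumes sym: "\<And>i j. i \<in> I \<Longrightarrow> j \<in> I \<Longrightarrow> a i j = a j i"
  shows "(\<Sum>i\<in>I. \<Sum>j\<in>I. da i j * (w * (u1 j + \<eta> j * u)) + a i j * (w * (u2 i j + (P i j * u + \<eta> j * u1 i)) + w * \<eta> i * (u1 j + \<eta> j * u)))
    = w * (\<Sum>i\<in>I. \<Sum>j\<in>I. da i j * u1 j + a i j * u2 i j) + (\<Sum>i\<in>I. \<Sum>j\<in>I. da i j * \<eta> j + a i j * P i j) * (w * u)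
     + 2 * (\<Sum>k\<in>I. (\<Sum>l\<in>I. a k l * \<eta> l) * (w * (u1 k + \<eta> k * u))) - (\<Sum>k\<in>I. (\<Sum>l\<in>I. a k l * \<eta> l) * \<eta> k) * (w * u)"
proof -
  define T where "T = (\<Sum>i\<in>I. \<Sum>j\<in>I. a i j * \<eta> j * u1 i)"
  define U where "U = (\<Sum>i\<in>I. \<Sum>j\<in>I. a i j * \<eta> j * \<eta> i)"
  have T: "(\<Sum>i\<in>I. \<Sum>j\<in>I. a i j * \<eta> i * u1 j) = T"
    unfolding T_def by (subst sum.swap) (intro sum.cong refl, simp add: sym)
  have 1: "(\<Sum>k\<in>I. (\<Sum>l\<in>I. a k l * \<eta> l) * \<eta> k) = U" unfolding U_def sum_distrib_right ..
  have 2: "(\<Sum>k\<in>I. (\<Sum>l\<in>I. a k l * \<eta> l) * (w * (u1 k + \<eta> k * u))) = w * T + w * u * U"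
  proof -
    have "(\<Sum>l\<in>I. a k l * \<eta> l) * (w * (u1 k + \<eta> k * u)) = w * (\<Sum>l\<in>I. a k l * \<eta> l * u1 k) + w * u * (\<Sum>l\<in>I. a k l * \<eta> l * \<eta> k)" for k
      unfolding sum_distrib_right[symmetric] by (simp add: algebra_simps)
    then show ?thesis unfolding T_def U_def by (simp only: sum.distrib sum_distrib_left)
  qed
  have "da i j * (w * (u1 j + \<eta> j * u)) + a i j * (w * (u2 i j + (P i j * u + \<eta> j * u1 i)) + w * \<eta> i * (u1 j + \<eta> j * u))
    = w * (da i j * u1 j + a i j * u2 i j) + w * u * (da i j * \<eta> j + a i j * P i j)
      + w * (a i j * \<eta> j * u1 i) + w * (a i j * \<eta> i * u1 j) + w * u * (a i j * \<eta> j * \<eta> i)" for i j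
    by (simp add: algebra_simps)
  then have "(\<Sum>i\<in>I. \<Sum>j\<in>I. da i j * (w * (u1 j + \<eta> j * u)) + a i j * (w * (u2 i j + (P i j * u + \<eta> j * u1 i)) + w * \<eta> i * (u1 j + \<eta> j * u)))
    = w * (\<Sum>i\<in>I. \<Sum>j\<in>I. da i j * u1 j + a i j * u2 i j) + w * u * (\<Sum>i\<in>I. \<Sum>j\<in>I. da i j * \<eta> j + a i j * P i j)
      + w * T + w * T + w * u * U"
    by (simp only: sum.distrib sum_distrib_left[symmetric] T U_def[symmetric] T_def[symmetric])
  then show ?thesis unfolding 1 2 by (simp add: algebra_simps)
qed

text \<open>The conditions on the constants alone, separated from points and coefficients so that
  their consistency is a statement about real numbers. \<open>A1\<close> and \<open>A2\<close> serve
  \<open>GT_lower\<close>, \<open>A3\<close> serves \<open>R_bounds\<close>, and \<open>A4\<close>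
  to \<open>A9\<close> give the quantities in \<open>Z_lower\<close> coefficients of the right
  sign.\<close>

locale carleman_parameters =
  fixes n :: nat and lam Lam b c c1 \<Theta> K Mb E :: real
  assumes lam: "0 < lam" "lam \<le> Lam"
    and pos: "b > 0" "c > 0" "c1 > 0" "\<Theta> \<ge> 4" "K > 0" "Mb > 0" "E > 0"
    and A1: "12 * real n ^ 3 * Lam * E \<le> lam * c"
    and A2: "4 * real n ^ 3 * Lam * E * b * elliptic.C\<psi> lam Lam + (real n)\<^sup>2 * Mb + 3 * b * (real n)\<^sup>2 * elliptic.C\<psi> lam Lam * Lam\<^sup>2 + 2 \<le> 2 * lam * \<Theta>"
    and A3: "3 * (real n)\<^sup>2 * E \<le> c" "(real n)\<^sup>2 * E * b * elliptic.C\<psi> lam Lam + b * (real n)\<^sup>2 * Lam * elliptic.C\<psi> lam Lam \<le> \<Theta>"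
    and A4: "2 * b * (real n)\<^sup>2 * elliptic.C\<psi> lam Lam * Lam\<^sup>2 + (real n)\<^sup>2 * Mb + real n ^ 3 * Lam * E * b * elliptic.C\<psi> lam Lam + 2 \<le> \<Theta>"
    and A5: "3 * real n ^ 3 * Lam * E + 3 * Lam * c \<le> 3 / 2 * c1\<^sup>2" "c1 \<le> lam" "c1 * elliptic.C\<psi> lam Lam \<le> Lam + lam"
    and A6: "c \<le> lam" "9 / 2 * ((3 * Lam + 1) * \<Theta>) + 9 / 2 * c\<^sup>2 \<le> 6 * K * lam"
    and A7: "3 * K * b * elliptic.C2 lam Lam + 3 * b * elliptic.C2 lam Lam + 3 / 4 * b\<^sup>2 * (elliptic.C2 lam Lam)\<^sup>2 + 3 * \<Theta> * K
       + (real n * (E + Lam + c) * Lam)\<^sup>2 / (lam * c) \<le> K * (K + 1)"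
    and A8: "(3 * Lam + 1) * b * (elliptic.C\<psi> lam Lam)\<^sup>2 \<le> 1 / 4"
    and A9: "9 / 2 * \<Theta>\<^sup>2 + 1 \<le> K"

locale carleman = carleman_parameters n lam Lam b c c1 \<Theta> K Mb E + weight n lam Lam b c \<Theta> K \<gamma> + support_in_box n l r S \<delta>
  for n lam Lam b c c1 \<Theta> K Mb E \<gamma> l r S \<delta> +
  fixes a :: "nat \<Rightarrow> nat \<Rightarrow> point \<Rightarrow> real" and u :: "point \<Rightarrow> real"
  assumes a_sym: "\<And>i j p. i \<in> {1..n} \<Longrightarrow> j \<in> {1..n} \<Longrightarrow> p \<in> Om n \<Longrightarrow> a i j p = a j i p"
    and ell: "\<And>p \<xi>. p \<in> Om n \<Longrightarrow> lam * (L2_set \<xi> {1..n})\<^sup>2 \<le> (\<Sum>i\<in>{1..n}. \<Sum>j\<in>{1..n}. a i j p * \<xi> i * \<xi> j)"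
      "\<And>p \<xi>. p \<in> Om n \<Longrightarrow> (\<Sum>i\<in>{1..n}. \<Sum>j\<in>{1..n}. a i j p * \<xi> i * \<xi> j) \<le> Lam * (L2_set \<xi> {1..n})\<^sup>2"
    and slip_a: "\<And>i j. i \<in> {1..n} \<Longrightarrow> j \<in> {1..n} \<Longrightarrow> slip n (cuboid n l r) (a i j)"
    and u_pd: "\<And>i p. i \<le> n \<Longrightarrow> p \<in> Om n \<Longrightarrow> has_pd i u p (pd i u p)"
    and u_pd2: "\<And>i j p. i \<le> n \<Longrightarrow> j \<le> n \<Longrightarrow> p \<in> Om n \<Longrightarrow> has_pd i (pd j u) p (pd i (pd j u) p)"
    and u_comm: "\<And>i j p. i \<le> n \<Longrightarrow> j \<le> n \<Longrightarrow> p \<in> Om n \<Longrightarrow> pd i (pd j u) p = pd j (pd i u) p"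
    and slip_u: "slip n (cuboid n l r) u" "\<And>i. i \<le> n \<Longrightarrow> slip n (cuboid n l r) (pd i u)"
    and u_zero: "\<And>p. p \<in> Om n \<Longrightarrow> p \<notin> S \<Longrightarrow> u p = 0"
    and S_xn: "\<And>p. p \<in> S \<Longrightarrow> fst p n \<ge> 1"
begin

abbreviation "I \<equiv> {1..n}"
abbreviation "wg p \<equiv> exp (phi p)"
definition v :: "point \<Rightarrow> real" where "v p = wg p * u p"
definition V :: "nat \<Rightarrow> point \<Rightarrow> real" where "V i p = wg p * (pd i u p + phi1 i p * u p)"
definition Hf :: "nat \<Rightarrow> nat \<Rightarrow> point \<Rightarrow> real" where
  "Hf j i p = wg p * (pd j (pd i u) p + (phi2 j i p * u p + phi1 i p * pd j u p)) + wg p * phi1 j p * (pd i u p + phi1 i p * u p)"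
definition Bf :: "nat \<Rightarrow> point \<Rightarrow> real" where "Bf k p = (\<Sum>l\<in>I. a k l p * phi1 l p)"
definition Ff :: "point \<Rightarrow> real" where "Ff p = (3 / 4 * a n n p + c) * (gf p * iy p) + \<Theta> * tau p"
definition Wf :: "point \<Rightarrow> real" where "Wf p = (\<Sum>k\<in>I. Bf k p * phi1 k p) - phi1 0 p"
definition wf :: "nat \<Rightarrow> point \<Rightarrow> real" where "wf i p = (\<Sum>j\<in>I. a i j p * V j p)"
definition bef :: "point \<Rightarrow> real" where "bef p = (\<Sum>k\<in>I. Bf k p * V k p)"
definition sf :: "point \<Rightarrow> real" where "sf p = (\<Sum>i\<in>I. wf i p * V i p)"
text \<open>The fluxes whose derivatives are \<open>DX\<close> and \<open>DY\<close> of the locale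
  \<open>jet\<close>; component 0 is the time flux.\<close>

definition Xf :: "nat \<Rightarrow> point \<Rightarrow> real" where
  "Xf i p = (if i = 0 then Wf p * (v p * v p) - sf p
     else 2 * (wf i p * V 0 p) - 4 * (wf i p * bef p) + 2 * (Bf i p * sf p)
       - 2 * (wf i p * (Ff p * v p)) - 2 * (Wf p * (Bf i p * (v p * v p))))"

lemma has_pd_wg: "p \<in> Om n \<Longrightarrow> i \<le> n \<Longrightarrow> has_pd i (\<lambda>p. wg p) p (wg p * phi1 i p)"
  by (rule has_pd_chain[OF DERIV_exp has_pd_phi])

lemma has_pd_v: "p \<in> Om n \<Longrightarrow> i \<le> n \<Longrightarrow> has_pd i v p (V i p)"
  unfolding v_def[abs_def] V_def
  by (rule has_pd_eqI, rule has_pd_mult[OF has_pd_wg u_pd]) (simp_all add: algebra_simps)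

lemma has_pd_V: "p \<in> Om n \<Longrightarrow> i \<le> n \<Longrightarrow> j \<le> n \<Longrightarrow> has_pd j (V i) p (Hf j i p)"
  unfolding V_def[abs_def] Hf_def
  by (rule has_pd_eqI, rule has_pd_mult[OF has_pd_wg has_pd_add[OF u_pd2 has_pd_mult[OF has_pd_phi1 u_pd]]])
    (simp_all add: algebra_simps)

lemma Hf_commute: "p \<in> Om n \<Longrightarrow> i \<le> n \<Longrightarrow> j \<le> n \<Longrightarrow> Hf j i p = Hf i j p"
  unfolding Hf_def using phi2_commute[of j i p] u_comm[of j i p] by (simp add: algebra_simps)

text \<open>The fluxes contain the coefficients undifferentiated and only first derivatives of
  \<open>phi\<close> and \<open>u\<close>, and \<open>slip\<close> is stable under sums and products
  on the box. Hence everything under the divergence is separately Lipschitz although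
  \<open>a\<close> is no better than Lipschitz.\<close>

lemma slip_conjugated:
  shows "slip n B v" "i \<le> n \<Longrightarrow> slip n B (V i)" "k \<in> I \<Longrightarrow> slip n B (Bf k)" "slip n B Ff" "slip n B Wf"
    "i \<in> I \<Longrightarrow> slip n B (wf i)" "slip n B bef" "slip n B sf" "i \<le> n \<Longrightarrow> slip n B (Xf i)"
proof -
  note m = slip_mult[OF _ _ compact_cuboid box_sub]
  note d = slip_diff[OF _ _ compact_cuboid box_sub]
  note phi = slip_phi[OF box_sub] and base = slip_base[OF box_sub]
  show v: "slip n B v" unfolding v_def[abs_def] by (rule m[OF phi(5) slip_u(1)])
  show V: "slip n B (V i)" if "i \<le> n" for i
    unfolding V_def[abs_def] by (rule m[OF phi(5) slip_add[OF slip_u(2)[OF that] m[OF phi(3) slip_u(1)]]])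
  show Bf: "slip n B (Bf k)" if "k \<in> I" for k
    unfolding Bf_def[abs_def] by (rule slip_sum) (rule m[OF slip_a[OF that] phi(3)])
  have nI: "n \<in> I" using n1 by simp
  show F: "slip n B Ff"
    unfolding Ff_def[abs_def]
    by (rule slip_add[OF m[OF slip_add[OF m[OF slip_const slip_a[OF nI nI]] slip_const] phi(4)] m[OF slip_const base(1)]])
  show W: "slip n B Wf"
    unfolding Wf_def[abs_def] by (rule d[OF slip_sum phi(3)]) (rule m[OF Bf phi(3)])
  show w: "slip n B (wf i)" if "i \<in> I" for i
    unfolding wf_def[abs_def]
  proof (rule slip_sum)
    fix j assume j: "j \<in> I"
    then have "j \<le> n" by simp
    show "slip n B (\<lambda>p. a i j p * V j p)" by (rule m[OF slip_a[OF that j] V[OF \<open>j \<le> n\<close>]])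
  qed
  show be: "slip n B bef"
    unfolding bef_def[abs_def]
  proof (rule slip_sum)
    fix k assume k: "k \<in> I"
    then have "k \<le> n" by simp
    show "slip n B (\<lambda>p. Bf k p * V k p)" by (rule m[OF Bf[OF k] V[OF \<open>k \<le> n\<close>]])
  qed
  show s: "slip n B sf"
    unfolding sf_def[abs_def]
  proof (rule slip_sum)
    fix k assume k: "k \<in> I"
    then have "k \<le> n" by simp
    show "slip n B (\<lambda>p. wf k p * V k p)" by (rule m[OF w[OF k] V[OF \<open>k \<le> n\<close>]])
  qed
  show "slip n B (Xf i)" if i: "i \<le> n" for i
  proof (cases "i = 0")
    case True
    have eq: "Xf i = (\<lambda>p. Wf p * (v p * v p) - sf p)" by (rule ext) (simp add: Xf_def True)
    show ?thesis unfolding eq by (rule d[OF m[OF W m[OF v v]] s])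
  next
    case False
    then have iI: "i \<in> I" using i by simp
    have eq: "Xf i = (\<lambda>p. 2 * (wf i p * V 0 p) - 4 * (wf i p * bef p) + 2 * (Bf i p * sf p)
       - 2 * (wf i p * (Ff p * v p)) - 2 * (Wf p * (Bf i p * (v p * v p))))"
      by (rule ext) (simp add: Xf_def False)
    note m2 = m[OF slip_const]
    show ?thesis unfolding eq
      by (rule d[OF d[OF slip_add[OF d[OF m2[OF m[OF w[OF iI] V[OF le0]]] m2[OF m[OF w[OF iI] be]]] m2[OF m[OF Bf[OF iI] s]]]
            m2[OF m[OF w[OF iI] m[OF F v]]]] m2[OF m[OF W m[OF Bf[OF iI] m[OF v v]]]]])
  qed
qed

lemma pd_u_zero: "p \<in> Om n \<Longrightarrow> p \<notin> S \<Longrightarrow> i \<le> n \<Longrightarrow> pd i u p = 0"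
  by (rule has_pd_imp_pd, rule has_pd_outside_support[OF closed_K u_zero])

lemma Xf_zero:
  assumes p: "p \<in> Om n" "p \<notin> S"
  shows "Xf i p = 0"
proof -
  have V: "V i p = 0" if "i \<le> n" for i using u_zero[OF p] pd_u_zero[OF p that] by (simp add: V_def)
  have w: "wf i p = 0" for i unfolding wf_def using V by (intro sum.neutral) simp
  have "sf p = 0" unfolding sf_def using w by simp
  moreover have "v p = 0" using u_zero[OF p] by (simp add: v_def)
  ultimately show ?thesis using w unfolding Xf_def by simp
qed

definition regular_at :: "point \<Rightarrow> bool" where
  "regular_at p \<longleftrightarrow> (\<forall>i\<in>I. \<forall>j\<in>I. (\<forall>k\<le>n. has_pd k (a i j) p (pd k (a i j) p)) \<and> \<bar>pd 0 (a i j) p\<bar> \<le> Mb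
     \<and> (\<forall>k\<in>I. \<bar>pd k (a i j) p\<bar> \<le> E / L2_set (fst p) I))"

lemma pointwise_bound:
  assumes p: "p \<in> S" and regular_at: "regular_at p"
  shows "\<forall>i\<le>n. \<exists>d. has_pd i (Xf i) p d"
    and "(wg p)\<^sup>2 * ((u p)\<^sup>2 + (\<Sum>i\<in>I. (pd i u p)\<^sup>2)) + (\<Sum>i\<in>I. pd i (Xf i) p) + pd 0 (Xf 0) p
      \<le> (wg p)\<^sup>2 * (pd 0 u p + (\<Sum>i\<in>I. \<Sum>j\<in>I. pd i (a i j) p * pd j u p + a i j p * pd i (pd j u) p))\<^sup>2"
proof -
  have Om: "p \<in> Om n" using p K_Om by blast
  note op = Om_pos[OF Om]
  have xn: "fst p n = crd n p" using n1 by (simp add: crd_def)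
  have nI: "n \<in> I" using n1 by simp
  have da: "has_pd k (a i j) p (pd k (a i j) p)" if "i \<in> I" "j \<in> I" "k \<le> n" for i j k
    using regular_at that unfolding regular_at_def by blast
  interpret cp: carleman_point n lam Lam "\<lambda>i j. a i j p" "\<lambda>k i j. pd k (a i j) p" "fst p" "tau p" "gf p" "qf p" b c c1 \<Theta> K Mb E
  proof unfold_locales
    show "1 \<le> n" "0 < lam" "lam \<le> Lam" using n1 lam by auto
    show "1 \<le> fst p n" by (rule S_xn[OF p])
    show "1 \<le> tau p" using op unfolding tau_def by (simp add: le_divide_eq)
    have t: "1 \<le> crd 0 p powr (- K)"
    proof -
      have "crd 0 p powr K \<le> 1" using op K0 powr_mono2[of K "crd 0 p" 1] by simp
      moreover have "crd 0 p powr K > 0" using op by simp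
      ultimately show ?thesis by (simp add: powr_minus one_le_inverse_iff)
    qed
    show "0 \<le> gf p" using mult_left_mono[OF t, of \<gamma>] \<gamma>0 by (simp add: gf_def qf_def)
    show "gf p \<le> qf p" using \<gamma>0 by (simp add: gf_def)
    show "a i j p = a j i p" if "i \<in> I" "j \<in> I" for i j by (rule a_sym[OF that Om])
    show "lam * (L2_set \<xi> I)\<^sup>2 \<le> (\<Sum>i\<in>I. \<Sum>j\<in>I. a i j p * \<xi> i * \<xi> j)" for \<xi> by (rule ell[OF Om])
    show "(\<Sum>i\<in>I. \<Sum>j\<in>I. a i j p * \<xi> i * \<xi> j) \<le> Lam * (L2_set \<xi> I)\<^sup>2" for \<xi> by (rule ell[OF Om])
    show "\<bar>pd 0 (a i j) p\<bar> \<le> Mb" if "i \<in> I" "j \<in> I" for i j using regular_at that unfolding regular_at_def by blast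
    show "\<bar>pd k (a i j) p\<bar> \<le> E / L2_set (fst p) I" if "k \<in> I" "i \<in> I" "j \<in> I" for k i j
      using regular_at that unfolding regular_at_def by blast
  qed (fact pos A1 A2 A3 A4 A5 A6 A7 A8 A9)+
  \<comment> \<open>From here to \<open>P00\<close> the functions of the locale
    \<open>weight\<close>, evaluated at \<open>p\<close>, are matched with the numbers of
    \<open>carleman_point\<close>.\<close>
  have e: "cp.e = en" by (rule ext) (simp add: cp.e_def en_def)
  have ka: "cp.\<kappa> = ka" by (simp add: cp.\<kappa>_def ka_def)
  have cr: "crd i p = fst p i" if "i \<noteq> 0" for i using that by (simp add: crd_def)
  have rf: "L2_set (fst p) I = rf p"
    unfolding rf_def L2_set_def by (intro arg_cong[where f = sqrt] sum.cong refl) (simp add: crd_def)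
  have y: "cp.y = yf p" by (simp add: cp.y_def yf_def xn)
  have rho: "cp.\<rho> = gf p * iy p" unfolding cp.\<rho>_def y iy_def by simp
  have psi1: "cp.psi1 (fst p) i = psi1f i p" if "i \<in> I" for i
    using that unfolding cp.psi1_def psi1f_def e ka rf xn ir_def by (simp add: cr algebra_simps)
  have psi2: "cp.psi2 (fst p) j i = psi2f j i p" if "i \<in> I" "j \<in> I" for i j
    using that unfolding cp.psi2_def psi2f_def e ka rf xn ir_def by (simp add: cr algebra_simps)
  have psi: "psi n Lam lam (fst p) = psif p"
    unfolding psi_def psif_def rf xn ka_def by (simp add: power2_eq_square)
  have \<eta>: "cp.\<eta> i = phi1 i p" if "i \<in> I" for i
    using that unfolding cp.\<eta>_def phi1_def y e psi1[OF that] by simp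
  have P2: "cp.P2 j i = phi2 j i p" if "i \<in> I" "j \<in> I" for i j
    using that unfolding cp.P2_def phi2_def rho e psi2[OF that] by simp
  have P02: "cp.P02 i = phi2 0 i p" "cp.P02 i = phi2 i 0 p" if "i \<in> I" for i
    using that unfolding cp.P02_def phi2_def y e psi1[OF that] by simp_all
  have P0: "cp.P0 = phi1 0 p"
    unfolding cp.P0_def phi1_def y psi by (simp add: power2_eq_square power3_eq_cube)
  have P00: "cp.P00 = phi2 0 0 p"
    unfolding cp.P00_def phi2_def y psi by simp
  interpret J: jet n "\<lambda>i j. a i j p" "\<lambda>k i j. pd k (a i j) p" "v p" "\<lambda>i. V i p" "\<lambda>j i. Hf j i p"
    "cp.Av cp.\<eta>" cp.dB cp.F cp.W cp.dF cp.dW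
    by unfold_locales (rule a_sym, assumption+, rule Om, rule Hf_commute[OF Om], assumption+)
  have Bf: "Bf k p = cp.Av cp.\<eta> k" for k
    unfolding Bf_def cp.Av_def by (intro sum.cong refl) (simp add: \<eta>)
  have Bf': "has_pd i (Bf k) p (\<Sum>l\<in>I. pd i (a k l) p * phi1 l p + a k l p * phi2 i l p)" if "k \<in> I" "i \<le> n" for i k
    unfolding Bf_def[abs_def]
  proof (rule has_pd_sum)
    fix l assume l: "l \<in> I"
    then have "l \<le> n" by simp
    show "has_pd i (\<lambda>q. a k l q * phi1 l q) p (pd i (a k l) p * phi1 l p + a k l p * phi2 i l p)"
      by (rule has_pd_mult[OF da[OF that(1) l that(2)] has_pd_phi1[OF Om that(2) \<open>l \<le> n\<close>]])
  qed
  have dB: "has_pd i (Bf k) p (cp.dB i k)" if "i \<in> I" "k \<in> I" for i k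
  proof -
    have "(\<Sum>l\<in>I. pd i (a k l) p * phi1 l p + a k l p * phi2 i l p) = cp.dB i k"
      unfolding cp.dB_def
    proof (intro sum.cong refl)
      fix l assume l: "l \<in> I"
      show "pd i (a k l) p * phi1 l p + a k l p * phi2 i l p = pd i (a k l) p * cp.\<eta> l + a k l p * cp.P2 i l"
        unfolding \<eta>[OF l] P2[OF l that(1)] ..
    qed
    then show ?thesis using Bf'[of k i] that by simp
  qed
  have w: "wf i p = J.w i" for i unfolding wf_def J.w_def ..
  have dw: "has_pd k (wf i) p (J.dw k i)" if "i \<in> I" "k \<le> n" for i k
    unfolding wf_def[abs_def] J.dw_def
  proof (rule has_pd_sum)
    fix j assume j: "j \<in> I"
    then have "j \<le> n" by simp
    show "has_pd k (\<lambda>q. a i j q * V j q) p (pd k (a i j) p * V j p + a i j p * Hf k j p)"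
      by (rule has_pd_mult[OF da[OF that(1) j that(2)] has_pd_V[OF Om \<open>j \<le> n\<close> that(2)]])
  qed
  have be: "bef p = J.be" unfolding bef_def J.be_def Bf ..
  have dbe: "has_pd i bef p (J.dbe i)" if i: "i \<in> I" for i
    unfolding bef_def[abs_def] J.dbe_def Bf[symmetric]
  proof (rule has_pd_sum)
    fix k assume k: "k \<in> I"
    then have "k \<le> n" "i \<le> n" using i by simp_all
    show "has_pd i (\<lambda>q. Bf k q * V k q) p (cp.dB i k * V k p + Bf k p * Hf i k p)"
      by (rule has_pd_mult[OF dB[OF i k] has_pd_V[OF Om \<open>k \<le> n\<close> \<open>i \<le> n\<close>]])
  qed
  have s: "sf p = J.s" unfolding sf_def J.s_def w ..
  have ds: "has_pd k sf p (J.ds k)" if k: "k \<le> n" for k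
    unfolding sf_def[abs_def] J.ds_def w[symmetric]
  proof (rule has_pd_sum)
    fix i assume i: "i \<in> I"
    then have "i \<le> n" by simp
    show "has_pd k (\<lambda>q. wf i q * V i q) p (J.dw k i * V i p + wf i p * Hf k i p)"
      by (rule has_pd_mult[OF dw[OF i k] has_pd_V[OF Om \<open>i \<le> n\<close> k]])
  qed
  have F: "Ff p = cp.F" unfolding Ff_def cp.F_def rho ..
  have dF: "has_pd i Ff p (cp.dF i)" if i: "i \<in> I" for i
  proof -
    have i': "i \<le> n" "i \<noteq> 0" using i by simp_all
    have "has_pd i Ff p ((3 / 4 * pd i (a n n) p + 0) * (gf p * iy p)
       + (3 / 4 * a n n p + c) * (- (gf p * (en i * iy p * iy p * iy p / 2))) + \<Theta> * (if i = 0 then - (tau p * tau p) else 0))"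
      unfolding Ff_def[abs_def]
      by (rule has_pd_add[OF has_pd_mult[OF has_pd_add[OF has_pd_cmult[OF da[OF nI nI i'(1)]] has_pd_const]
            has_pd_rho[OF Om i']] has_pd_cmult[OF has_pd_tau[OF Om]]])
    moreover have "gf p * (en i * iy p * iy p * iy p / 2) = gf p / (2 * yf p ^ 3) * en i"
      by (simp add: iy_def power3_eq_cube)
    ultimately show ?thesis unfolding cp.dF_def rho e y
      by (elim has_pd_eqI) (use i' in \<open>simp add: mult_ac\<close>)
  qed
  have W: "Wf p = cp.W" unfolding Wf_def cp.W_def cp.Af_def P0 Bf by (simp add: \<eta>)
  have dW: "has_pd k Wf p (cp.dW k)" if k: "k \<le> n" for k
  proof -
    define P where "P i = (if k = 0 then cp.P02 i else cp.P2 k i)" for i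
    have P: "P i = phi2 k i p" if "i \<in> I" for i using that k P02 P2 unfolding P_def by simp
    have "has_pd k Wf p ((\<Sum>i\<in>I. (\<Sum>l\<in>I. pd k (a i l) p * phi1 l p + a i l p * phi2 k l p) * phi1 i p + Bf i p * phi2 k i p) - phi2 k 0 p)"
      unfolding Wf_def[abs_def]
    proof (rule has_pd_diff[OF has_pd_sum has_pd_phi1[OF Om k le0]])
      fix i assume i: "i \<in> I"
      then have "i \<le> n" by simp
      show "has_pd k (\<lambda>q. Bf i q * phi1 i q) p ((\<Sum>l\<in>I. pd k (a i l) p * phi1 l p + a i l p * phi2 k l p) * phi1 i p + Bf i p * phi2 k i p)"
        by (rule has_pd_mult[OF Bf'[OF i k] has_pd_phi1[OF Om k \<open>i \<le> n\<close>]])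
    qed
    moreover have "(\<Sum>i\<in>I. (\<Sum>l\<in>I. pd k (a i l) p * phi1 l p + a i l p * phi2 k l p) * phi1 i p + Bf i p * phi2 k i p)
      = (\<Sum>i\<in>I. \<Sum>j\<in>I. pd k (a i j) p * cp.\<eta> i * cp.\<eta> j) + 2 * (\<Sum>i\<in>I. cp.Av cp.\<eta> i * P i)"
    proof -
      have "(\<Sum>i\<in>I. (\<Sum>l\<in>I. pd k (a i l) p * phi1 l p + a i l p * phi2 k l p) * phi1 i p + Bf i p * phi2 k i p)
        = (\<Sum>i\<in>I. (\<Sum>l\<in>I. pd k (a i l) p * cp.\<eta> l + a i l p * P l) * cp.\<eta> i + cp.Av cp.\<eta> i * P i)"
        unfolding Bf by (intro sum.cong refl arg_cong2[where f = "(+)"] arg_cong2[where f = "(*)"]) (simp_all add: \<eta> P)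
      also have "\<dots> = (\<Sum>i\<in>I. \<Sum>l\<in>I. pd k (a i l) p * cp.\<eta> i * cp.\<eta> l) + (\<Sum>i\<in>I. \<Sum>l\<in>I. a i l p * P l * cp.\<eta> i) + (\<Sum>i\<in>I. cp.Av cp.\<eta> i * P i)"
        unfolding sum.distrib[symmetric]
      proof (intro sum.cong refl arg_cong2[where f = "(+)"])
        fix i
        show "(\<Sum>l\<in>I. pd k (a i l) p * cp.\<eta> l + a i l p * P l) * cp.\<eta> i
          = (\<Sum>l\<in>I. pd k (a i l) p * cp.\<eta> i * cp.\<eta> l + a i l p * P l * cp.\<eta> i)"
          unfolding sum_distrib_right by (intro sum.cong refl) (simp add: distrib_right)
      qed
      also have "(\<Sum>i\<in>I. \<Sum>l\<in>I. a i l p * P l * cp.\<eta> i) = (\<Sum>i\<in>I. cp.Av cp.\<eta> i * P i)"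
        unfolding cp.Av_def sum_distrib_right
        by (subst sum.swap, intro sum.cong refl) (simp add: a_sym[OF _ _ Om])
      finally show ?thesis by simp
    qed
    moreover have "phi2 k 0 p = (if k = 0 then cp.P00 else cp.P02 k)" using k P02(2)[of k] P00 by simp
    ultimately show ?thesis unfolding cp.dW_def P_def by simp
  qed
  have DX: "has_pd i (Xf i) p (J.DX i)" if i: "i \<in> I" for i
  proof -
    have i': "i \<le> n" "i \<noteq> 0" using i by simp_all
    have eq: "Xf i = (\<lambda>p. 2 * (wf i p * V 0 p) - 4 * (wf i p * bef p) + 2 * (Bf i p * sf p)
       - 2 * (wf i p * (Ff p * v p)) - 2 * (Wf p * (Bf i p * (v p * v p))))"
      by (rule ext) (simp add: Xf_def i')
    note c = has_pd_cmult and m = has_pd_mult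
    have "has_pd i (Xf i) p (2 * (J.dw i i * V 0 p + wf i p * Hf i 0 p) - 4 * (J.dw i i * bef p + wf i p * J.dbe i)
       + 2 * (cp.dB i i * sf p + Bf i p * J.ds i) - 2 * (J.dw i i * (Ff p * v p) + wf i p * (cp.dF i * v p + Ff p * V i p))
       - 2 * (cp.dW i * (Bf i p * (v p * v p)) + Wf p * (cp.dB i i * (v p * v p) + Bf i p * (V i p * v p + v p * V i p))))"
      unfolding eq
      by (rule has_pd_diff[OF has_pd_diff[OF has_pd_add[OF has_pd_diff[OF c[OF m[OF dw[OF i i'(1)] has_pd_V[OF Om le0 i'(1)]]]
          c[OF m[OF dw[OF i i'(1)] dbe[OF i]]]] c[OF m[OF dB[OF i i] ds[OF i'(1)]]]]
          c[OF m[OF dw[OF i i'(1)] m[OF dF[OF i] has_pd_v[OF Om i'(1)]]]]]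
          c[OF m[OF dW[OF i'(1)] m[OF dB[OF i i] m[OF has_pd_v[OF Om i'(1)] has_pd_v[OF Om i'(1)]]]]]])
    moreover have "V i p * v p + v p * V i p = 2 * v p * V i p" by simp
    ultimately show ?thesis by (simp only: J.DX_def w be s Bf F W power2_eq_square)
  qed
  have DY: "has_pd 0 (Xf 0) p J.DY"
  proof -
    have eq: "Xf 0 = (\<lambda>p. Wf p * (v p * v p) - sf p)" by (rule ext) (simp add: Xf_def)
    have "has_pd 0 (Xf 0) p (cp.dW 0 * (v p * v p) + Wf p * (V 0 p * v p + v p * V 0 p) - J.ds 0)"
      unfolding eq
      by (rule has_pd_diff[OF has_pd_mult[OF dW[OF le0] has_pd_mult[OF has_pd_v[OF Om le0] has_pd_v[OF Om le0]]] ds[OF le0]])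
    moreover have "cp.dW 0 * (v p * v p) + Wf p * (V 0 p * v p + v p * V 0 p) - J.ds 0 = J.DY"
      unfolding J.DY_def W power2_eq_square by (simp only: mult.commute[of "V 0 p" "v p"] mult_2 distrib_right)
    ultimately show ?thesis by (rule has_pd_eqI)
  qed
  show "\<forall>i\<le>n. \<exists>d. has_pd i (Xf i) p d"
  proof (intro allI impI)
    fix i assume "i \<le> n"
    then show "\<exists>d. has_pd i (Xf i) p d" using DX[of i] DY by (cases "i = 0") auto
  qed
  define Pu where "Pu = pd 0 u p + (\<Sum>i\<in>I. \<Sum>j\<in>I. pd i (a i j) p * pd j u p + a i j p * pd i (pd j u) p)"
  define Sv where "Sv = (\<Sum>i\<in>I. J.dw i i) + cp.W * v p"
  define Tv where "Tv = V 0 p - 2 * J.be - cp.F * v p"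
  have op: "wg p * Pu = Sv + cp.R * v p + Tv"
  proof -
    have "(\<Sum>i\<in>I. J.dw i i) = (\<Sum>i\<in>I. \<Sum>j\<in>I. pd i (a i j) p * (wg p * (pd j u p + cp.\<eta> j * u p))
       + a i j p * (wg p * (pd i (pd j u) p + (cp.P2 i j * u p + cp.\<eta> j * pd i u p)) + wg p * cp.\<eta> i * (pd j u p + cp.\<eta> j * u p)))"
      unfolding J.dw_def
    proof (intro sum.cong refl)
      fix i j assume ij: "i \<in> I" "j \<in> I"
      show "pd i (a i j) p * V j p + a i j p * Hf i j p = pd i (a i j) p * (wg p * (pd j u p + cp.\<eta> j * u p))
         + a i j p * (wg p * (pd i (pd j u) p + (cp.P2 i j * u p + cp.\<eta> j * pd i u p)) + wg p * cp.\<eta> i * (pd j u p + cp.\<eta> j * u p))"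
        unfolding V_def Hf_def \<eta>[OF ij(1)] \<eta>[OF ij(2)] P2[OF ij(2,1)] ..
    qed
    also have "\<dots> = wg p * (\<Sum>i\<in>I. \<Sum>j\<in>I. pd i (a i j) p * pd j u p + a i j p * pd i (pd j u) p)
       + (\<Sum>i\<in>I. \<Sum>j\<in>I. pd i (a i j) p * cp.\<eta> j + a i j p * cp.P2 i j) * (wg p * u p)
       + 2 * (\<Sum>k\<in>I. (\<Sum>l\<in>I. a k l p * cp.\<eta> l) * (wg p * (pd k u p + cp.\<eta> k * u p)))
       - (\<Sum>k\<in>I. (\<Sum>l\<in>I. a k l p * cp.\<eta> l) * cp.\<eta> k) * (wg p * u p)"
      by (rule conjugated_operator_algebra) (rule a_sym[OF _ _ Om])
    also have "(\<Sum>i\<in>I. \<Sum>j\<in>I. pd i (a i j) p * cp.\<eta> j + a i j p * cp.P2 i j) = (\<Sum>i\<in>I. cp.dB i i)"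
      unfolding cp.dB_def ..
    also have "(\<Sum>k\<in>I. (\<Sum>l\<in>I. a k l p * cp.\<eta> l) * (wg p * (pd k u p + cp.\<eta> k * u p))) = J.be"
      unfolding J.be_def cp.Av_def by (intro sum.cong refl) (simp add: V_def \<eta>)
    also have "(\<Sum>k\<in>I. (\<Sum>l\<in>I. a k l p * cp.\<eta> l) * cp.\<eta> k) = cp.W + phi1 0 p"
      unfolding cp.W_def P0 cp.Af_def cp.Av_def by simp
    finally have fin: "(\<Sum>i\<in>I. J.dw i i) = wg p * (\<Sum>i\<in>I. \<Sum>j\<in>I. pd i (a i j) p * pd j u p + a i j p * pd i (pd j u) p)
       + (\<Sum>i\<in>I. cp.dB i i) * (wg p * u p) + 2 * J.be - (cp.W + phi1 0 p) * (wg p * u p)" .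
    \<comment> \<open>Each sum is treated as a single variable, which reduces the claim to an
      identity between real numbers.\<close>
    have generic: "w * (p0 + D) = (dw + W * (w * u)) + (F - DB) * (w * u) + (w * (p0 + ph * u) - 2 * be - F * (w * u))"
      if "dw = w * D + DB * (w * u) + 2 * be - (W + ph) * (w * u)" for dw w D DB u be W ph F p0 :: real
      unfolding that by (simp add: algebra_simps)
    have V0: "V 0 p = wg p * (pd 0 u p + phi1 0 p * u p)" and vv: "v p = wg p * u p"
      unfolding V_def v_def by simp_all
    show ?thesis unfolding Sv_def Tv_def cp.R_def Pu_def V0 vv by (rule generic[OF fin])
  qed
  have "2 * Sv * Tv = (\<Sum>i\<in>I. J.DX i) + J.DY + J.Qf"
    using J.divergence_identity unfolding Sv_def Tv_def .
  moreover have "(wg p)\<^sup>2 * Pu\<^sup>2 \<ge> 2 * Sv * Tv - cp.R\<^sup>2 * (v p)\<^sup>2"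
    using square_ge_cross_term[where S = Sv and R = cp.R and v = "v p" and T = Tv] unfolding op[symmetric] by (simp add: power_mult_distrib)
  moreover have "J.Qf - cp.R\<^sup>2 * (v p)\<^sup>2 \<ge> 2 * (L2_set (\<lambda>i. V i p) I)\<^sup>2 + (1 + 2 * (L2_set cp.\<eta> I)\<^sup>2) * (v p)\<^sup>2"
    by (rule cp.pointwise_inequality[OF Hf_commute[OF Om]])
  moreover have "(wg p)\<^sup>2 * ((u p)\<^sup>2 + (\<Sum>i\<in>I. (pd i u p)\<^sup>2)) \<le> 2 * (L2_set (\<lambda>i. V i p) I)\<^sup>2 + (1 + 2 * (L2_set cp.\<eta> I)\<^sup>2) * (v p)\<^sup>2"
  proof -
    \<comment> \<open>Since \<open>\<nabla>v = exp \<phi> (\<nabla>u + \<eta> u)\<close>, the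
      weighted gradient of \<open>u\<close> is \<open>V - \<eta> v\<close>; squaring this difference
      explains both factors 2 in the lower bound of the form.\<close>
    have "(wg p)\<^sup>2 * (\<Sum>i\<in>I. (pd i u p)\<^sup>2) = (\<Sum>i\<in>I. (V i p - cp.\<eta> i * v p)\<^sup>2)"
      unfolding sum_distrib_left
    proof (intro sum.cong refl)
      fix i assume i: "i \<in> I"
      have "wg p * pd i u p = V i p - cp.\<eta> i * v p" by (simp add: V_def v_def \<eta>[OF i] algebra_simps)
      then show "(wg p)\<^sup>2 * (pd i u p)\<^sup>2 = (V i p - cp.\<eta> i * v p)\<^sup>2" by (simp only: power_mult_distrib[symmetric])
    qed
    also have "\<dots> \<le> (\<Sum>i\<in>I. 2 * (V i p)\<^sup>2 + 2 * (v p)\<^sup>2 * (cp.\<eta> i)\<^sup>2)"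
    proof (rule sum_mono)
      fix i
      have "0 \<le> (V i p + cp.\<eta> i * v p)\<^sup>2" by simp
      then show "(V i p - cp.\<eta> i * v p)\<^sup>2 \<le> 2 * (V i p)\<^sup>2 + 2 * (v p)\<^sup>2 * (cp.\<eta> i)\<^sup>2"
        by (simp add: power2_eq_square algebra_simps)
    qed
    also have "\<dots> = 2 * (L2_set (\<lambda>i. V i p) I)\<^sup>2 + 2 * (v p)\<^sup>2 * (L2_set cp.\<eta> I)\<^sup>2"
      unfolding L2_set_sq sum.distrib sum_distrib_left ..
    finally have 1: "(wg p)\<^sup>2 * (\<Sum>i\<in>I. (pd i u p)\<^sup>2) \<le> 2 * (L2_set (\<lambda>i. V i p) I)\<^sup>2 + 2 * (v p)\<^sup>2 * (L2_set cp.\<eta> I)\<^sup>2" .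
    have 2: "(wg p)\<^sup>2 * ((u p)\<^sup>2 + (\<Sum>i\<in>I. (pd i u p)\<^sup>2)) = (v p)\<^sup>2 + (wg p)\<^sup>2 * (\<Sum>i\<in>I. (pd i u p)\<^sup>2)"
      unfolding v_def distrib_left power_mult_distrib ..
    have "x + 2 * x * z = (1 + 2 * z) * x" for x z :: real by (simp add: algebra_simps)
    from this[of "(v p)\<^sup>2" "(L2_set cp.\<eta> I)\<^sup>2"] show ?thesis using 1 unfolding 2 by linarith
  qed
  moreover have "(\<Sum>i\<in>I. pd i (Xf i) p) = (\<Sum>i\<in>I. J.DX i)" by (intro sum.cong refl has_pd_imp_pd DX)
  moreover have "pd 0 (Xf 0) p = J.DY" by (rule has_pd_imp_pd[OF DY])
  ultimately show "(wg p)\<^sup>2 * ((u p)\<^sup>2 + (\<Sum>i\<in>I. (pd i u p)\<^sup>2)) + (\<Sum>i\<in>I. pd i (Xf i) p) + pd 0 (Xf 0) p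
      \<le> (wg p)\<^sup>2 * (pd 0 u p + (\<Sum>i\<in>I. \<Sum>j\<in>I. pd i (a i j) p * pd j u p + a i j p * pd i (pd j u) p))\<^sup>2"
    unfolding Pu_def by linarith
qed

end

section \<open>Integration of the pointwise bound\<close>

context carleman
begin

text \<open>The products \<open>a i j * pd j u\<close> are kept unexpanded, as in
  \<open>parabolic_op\<close>. They are separately Lipschitz, so the general lemmas make their
  derivatives measurable and essentially bounded; the product rule is applied at regular points
  only.\<close>

definition gij :: "nat \<Rightarrow> nat \<Rightarrow> point \<Rightarrow> real" where "gij i j p = a i j p * pd j u p"
definition Pop :: "point \<Rightarrow> real" where "Pop p = pd 0 u p + (\<Sum>i\<in>I. \<Sum>j\<in>I. pd i (gij i j) p)"

lemma has_pd_gij: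
  assumes "p \<in> S" "regular_at p" "i \<in> I" "j \<in> I"
  shows "has_pd i (gij i j) p (pd i (a i j) p * pd j u p + a i j p * pd i (pd j u) p)"
proof -
  have "i \<le> n" "j \<le> n" "p \<in> Om n" using assms K_Om by auto
  moreover have "has_pd i (a i j) p (pd i (a i j) p)"
    using assms \<open>i \<le> n\<close> unfolding regular_at_def by blast
  ultimately show ?thesis unfolding gij_def[abs_def] by (intro has_pd_mult u_pd2)
qed

lemma slip_gij: "i \<in> I \<Longrightarrow> j \<in> I \<Longrightarrow> slip n B (gij i j)"
  unfolding gij_def[abs_def] by (rule slip_mult[OF slip_a slip_u(2) compact_cuboid box_sub]) auto

lemma AE_has_pd:
  assumes "AE p in M. p \<in> S \<longrightarrow> regular_at p" "\<And>p. p \<in> S \<Longrightarrow> regular_at p \<Longrightarrow> \<exists>d. has_pd i f p d"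
  shows "AE p in M. p \<in> S \<longrightarrow> (\<exists>d. has_pd i f p d)"
  by (rule AE_mp[OF assms(1)]) (rule AE_I2, use assms(2) in blast)

lemma AE_bounded_sum:
  assumes "finite J" "\<And>j. j \<in> J \<Longrightarrow> \<exists>C. AE p in M. p \<in> S \<longrightarrow> \<bar>f j p\<bar> \<le> C"
  shows "\<exists>C. AE p in M. p \<in> S \<longrightarrow> \<bar>\<Sum>j\<in>J. f j p :: real\<bar> \<le> C"
proof -
  obtain C where C: "\<And>j. j \<in> J \<Longrightarrow> AE p in M. p \<in> S \<longrightarrow> \<bar>f j p\<bar> \<le> C j" using assms(2) by metis
  then have "AE p in M. \<forall>j\<in>J. p \<in> S \<longrightarrow> \<bar>f j p\<bar> \<le> C j" unfolding AE_finite_all[OF assms(1)] by blast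
  then have "AE p in M. p \<in> S \<longrightarrow> \<bar>\<Sum>j\<in>J. f j p\<bar> \<le> (\<Sum>j\<in>J. C j)"
  proof (rule AE_mp, intro AE_I2 impI)
    fix p assume "\<forall>j\<in>J. p \<in> S \<longrightarrow> \<bar>f j p\<bar> \<le> C j" "p \<in> S"
    then show "\<bar>\<Sum>j\<in>J. f j p\<bar> \<le> (\<Sum>j\<in>J. C j)"
      by (intro order_trans[OF sum_abs] sum_mono) simp
  qed
  then show ?thesis by blast
qed

lemma measurable_Pop: "(\<lambda>p. indicator S p * Pop p) \<in> borel_measurable M"
proof -
  have "(\<lambda>p. indicator S p * pd 0 u p + (\<Sum>i\<in>I. \<Sum>j\<in>I. indicator S p * pd i (gij i j) p)) \<in> borel_measurable M"
  proof (intro borel_measurable_add borel_measurable_sum)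
    show "(\<lambda>p. indicator S p * pd 0 u p) \<in> borel_measurable M"
      by (rule measurable_K_pd[OF slip_continuous[OF slip_u(1)] le0])
    fix i j assume ij: "i \<in> I" "j \<in> I"
    then have "i \<le> n" by simp
    then show "(\<lambda>p. indicator S p * pd i (gij i j) p) \<in> borel_measurable M"
      by (rule measurable_K_pd[OF slip_continuous[OF slip_gij[OF ij]]])
  qed
  then show ?thesis unfolding Pop_def by (simp only: distrib_left sum_distrib_left)
qed

lemma Pop_bounded:
  assumes "AE p in M. p \<in> S \<longrightarrow> regular_at p"
  shows "\<exists>C. AE p in M. p \<in> S \<longrightarrow> \<bar>Pop p\<bar> \<le> C"
proof -
  have "\<exists>C. AE p in M. p \<in> S \<longrightarrow> \<bar>\<Sum>i\<in>I. \<Sum>j\<in>I. pd i (gij i j) p\<bar> \<le> C"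
  proof (intro AE_bounded_sum)
    fix i j assume ij: "i \<in> I" "j \<in> I"
    then have "i \<le> n" by simp
    have "AE p in M. p \<in> S \<longrightarrow> (\<exists>d. has_pd i (gij i j) p d)"
      by (rule AE_has_pd[OF assms]) (use has_pd_gij ij in blast)
    then show "\<exists>C. AE p in M. p \<in> S \<longrightarrow> \<bar>pd i (gij i j) p\<bar> \<le> C"
      by (rule pd_bounded[OF slip_gij[OF ij] \<open>i \<le> n\<close>])
  qed simp_all
  then obtain C1 where C1: "AE p in M. p \<in> S \<longrightarrow> \<bar>\<Sum>i\<in>I. \<Sum>j\<in>I. pd i (gij i j) p\<bar> \<le> C1" by blast
  have "AE p in M. p \<in> S \<longrightarrow> (\<exists>d. has_pd 0 u p d)"
    by (rule AE_has_pd[OF assms]) (use u_pd[OF le0] K_Om in blast)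
  then obtain C0 where C0: "AE p in M. p \<in> S \<longrightarrow> \<bar>pd 0 u p\<bar> \<le> C0"
    using pd_bounded[OF slip_u(1) le0] by blast
  have "AE p in M. p \<in> S \<longrightarrow> \<bar>Pop p\<bar> \<le> C0 + C1"
    using C0 C1 by eventually_elim (auto simp: Pop_def intro: order_trans[OF abs_triangle_ineq])
  then show ?thesis by blast
qed

lemma slip_wg2: "slip n B (\<lambda>p. (wg p)\<^sup>2)"
  unfolding power2_eq_square by (rule slip_mult[OF slip_phi(5)[OF box_sub] slip_phi(5)[OF box_sub] compact_cuboid box_sub])

lemma integrable_slip:
  assumes "slip n B f"
  shows "integrable M (\<lambda>p. indicator S p * f p)"
proof -
  obtain C where "\<forall>p\<in>B. \<bar>f p\<bar> \<le> C" using slip_bounded[OF assms compact_cuboid box_sub] by blast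
  then have "AE p in M. p \<in> S \<longrightarrow> \<bar>f p\<bar> \<le> C" using K_sub by (intro AE_I2) blast
  then show ?thesis by (rule integrable_K_bounded[OF measurable_K[OF slip_continuous[OF assms]]])
qed

text \<open>A Bochner integral of a non-integrable function is 0 by convention, so comparing the
  integrals requires integrability of the right-hand side. It holds since \<open>Pop\<close> is
  essentially bounded on \<open>S\<close>.\<close>

lemma integrable_rhs:
  assumes "AE p in M. p \<in> S \<longrightarrow> regular_at p"
  shows "integrable M (\<lambda>p. indicator S p * ((wg p)\<^sup>2 * (Pop p)\<^sup>2))"
proof -
  obtain C where C: "AE p in M. p \<in> S \<longrightarrow> \<bar>Pop p\<bar> \<le> C" using Pop_bounded[OF assms] by blast
  obtain D where D: "D \<ge> 0" "\<forall>p\<in>B. \<bar>(wg p)\<^sup>2\<bar> \<le> D" using slip_bounded[OF slip_wg2 compact_cuboid box_sub] by blast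
  show ?thesis
  proof (rule integrable_K_bounded)
    have "(\<lambda>p. (indicator S p * (wg p)\<^sup>2) * (indicator S p * Pop p)\<^sup>2) \<in> borel_measurable M"
      by (intro borel_measurable_times borel_measurable_power measurable_Pop
          measurable_K slip_continuous[OF slip_wg2])
    moreover have "(indicator S p * (wg p)\<^sup>2) * (indicator S p * Pop p)\<^sup>2 = indicator S p * ((wg p)\<^sup>2 * (Pop p)\<^sup>2)" for p
      by (simp add: indicator_def)
    ultimately show "(\<lambda>p. indicator S p * ((wg p)\<^sup>2 * (Pop p)\<^sup>2)) \<in> borel_measurable M" by (simp only:)
    show "AE p in M. p \<in> S \<longrightarrow> \<bar>(wg p)\<^sup>2 * (Pop p)\<^sup>2\<bar> \<le> D * C\<^sup>2"
    proof (rule AE_mp[OF C], intro AE_I2 impI)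
      fix p assume 1: "p \<in> S \<longrightarrow> \<bar>Pop p\<bar> \<le> C" and p: "p \<in> S"
      then have "\<bar>Pop p\<bar>\<^sup>2 \<le> C\<^sup>2" by (intro power_mono) simp_all
      moreover have "\<bar>(wg p)\<^sup>2\<bar> \<le> D" using D(2) subsetD[OF K_sub p] by blast
      ultimately show "\<bar>(wg p)\<^sup>2 * (Pop p)\<^sup>2\<bar> \<le> D * C\<^sup>2"
        unfolding abs_mult using D(1) by (intro mult_mono) simp_all
    qed
  qed
qed

lemma integral_inequality:
  assumes ae: "AE p in M. p \<in> S \<longrightarrow> regular_at p"
  shows "(LINT p|M. indicator S p * ((wg p)\<^sup>2 * ((u p)\<^sup>2 + (\<Sum>i\<in>I. (pd i u p)\<^sup>2))))
    \<le> (LINT p|M. indicator S p * ((wg p)\<^sup>2 * (Pop p)\<^sup>2))"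
proof -
  let ?f = "\<lambda>p. indicator S p * ((wg p)\<^sup>2 * ((u p)\<^sup>2 + (\<Sum>i\<in>I. (pd i u p)\<^sup>2)))"
  let ?R = "\<lambda>p. indicator S p * ((wg p)\<^sup>2 * (Pop p)\<^sup>2)"
  let ?X = "\<lambda>i p. indicator S p * pd i (Xf i) p"
  have sq: "slip n B (\<lambda>p. (f p)\<^sup>2)" if "slip n B f" for f
    unfolding power2_eq_square by (rule slip_mult[OF that that compact_cuboid box_sub])
  have f: "integrable M ?f"
  proof (rule integrable_slip, rule slip_mult[OF slip_wg2 slip_add[OF sq[OF slip_u(1)] slip_sum] compact_cuboid box_sub])
    fix i assume "i \<in> I"
    then have "i \<le> n" by simp
    then show "slip n B (\<lambda>p. (pd i u p)\<^sup>2)" by (intro sq slip_u(2))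
  qed
  have D: "AE p in M. p \<in> S \<longrightarrow> (\<exists>d. has_pd i (Xf i) p d)" if "i \<le> n" for i
    by (rule AE_has_pd[OF ae]) (use pointwise_bound(1) that in blast)
  have X: "integrable M (?X i)" "integral\<^sup>L M (?X i) = 0" if "i \<le> n" for i
    by (rule integrable_pd[OF slip_conjugated(9)[OF that] that D[OF that]])
      (rule integral_pd_eq_0[OF slip_conjugated(9)[OF that] that Xf_zero D[OF that]])
  have sX: "integrable M (\<lambda>p. \<Sum>i\<in>I. ?X i p)"
    by (rule Bochner_Integration.integrable_sum) (use X(1) in simp)
  have "(LINT p|M. (\<Sum>i\<in>I. ?X i p)) = (\<Sum>i\<in>I. integral\<^sup>L M (?X i))"
    by (rule Bochner_Integration.integral_sum) (use X(1) in simp)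
  also have "\<dots> = 0" using X(2) by (intro sum.neutral) simp
  finally have s0: "(LINT p|M. (\<Sum>i\<in>I. ?X i p)) = 0" .
  have "(LINT p|M. ?f p + (\<Sum>i\<in>I. ?X i p) + ?X 0 p) \<le> (LINT p|M. ?R p)"
  proof (rule integral_mono_AE)
    show "integrable M (\<lambda>p. ?f p + (\<Sum>i\<in>I. ?X i p) + ?X 0 p)"
      by (rule Bochner_Integration.integrable_add[OF Bochner_Integration.integrable_add[OF f sX] X(1)[OF le0]])
    show "integrable M ?R" by (rule integrable_rhs[OF ae])
    show "AE p in M. ?f p + (\<Sum>i\<in>I. ?X i p) + ?X 0 p \<le> ?R p"
    proof (rule AE_mp[OF ae], intro AE_I2 impI)
      fix p assume gp: "p \<in> S \<longrightarrow> regular_at p"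
      show "?f p + (\<Sum>i\<in>I. ?X i p) + ?X 0 p \<le> ?R p"
      proof (cases "p \<in> S")
        case True
        with gp have g: "regular_at p" by simp
        have "Pop p = pd 0 u p + (\<Sum>i\<in>I. \<Sum>j\<in>I. pd i (a i j) p * pd j u p + a i j p * pd i (pd j u) p)"
          unfolding Pop_def by (intro arg_cong2[where f = "(+)"] refl sum.cong has_pd_imp_pd has_pd_gij[OF True g])
        then show ?thesis using pointwise_bound(2)[OF True g] True by simp
      next
        case False
        then show ?thesis by simp
      qed
    qed
  qed
  moreover have "(LINT p|M. ?f p + (\<Sum>i\<in>I. ?X i p) + ?X 0 p) = (LINT p|M. ?f p) + (LINT p|M. (\<Sum>i\<in>I. ?X i p)) + (LINT p|M. ?X 0 p)"
    by (simp only: Bochner_Integration.integral_add[OF Bochner_Integration.integrable_add[OF f sX] X(1)[OF le0]]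
        Bochner_Integration.integral_add[OF f sX])
  ultimately show ?thesis using s0 X(2)[OF le0] by simp
qed

lemma weight_eq:
  assumes p: "p \<in> Om n"
  shows "carleman_weight n Lam lam (3/2) b K \<gamma> p = (wg p)\<^sup>2"
proof -
  obtain x t where pt: "p = (x, t)" by (cases p)
  have t: "crd 0 p = t" and x: "crd n p = x n" using n1 by (simp_all add: crd_def pt)
  have r: "L2_set x I = rf p"
    unfolding rf_def L2_set_def by (intro arg_cong[where f = sqrt] sum.cong refl) (simp add: crd_def pt)
  have psi: "psi n Lam lam x = psif p"
    unfolding psi_def psif_def r x ka_def by (simp add: power2_eq_square)
  have x0: "x n > 0" using Om_pos(3)[OF p] x by simp
  have "x n powr (3/2) = x n powr (1 + 1/2)" by simp
  also have "\<dots> = x n * sqrt (x n)" using x0 by (simp only: powr_add powr_half_sqrt) simp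
  also have "\<dots> = yf p * yf p * yf p" using yf_sq[OF p] by (simp add: yf_def x)
  finally have X: "x n powr (3/2) = yf p * yf p * yf p" .
  have "2 * \<gamma> * (t powr (- K) - 1) * x n powr (3/2) - (b * psi n Lam lam x + K) / t = 2 * phi p"
    unfolding phi_def gf_def qf_def tau_def t psi X by (simp add: algebra_simps add_divide_distrib)
  then show ?thesis unfolding pt carleman_weight_def by (simp add: pt power2_eq_square exp_add[symmetric])
qed

text \<open>At points of \<open>Q_set n\<close> outside the closed set \<open>S\<close>, the
  functions \<open>u\<close> and \<open>gij i j\<close> vanish locally along the coordinate lines,
  hence so do the derivatives in both integrands, and the integrals reduce to
  \<open>S\<close>.\<close>

lemma set_integral_inequality:
  assumes ae: "AE p in M. p \<in> S \<longrightarrow> regular_at p" and SQ: "S \<subseteq> Q_set n"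
  shows "(LINT p:Q_set n|M. carleman_weight n Lam lam (3/2) b K \<gamma> p * (\<bar>u p\<bar>\<^sup>2 + (grad_norm n u p)\<^sup>2))
    \<le> (LINT p:Q_set n|M. carleman_weight n Lam lam (3/2) b K \<gamma> p * \<bar>parabolic_op n a u p\<bar>\<^sup>2)"
proof -
  have Q_Om: "Q_set n \<subseteq> Om n"
    unfolding Q_set_def Om_def Rn_plus_def by auto
  have grad: "(grad_norm n u p)\<^sup>2 = (\<Sum>i\<in>I. (pd i u p)\<^sup>2)" for p
    unfolding grad_norm_def L2_set_sq by (intro sum.cong refl) (simp add: partial_x_pd)
  have Pop: "parabolic_op n a u p = Pop p" for p
  proof -
    have "partial_x i (\<lambda>q. a i j q * partial_x j u q) p = pd i (gij i j) p" if "i \<in> I" "j \<in> I" for i j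
    proof -
      have "(\<lambda>q. a i j q * partial_x j u q) = gij i j"
        by (rule ext) (use that in \<open>simp add: gij_def partial_x_pd\<close>)
      then show ?thesis using that by (simp add: partial_x_pd)
    qed
    then show ?thesis unfolding parabolic_op_def Pop_def partial_t_pd by simp
  qed
  have zero: "pd i u p = 0" "pd i (gij i j) p = 0" "u p = 0" if "p \<in> Om n" "p \<notin> S" "i \<le> n" "j \<le> n" for p i j
  proof -
    show "pd i u p = 0" by (rule pd_u_zero[OF that(1-3)])
    show "u p = 0" by (rule u_zero[OF that(1,2)])
    show "pd i (gij i j) p = 0"
      by (rule has_pd_imp_pd, rule has_pd_outside_support[OF closed_K _ that(1-3)])
        (simp add: gij_def pd_u_zero that(4))
  qed
  have l: "indicator (Q_set n) p *\<^sub>R (carleman_weight n Lam lam (3/2) b K \<gamma> p * (\<bar>u p\<bar>\<^sup>2 + (grad_norm n u p)\<^sup>2))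
     = indicator S p * ((wg p)\<^sup>2 * ((u p)\<^sup>2 + (\<Sum>i\<in>I. (pd i u p)\<^sup>2)))" for p
  proof -
    consider "p \<in> S" "p \<in> Q_set n" | "p \<notin> S" "p \<in> Q_set n" | "p \<notin> S" "p \<notin> Q_set n" using SQ by blast
    then show ?thesis
    proof cases
      case 1
      then show ?thesis using weight_eq[OF subsetD[OF Q_Om 1(2)]] by (simp add: grad)
    next
      case 2
      have "(\<Sum>i\<in>I. (pd i u p)\<^sup>2) = 0" using zero(1)[OF subsetD[OF Q_Om 2(2)] 2(1) _ le0] by (intro sum.neutral) simp
      then show ?thesis using zero(3)[OF subsetD[OF Q_Om 2(2)] 2(1) le0 le0] 2 by (simp add: grad)
    qed simp
  qed
  have r: "indicator (Q_set n) p *\<^sub>R (carleman_weight n Lam lam (3/2) b K \<gamma> p * \<bar>parabolic_op n a u p\<bar>\<^sup>2)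
     = indicator S p * ((wg p)\<^sup>2 * (Pop p)\<^sup>2)" for p
  proof -
    consider "p \<in> S" "p \<in> Q_set n" | "p \<notin> S" "p \<in> Q_set n" | "p \<notin> S" "p \<notin> Q_set n" using SQ by blast
    then show ?thesis
    proof cases
      case 1
      then show ?thesis using weight_eq[OF subsetD[OF Q_Om 1(2)]] by (simp add: Pop)
    next
      case 2
      note z = zero[OF subsetD[OF Q_Om 2(2)] 2(1)]
      have "(\<Sum>i\<in>I. \<Sum>j\<in>I. pd i (gij i j) p) = 0" by (intro sum.neutral ballI z(2)) simp_all
      then have "Pop p = 0" unfolding Pop_def using z(1)[OF le0 le0] by simp
      then show ?thesis using 2 by (simp add: Pop)
    qed simp
  qed
  show ?thesis unfolding set_lebesgue_integral_def l r by (rule integral_inequality[OF ae])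
qed

end

text \<open>The constants are chosen in the order \<open>c1\<close>, \<open>c\<close>, \<open>b\<close> (from \<open>lam\<close> and \<open>Lam\<close> only), then \<open>E0\<close>,
  then \<open>\<Theta>\<close>, then \<open>K\<close>; only \<open>\<Theta>\<close> and \<open>K\<close> see the bound \<open>Mb\<close>.\<close>

lemma carleman_constants:
  fixes lam Lam :: real
  assumes lam: "0 < lam" "lam \<le> Lam"
  defines "Cp \<equiv> elliptic.C\<psi> lam Lam" and "D2 \<equiv> elliptic.C2 lam Lam"
  shows "\<exists>b>0. \<forall>n\<ge>1. \<exists>E0>0. \<forall>E. 0 < E \<and> E < E0 \<longrightarrow>
    (\<forall>Mb>0. \<exists>c c1 \<Theta> K. carleman_parameters n lam Lam b c c1 \<Theta> K Mb E)"
proof -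
  \<comment> \<open>An auxiliary instance in dimension 1 with the constant coefficient
    \<open>lam\<close>; it gives access to facts about \<open>C\<psi>\<close>, \<open>C2\<close> and
    \<open>\<kappa>\<close>, which depend on \<open>lam\<close> and \<open>Lam\<close> only.\<close>
  interpret e: elliptic 1 lam Lam "\<lambda>_ _. lam"
  proof unfold_locales
    fix \<xi> :: "nat \<Rightarrow> real"
    have "(\<Sum>i\<in>{1..1::nat}. \<Sum>j\<in>{1..1::nat}. lam * \<xi> i * \<xi> j) = lam * (L2_set \<xi> {1..1})\<^sup>2"
      unfolding L2_set_sq by (simp add: power2_eq_square)
    moreover have "lam * (L2_set \<xi> {1..1})\<^sup>2 \<le> Lam * (L2_set \<xi> {1..1})\<^sup>2"
      by (rule mult_right_mono[OF lam(2)]) simp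
    ultimately show "lam * (L2_set \<xi> {1..1})\<^sup>2 \<le> (\<Sum>i\<in>{1..1::nat}. \<Sum>j\<in>{1..1::nat}. lam * \<xi> i * \<xi> j)"
      "(\<Sum>i\<in>{1..1::nat}. \<Sum>j\<in>{1..1::nat}. lam * \<xi> i * \<xi> j) \<le> Lam * (L2_set \<xi> {1..1})\<^sup>2" by linarith+
  qed (use lam in simp_all)
  have Lam: "Lam > 0" using lam by linarith
  have Cp: "Cp > 0" unfolding Cp_def by (rule e.C\<psi>_pos)
  have D2: "D2 \<ge> 0" unfolding D2_def e.C2_def using e.\<kappa>1 Lam by simp
  \<comment> \<open>\<open>c1\<close> is the largest value that the last two parts of
    \<open>A5\<close> allow. With this \<open>c\<close> the term \<open>3 * Lam * c\<close> takes at
    most half of the budget \<open>3 / 2 * c1\<^sup>2\<close> in \<open>A5\<close>, and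
    \<open>b\<close> gives equality in \<open>A8\<close>.\<close>
  define c1 where "c1 = min lam ((Lam + lam) / Cp)"
  define c where "c = min lam (c1\<^sup>2 / (4 * Lam))"
  define b where "b = 1 / (4 * ((3 * Lam + 1) * Cp\<^sup>2))"
  have c1: "c1 > 0" "c1 \<le> lam" "c1 \<le> (Lam + lam) / Cp" using lam Lam Cp by (simp_all add: c1_def)
  have c1': "c1 * Cp \<le> Lam + lam" using c1(3) Cp by (simp add: pos_le_divide_eq)
  have c: "c > 0" "c \<le> lam" "c \<le> c1\<^sup>2 / (4 * Lam)" using lam Lam c1(1) by (simp_all add: c_def)
  have c': "3 * Lam * c \<le> 3 / 4 * c1\<^sup>2" using c(3) Lam by (simp add: pos_le_divide_eq mult_ac)
  have d: "(3 * Lam + 1) * Cp\<^sup>2 > 0" using Lam Cp by simp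
  have b: "b > 0" unfolding b_def using d by simp
  have b': "(3 * Lam + 1) * b * Cp\<^sup>2 \<le> 1 / 4"
  proof -
    have "D * (1 / (4 * D)) = 1 / 4" if "D > 0" for D :: real using that by simp
    from this[OF d] show ?thesis unfolding b_def by (simp only: mult_ac)
  qed
  have main: "\<exists>E0>0. \<forall>E. 0 < E \<and> E < E0 \<longrightarrow>
      (\<forall>Mb>0. \<exists>c c1 \<Theta> K. carleman_parameters n lam Lam b c c1 \<Theta> K Mb E)" if n: "n \<ge> 1" for n :: nat
  proof -
    define N where "N = real n"
    have N: "N > 0" using n by (simp add: N_def)
    \<comment> \<open>The three bounds ensure \<open>A1\<close>, the first part of
      \<open>A3\<close>, and that \<open>E\<close> stays within the other half of the budget in
      \<open>A5\<close>.\<close>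
    define E0 where "E0 = min (lam * c / (12 * N ^ 3 * Lam)) (min (c / (3 * N\<^sup>2)) (c1\<^sup>2 / (4 * N ^ 3 * Lam)))"
    have "E0 > 0" unfolding E0_def using lam c c1 N Lam by simp
    moreover have "\<exists>c c1 \<Theta> K. carleman_parameters n lam Lam b c c1 \<Theta> K Mb E"
      if E: "0 < E" "E < E0" and Mb: "0 < Mb" for E Mb
    proof -
      have E1: "12 * N ^ 3 * Lam * E \<le> lam * c" "3 * N\<^sup>2 * E \<le> c" "3 * N ^ 3 * Lam * E + 3 * Lam * c \<le> 3 / 2 * c1\<^sup>2"
      proof -
        have "E < lam * c / (12 * N ^ 3 * Lam)" "E < c / (3 * N\<^sup>2)" "E < c1\<^sup>2 / (4 * N ^ 3 * Lam)"
          using E unfolding E0_def by simp_all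
        then have 1: "E * (12 * N ^ 3 * Lam) < lam * c" "E * (3 * N\<^sup>2) < c" "E * (4 * N ^ 3 * Lam) < c1\<^sup>2"
          using N Lam by (simp_all only: pos_less_divide_eq mult_pos_pos zero_less_power zero_less_numeral)
        show "12 * N ^ 3 * Lam * E \<le> lam * c" "3 * N\<^sup>2 * E \<le> c" using 1(1,2) by (simp_all add: mult_ac)
        have "4 * (N ^ 3 * Lam * E) < c1\<^sup>2" using 1(3) by (simp add: mult_ac)
        moreover have "3 * N ^ 3 * Lam * E = 3 * (N ^ 3 * Lam * E)" by simp
        ultimately show "3 * N ^ 3 * Lam * E + 3 * Lam * c \<le> 3 / 2 * c1\<^sup>2" using c' by linarith
      qed
      define T2 where "T2 = 4 * N ^ 3 * Lam * E * b * Cp + N\<^sup>2 * Mb + 3 * b * N\<^sup>2 * Cp * Lam\<^sup>2 + 2"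
      define T3 where "T3 = N\<^sup>2 * E * b * Cp + b * N\<^sup>2 * Lam * Cp"
      define T4 where "T4 = 2 * b * N\<^sup>2 * Cp * Lam\<^sup>2 + N\<^sup>2 * Mb + N ^ 3 * Lam * E * b * Cp + 2"
      have T: "T2 \<ge> 0" "T3 \<ge> 0" "T4 \<ge> 0" unfolding T2_def T3_def T4_def using N Lam E b Cp Mb by simp_all
      \<comment> \<open>The sum of all required lower bounds: in \<open>A2\<close>,
        \<open>A3\<close> and \<open>A4\<close> the constant \<open>\<Theta>\<close> occurs on the
        right-hand side only.\<close>
      define \<Theta> where "\<Theta> = 4 + T2 / (2 * lam) + T3 + T4"
      have q: "T2 / (2 * lam) \<ge> 0" using T lam by simp
      have \<Theta>: "\<Theta> \<ge> 4" "T3 \<le> \<Theta>" "T4 \<le> \<Theta>" "T2 / (2 * lam) \<le> \<Theta>" using T q unfolding \<Theta>_def by linarith+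
      have \<Theta>2: "T2 \<le> 2 * lam * \<Theta>" using \<Theta>(4) lam by (simp add: pos_divide_le_eq mult_ac)
      define T6 where "T6 = 9 / 2 * ((3 * Lam + 1) * \<Theta>) + 9 / 2 * c\<^sup>2"
      define T7 where "T7 = 3 * b * D2 + 3 / 4 * b\<^sup>2 * D2\<^sup>2 + (N * (E + Lam + c) * Lam)\<^sup>2 / (lam * c)"
      define P where "P = 3 * b * D2 + 3 * \<Theta>"
      define T9 where "T9 = 9 / 2 * \<Theta>\<^sup>2 + 1"
      have T': "T6 / (6 * lam) \<ge> 0" "T7 \<ge> 0" "P \<ge> 0" "T9 \<ge> 0"
        unfolding T6_def T7_def P_def T9_def using lam Lam \<Theta>(1) b D2 c(1) by simp_all
      \<comment> \<open>The left-hand side of \<open>A7\<close> is \<open>K * P + T7\<close>, so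
        \<open>K \<ge> P + T7\<close> and \<open>K \<ge> 1\<close> let the quadratic right-hand side
        dominate; \<open>T6\<close> and \<open>T9\<close> serve \<open>A6\<close> and
        \<open>A9\<close>.\<close>
      define K where "K = 1 + T6 / (6 * lam) + P + T7 + T9"
      have K: "K \<ge> 1" "T6 / (6 * lam) \<le> K" "P + T7 \<le> K" "T9 \<le> K" using T' unfolding K_def by linarith+
      have K6: "T6 \<le> 6 * K * lam" using K(2) lam by (simp add: pos_divide_le_eq mult_ac)
      have "K * (P + T7) \<le> K * K" using K by (intro mult_left_mono) simp_all
      moreover have "1 * T7 \<le> K * T7" using K T' by (intro mult_right_mono) simp_all
      ultimately have "K * P + T7 \<le> K * (K + 1)" using K(1) unfolding distrib_left by linarith
      then have "3 * K * b * D2 + 3 * b * D2 + 3 / 4 * b\<^sup>2 * D2\<^sup>2 + 3 * \<Theta> * K + (N * (E + Lam + c) * Lam)\<^sup>2 / (lam * c) \<le> K * (K + 1)"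
        unfolding P_def T7_def by (simp add: algebra_simps)
      then have "carleman_parameters n lam Lam b c c1 \<Theta> K Mb E"
        using lam b c(1,2) c1(1,2) c1' b' \<Theta>(1) \<Theta>2 \<Theta>(2,3) K6 K(1,4) E1 E(1) Mb
        unfolding carleman_parameters_def Cp_def D2_def N_def T2_def T3_def T4_def T6_def T9_def by auto
      then show ?thesis by blast
    qed
    ultimately show ?thesis by blast
  qed
  then show ?thesis using b by blast
qed

section \<open>From the hypotheses of the theorem to the pointwise setting\<close>

lemma abs_pd_le_grad_norm: "i \<in> {1..n} \<Longrightarrow> \<bar>pd i f p\<bar> \<le> grad_norm n f p"
  using member_le_L2_set[of "{1..n}" i "\<lambda>i. \<bar>partial_x i f p\<bar>"]
  unfolding grad_norm_def L2_set_def by (simp add: partial_x_pd)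

lemma grad_norm_nonneg: "0 \<le> grad_norm n f p"
  unfolding grad_norm_def by (rule L2_set_nonneg)

lemma test_function_pd:
  assumes u: "test_function n u"
  shows "\<And>i p. i \<le> n \<Longrightarrow> p \<in> Om n \<Longrightarrow> has_pd i u p (pd i u p)"
    and "\<And>i j p. i \<le> n \<Longrightarrow> j \<le> n \<Longrightarrow> p \<in> Om n \<Longrightarrow> has_pd i (pd j u) p (pd i (pd j u) p)"
    and "\<And>i j p. i \<le> n \<Longrightarrow> j \<le> n \<Longrightarrow> p \<in> Om n \<Longrightarrow> pd i (pd j u) p = pd j (pd i u) p"
    and "cuboid n l r \<subseteq> Om n \<Longrightarrow> slip n (cuboid n l r) u"
    and "\<And>i. cuboid n l r \<subseteq> Om n \<Longrightarrow> i \<le> n \<Longrightarrow> slip n (cuboid n l r) (pd i u)"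
proof -
  have C: "C_k n k u" for k using u unfolding test_function_def by (elim conjE allE)
  \<comment> \<open>Three orders of smoothness, so that the second partials satisfy
    \<open>C_k\<close> with index 1 and are in particular continuous, as \<open>pd_commute\<close>
    and \<open>slip_C1\<close> require.\<close>
  note C0 = C[of "Suc (Suc (Suc 0))"]
  have C1: "C_k n (Suc (Suc 0)) (pd j u)" if "j \<le> n" for j by (rule C_k_Suc_pd(3)[OF C0 that])
  have C2: "C_k n (Suc 0) (pd i (pd j u))" if "i \<le> n" "j \<le> n" for i j by (rule C_k_Suc_pd(3)[OF C1[OF that(2)] that(1)])
  note h0 = C_k_Suc_pd(2)[OF C0] and h1 = C_k_Suc_pd(2)[OF C1]
  show "has_pd i u p (pd i u p)" if "i \<le> n" "p \<in> Om n" for i p by (rule h0[OF that])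
  show "has_pd i (pd j u) p (pd i (pd j u) p)" if "i \<le> n" "j \<le> n" "p \<in> Om n" for i j p
    by (rule h1[OF that(2,1,3)])
  show "pd i (pd j u) p = pd j (pd i u) p" if "i \<le> n" "j \<le> n" "p \<in> Om n" for i j p
    by (rule pd_commute[OF that(3,1,2) h0 h1 C_k_Suc_pd(1)[OF C2]])
  show "slip n (cuboid n l r) u" if B: "cuboid n l r \<subseteq> Om n"
    by (rule slip_C1[OF C_k_Suc_pd(1)[OF C0] h0 C_k_Suc_pd(1)[OF C1] B])
  show "slip n (cuboid n l r) (pd i u)" if B: "cuboid n l r \<subseteq> Om n" and i: "i \<le> n" for i
    by (rule slip_C1[OF C_k_Suc_pd(1)[OF C1[OF i]] h1[OF i] C_k_Suc_pd(1)[OF C2[OF _ i]] B])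
qed

lemma carleman_estimate:
  fixes a :: "nat \<Rightarrow> nat \<Rightarrow> point \<Rightarrow> real"
  assumes par: "carleman_parameters n lam Lam b c c1 \<Theta> K Mb E" and n: "n \<ge> 1"
    and a_sym: "\<forall>i\<in>{1..n}. \<forall>j\<in>{1..n}. \<forall>p \<in> Rn_plus n \<times> {0<..<1}. a i j p = a j i p"
    and ell: "\<forall>p \<in> Rn_plus n \<times> {0<..<1}. \<forall>\<xi> :: nat \<Rightarrow> real.
      lam * (L2_set \<xi> {1..n})\<^sup>2 \<le> (\<Sum>i=1..n. \<Sum>j=1..n. a i j p * \<xi> i * \<xi> j) \<and>
      (\<Sum>i=1..n. \<Sum>j=1..n. a i j p * \<xi> i * \<xi> j) \<le> Lam * (L2_set \<xi> {1..n})\<^sup>2"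
    and lip: "\<forall>i\<in>{1..n}. \<forall>j\<in>{1..n}. lipschitz_coeff n (a i j)"
    and ae: "\<forall>i\<in>{1..n}. \<forall>j\<in>{1..n}. AE p in spacetime_measure n. p \<in> Rn_plus n \<times> {0<..<1} \<longrightarrow>
      has_partials_at n (a i j) p \<and>
      grad_norm n (a i j) p + \<bar>partial_t (a i j) p\<bar> \<le> Mb \<and>
      grad_norm n (a i j) p \<le> E / L2_set (fst p) {1..n}"
    and u: "test_function n u" and \<gamma>: "\<gamma> > 0"
  shows "(LINT p:Q_set n|spacetime_measure n.
      carleman_weight n Lam lam (3/2) b K \<gamma> p * (\<bar>u p\<bar>\<^sup>2 + (grad_norm n u p)\<^sup>2))
    \<le> (LINT p:Q_set n|spacetime_measure n.
      carleman_weight n Lam lam (3/2) b K \<gamma> p * \<bar>parabolic_op n a u p\<bar>\<^sup>2)"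
proof -
  define S where "S = closure {p \<in> Rn n \<times> {0<..<1}. u p \<noteq> 0}"
  have S: "compact S" "S \<subseteq> Q_set n" using u unfolding test_function_def S_def by (simp_all only:)
  obtain l r \<delta> where box: "support_in_box n l r S \<delta>" using support_in_box_exists[OF n S] by (elim exE)
  note B = support_in_box.box_sub[OF box]
  interpret w: weight n lam Lam b c \<Theta> K \<gamma>
    using n carleman_parameters.pos(5)[OF par] \<gamma> by (rule weight.intro)
  have u0: "u p = 0" if "p \<in> Om n" "p \<notin> S" for p
  proof (rule ccontr)
    assume "u p \<noteq> 0"
    then have "p \<in> {p \<in> Rn n \<times> {0<..<1}. u p \<noteq> 0}"
      using that(1) by (cases p) (simp add: Om_def Rn_plus_def)
    then have "p \<in> S" unfolding S_def by (rule subsetD[OF closure_subset])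
    then show False using that(2) by contradiction
  qed
  interpret carleman n lam Lam b c c1 \<Theta> K Mb E \<gamma> l r S \<delta> a u
  proof (rule carleman.intro[OF par w.weight_axioms box], unfold_locales)
    fix i j p assume "i \<in> {1..n}" "j \<in> {1..n}" "p \<in> Om n"
    then show "a i j p = a j i p" unfolding Om_def by (rule a_sym[rule_format])
  next
    fix p \<xi> assume "p \<in> Om n"
    then show "lam * (L2_set \<xi> {1..n})\<^sup>2 \<le> (\<Sum>i=1..n. \<Sum>j=1..n. a i j p * \<xi> i * \<xi> j)"
      "(\<Sum>i=1..n. \<Sum>j=1..n. a i j p * \<xi> i * \<xi> j) \<le> Lam * (L2_set \<xi> {1..n})\<^sup>2"
      using ell unfolding Om_def by (simp_all only:)
  next
    fix i j assume "i \<in> {1..n}" "j \<in> {1..n}"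
    then show "slip n (cuboid n l r) (a i j)" by (intro slip_lipschitz_coeff[OF _ B] lip[rule_format])
  next
    fix p assume "p \<in> S"
    then have "p \<in> Q_set n" by (rule subsetD[OF S(2)])
    then show "1 \<le> fst p n" by (cases p) (simp add: Q_set_def)
  qed (fact test_function_pd(1-3)[OF u] test_function_pd(4,5)[OF u B] u0)+
  \<comment> \<open>There are finitely many index pairs, so their exceptional null sets can be
    united.\<close>
  have "AE p in spacetime_measure n. \<forall>i\<in>{1..n}. \<forall>j\<in>{1..n}. p \<in> Om n \<longrightarrow> has_partials_at n (a i j) p \<and>
      grad_norm n (a i j) p + \<bar>partial_t (a i j) p\<bar> \<le> Mb \<and> grad_norm n (a i j) p \<le> E / L2_set (fst p) {1..n}"
    using ae unfolding AE_finite_all[OF finite_atLeastAtMost] Om_def .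
  then have "AE p in spacetime_measure n. p \<in> S \<longrightarrow> regular_at p"
  proof (rule AE_mp, intro AE_I2 impI)
    fix p assume H: "\<forall>i\<in>{1..n}. \<forall>j\<in>{1..n}. p \<in> Om n \<longrightarrow> has_partials_at n (a i j) p \<and>
      grad_norm n (a i j) p + \<bar>partial_t (a i j) p\<bar> \<le> Mb \<and> grad_norm n (a i j) p \<le> E / L2_set (fst p) {1..n}"
      and "p \<in> S"
    then have p: "p \<in> Om n" using K_Om by (rule_tac subsetD)
    show "regular_at p" unfolding regular_at_def
    proof (intro ballI conjI allI impI)
      fix i j assume "i \<in> {1..n}" "j \<in> {1..n}"
      then have h: "has_partials_at n (a i j) p" "grad_norm n (a i j) p + \<bar>pd 0 (a i j) p\<bar> \<le> Mb"
        "grad_norm n (a i j) p \<le> E / L2_set (fst p) {1..n}" using H p unfolding partial_t_pd by simp_all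
      show "has_pd k (a i j) p (pd k (a i j) p)" if "k \<le> n" for k by (rule has_partials_at_has_pd[OF h(1) that])
      show "\<bar>pd 0 (a i j) p\<bar> \<le> Mb" using h(2) grad_norm_nonneg[of n "a i j" p] by linarith
      show "\<bar>pd k (a i j) p\<bar> \<le> E / L2_set (fst p) {1..n}" if "k \<in> {1..n}" for k
        using abs_pd_le_grad_norm[OF that, of "a i j" p] h(3) by linarith
    qed
  qed
  then show ?thesis using S(2) by (rule set_integral_inequality)
qed

theorem proposition1p4:
  fixes Lam lam :: real
  assumes "0 < lam" and "lam \<le> Lam"
  shows "\<exists>b>0. \<forall>n::nat. n \<ge> 1 \<longrightarrow>
    (\<exists>E0>0. \<forall>E. 0 < E \<and> E < E0 \<longrightarrow>
    (\<exists>\<alpha>. 1 < \<alpha> \<and> \<alpha> < 2 \<and> (\<forall>M>0. \<exists>K>0.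
    (\<forall>a :: nat \<Rightarrow> nat \<Rightarrow> point \<Rightarrow> real.
      (\<forall>i\<in>{1..n}. \<forall>j\<in>{1..n}. \<forall>p \<in> Rn_plus n \<times> {0<..<1}. a i j p = a j i p) \<longrightarrow>
      (\<forall>p \<in> Rn_plus n \<times> {0<..<1}. \<forall>\<xi> :: nat \<Rightarrow> real.
         lam * (L2_set \<xi> {1..n})\<^sup>2 \<le> (\<Sum>i=1..n. \<Sum>j=1..n. a i j p * \<xi> i * \<xi> j) \<and>
         (\<Sum>i=1..n. \<Sum>j=1..n. a i j p * \<xi> i * \<xi> j) \<le> Lam * (L2_set \<xi> {1..n})\<^sup>2) \<longrightarrow>
      (\<forall>i\<in>{1..n}. \<forall>j\<in>{1..n}. lipschitz_coeff n (a i j)) \<longrightarrow>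
      (\<forall>i\<in>{1..n}. \<forall>j\<in>{1..n}. AE p in spacetime_measure n. p \<in> Rn_plus n \<times> {0<..<1} \<longrightarrow>
         has_partials_at n (a i j) p \<and>
         grad_norm n (a i j) p + \<bar>partial_t (a i j) p\<bar> \<le> M \<and>
         grad_norm n (a i j) p \<le> E / L2_set (fst p) {1..n}) \<longrightarrow>
      (\<forall>u \<gamma>. test_function n u \<and> \<gamma> > 0 \<longrightarrow>
         (LINT p:Q_set n|spacetime_measure n.
            carleman_weight n Lam lam \<alpha> b K \<gamma> p * (\<bar>u p\<bar>\<^sup>2 + (grad_norm n u p)\<^sup>2))
         \<le> (LINT p:Q_set n|spacetime_measure n.
            carleman_weight n Lam lam \<alpha> b K \<gamma> p * \<bar>parabolic_op n a u p\<bar>\<^sup>2))))))"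
proof -
  obtain b where b: "b > 0" and main: "\<forall>n\<ge>1. \<exists>E0>0. \<forall>E. 0 < E \<and> E < E0 \<longrightarrow>
    (\<forall>Mb>0. \<exists>c c1 \<Theta> K. carleman_parameters n lam Lam b c c1 \<Theta> K Mb E)"
    using carleman_constants[OF assms] by (elim exE conjE)
  show ?thesis
  proof (rule exI[of _ b], intro conjI b allI impI, goal_cases)
    case (1 n)
    then obtain E0 where E0: "E0 > 0" and par: "\<forall>E. 0 < E \<and> E < E0 \<longrightarrow>
      (\<forall>Mb>0. \<exists>c c1 \<Theta> K. carleman_parameters n lam Lam b c c1 \<Theta> K Mb E)"
      using main by iprover
    note n = 1
    show ?case
    proof (rule exI[of _ E0], intro conjI E0 allI impI, goal_cases)
      case (1 E)
      note E = 1
      show ?case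
      \<comment> \<open>One exponent serves all dimensions and all \<open>E\<close>; only
        \<open>K\<close> is chosen after \<open>M\<close> is known.\<close>
      proof (rule exI[of _ "3/2"], intro conjI allI impI, goal_cases)
        case (3 M)
        then obtain c c1 \<Theta> K where K: "carleman_parameters n lam Lam b c c1 \<Theta> K M E"
          using par E by iprover
        show ?case
        proof (rule exI[of _ K], intro conjI allI impI, goal_cases)
          case 1
          show ?case by (rule carleman_parameters.pos(5)[OF K])
        next
          case (2 a u \<gamma>)
          then show ?case by (elim conjE) (rule carleman_estimate[OF K n])
        qed
      qed simp_all
    qed
  qed
qed

end
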